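(* Let $(X,d)$ be a compact metric space with topological dimension $\dim(X)>1$ and let $\phi$ be a regular expansive continuous flow on $X$. If $K\subset X$ is a compact, $\phi$-invariant subset of topological dimension one, then there is a minimal subset of $X$ disjoint from $K$.
   Context: A continuous flow is a continuous map $\phi\colon\mathbb{R}\times X\to X$, $\phi_t=\phi(t,\cdot)$, with $\phi_0=\mathrm{id}$, $\phi_{t+s}=\phi_s\circ\phi_t$; regular means no fixed points. $K$ invariant means $\phi_t(K)=K$ for all $t$. A minimal subset is a nonempty compact invariant set with no nonempty proper compact invariant subset. Let $Rep$ be the set of increasing homeomorphisms $h\colon\mathbb{R}\to\mathbb{R}$ with $h(0)=0$. $\phi$ is expansive if for every $\varepsilon>0$ there is $\delta>0$ such that whenever $x,y\in X$, $h\in Rep$ and $d(\phi_t(x),\phi_{h(t)}(y))\le\delta$ for all $t\in\mathbb{R}$, then $y\in\phi_{[-\varepsilon,\varepsilon]}(x)$. *)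

theory Defs
  imports "HOL-Analysis.Analysis"
begin

definition covering_dim_le :: "'a::metric_space set \<Rightarrow> nat \<Rightarrow> bool" where
  "covering_dim_le S n \<longleftrightarrow>
     (\<forall>C. finite C \<and> (\<forall>U\<in>C. openin (top_of_set S) U) \<and> \<Union>C = S \<longrightarrow>
        (\<exists>D. finite D \<and> (\<forall>V\<in>D. openin (top_of_set S) V) \<and> \<Union>D = S \<and>
             (\<forall>V\<in>D. \<exists>U\<in>C. V \<subseteq> U) \<and>
             (\<forall>x\<in>S. card {V\<in>D. x \<in> V} \<le> n + 1)))"

definition continuous_flow :: "'a::metric_space set \<Rightarrow> (real \<Rightarrow> 'a \<Rightarrow> 'a) \<Rightarrow> bool" where
  "continuous_flow X \<phi> \<longleftrightarrow>
     continuous_on (UNIV \<times> X) (\<lambda>(t, x). \<phi> t x) \<and>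
     (\<forall>t. \<phi> t ` X \<subseteq> X) \<and>
     (\<forall>x\<in>X. \<phi> 0 x = x) \<and>
     (\<forall>t s. \<forall>x\<in>X. \<phi> (t + s) x = \<phi> s (\<phi> t x))"

definition regular_flow :: "'a set \<Rightarrow> (real \<Rightarrow> 'a \<Rightarrow> 'a) \<Rightarrow> bool" where
  "regular_flow X \<phi> \<longleftrightarrow> (\<forall>x\<in>X. \<exists>t. \<phi> t x \<noteq> x)"

definition flow_invariant :: "(real \<Rightarrow> 'a \<Rightarrow> 'a) \<Rightarrow> 'a set \<Rightarrow> bool" where
  "flow_invariant \<phi> K \<longleftrightarrow> (\<forall>t. \<phi> t ` K = K)"

definition minimal_subset :: "'a::metric_space set \<Rightarrow> (real \<Rightarrow> 'a \<Rightarrow> 'a) \<Rightarrow> 'a set \<Rightarrow> bool" where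
  "minimal_subset X \<phi> M \<longleftrightarrow>
     M \<subseteq> X \<and> M \<noteq> {} \<and> compact M \<and> flow_invariant \<phi> M \<and>
     (\<forall>N. N \<subseteq> M \<and> N \<noteq> {} \<and> compact N \<and> flow_invariant \<phi> N \<longrightarrow> N = M)"

definition Rep :: "(real \<Rightarrow> real) set" where
  "Rep = {h. strict_mono h \<and> (\<exists>g. homeomorphism UNIV UNIV h g) \<and> h 0 = 0}"

definition expansive_flow :: "'a::metric_space set \<Rightarrow> (real \<Rightarrow> 'a \<Rightarrow> 'a) \<Rightarrow> bool" where
  "expansive_flow X \<phi> \<longleftrightarrow>
     (\<forall>\<epsilon>>0. \<exists>\<delta>>0. \<forall>x\<in>X. \<forall>y\<in>X. \<forall>h\<in>Rep.
        (\<forall>t. dist (\<phi> t x) (\<phi> (h t) y) \<le> \<delta>) \<longrightarrow> (\<exists>s\<in>{-\<epsilon>..\<epsilon>}. y = \<phi> s x))"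

end

theory Submission
  imports Defs
begin

text \<open>
  Near each point \<open>x\<close> the level set of \<open>y \<mapsto> \<integral>\<^sub>0\<^sup>T d(\<phi>\<^sub>s y, x) ds\<close> through \<open>x\<close>
  is a local cross section, provided that \<open>T\<close> moves every point. As \<open>dim X > 1\<close>, some cross section
  contains an arbitrarily small nontrivial continuum, for otherwise \<open>X\<close> would be covered by finitely many
  boxes \<open>Z \<times> [-a, a]\<close> with \<open>Z\<close> zero-dimensional. By expansivity this continuum, carried along the flow and
  projected to cross sections, grows to a fixed size in one of the two time directions, say forward.
  As \<open>dim K = 1\<close>, a cross section of \<open>K\<close> contains no nontrivial continuum, because \<open>C \<times> [0, 1]\<close> does not
  map into \<open>K\<close> with opposite sides disjoint. Hence a continuum of the fixed size contains a smaller one at a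
  definite distance from \<open>K\<close>, which by expansivity grows again within a bounded time. Iterating
  gives orbits that stay away from \<open>K\<close> for arbitrarily long times, and thus a nonempty compact invariant set
  disjoint from \<open>K\<close>.
\<close>

section \<open>Boundary bumping\<close>

text \<open>Expansivity is a two-sided condition, but growth is needed in one time direction and
  with constants that do not deteriorate under iteration. Each continuum is therefore kept together
  with a \<open>history\<close>: N backward steps along which its points stay \<delta>-close. Two of
  its points that are not on a common short orbit arc must then separate within N forward steps,
  where N depends only on the flow and on the bound \<theta> for being off such an arc. Cutting at
  the first moment of growth yields a continuum with the same constants and again a
  \<open>history\<close>, since its points were close at the N preceding steps. Distance to K is
  controlled only at the cutting times; between two of them a bounded time passes, so invariance of
  K and uniform continuity do the rest. The two time directions are used contrapositively: without a
  minimal set off K no small continuum ever grows, forward or backward, so any two of its points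
  track each other for all times and lie on one short orbit arc, which forces dim X \<le> 1.\<close>

lemma connected_or_separated:
  fixes A :: "'a::metric_space set"
  assumes "compact A" "compact S" "compact T" "S \<subseteq> A" "T \<subseteq> A"
    and dis: "\<And>C. C \<subseteq> A \<Longrightarrow> connected C \<Longrightarrow> C \<inter> S = {} \<or> C \<inter> T = {}"
  obtains P Q where "P \<union> Q = A" "P \<inter> Q = {}" "S \<subseteq> P" "T \<subseteq> Q"
    "openin (top_of_set A) P" "openin (top_of_set A) Q" "compact P" "compact Q"
proof -
  have "separated_between (top_of_set A) S T"
  proof (rule cut_wire_fence_theorem_gen)
    show "compact_space (top_of_set A)"
      using assms by (simp add: compact_space_subtopology)
    show "Hausdorff_space (top_of_set A) \<or> regular_space (top_of_set A) \<or> normal_space (top_of_set A)"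
      by (simp add: Hausdorff_space_subtopology)
    show "compactin (top_of_set A) S"
      using assms by (simp add: compactin_subtopology)
    show "closedin (top_of_set A) T"
      using assms by (simp add: closed_subset compact_imp_closed)
    show "disjnt C S \<or> disjnt C T" if "connectedin (top_of_set A) C" for C
      using dis[of C] that by (simp add: connectedin_subtopology disjnt_def)
  qed
  then obtain P Q where PQ: "openin (top_of_set A) P" "openin (top_of_set A) Q" "P \<union> Q = A"
      "disjnt P Q" "S \<subseteq> P" "T \<subseteq> Q"
    unfolding separated_between_def by auto
  have "P = A - Q" "Q = A - P"
    using PQ by (auto simp: disjnt_def)
  then have "closedin (top_of_set A) P" "closedin (top_of_set A) Q"
    using PQ by (metis closedin_diff closedin_topspace topspace_euclidean_subtopology)+
  then have "compact P" "compact Q"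
    using assms(1) closedin_compact by auto
  then show ?thesis
    by (intro that[of P Q] PQ) (use PQ(4) in \<open>simp add: disjnt_def\<close>)
qed

text \<open>If no connected subset of the ball part joined p to the sphere, a clopen piece around p
  could be split off inside the ball, and it would be clopen in all of D. This cuts from a large
  continuum a small one that still has a prescribed extent.\<close>

lemma boundary_bumping_cball:
  fixes D :: "'a::metric_space set"
  assumes D: "compact D" "connected D" "p \<in> D" and r: "r > 0" and z: "z \<in> D" "dist p z \<ge> r"
  obtains E q where "E \<subseteq> D" "compact E" "connected E" "p \<in> E" "q \<in> E" "dist p q = r" "E \<subseteq> cball p r"
proof -
  let ?A = "D \<inter> cball p r"
  let ?T = "D \<inter> cball p r - ball p r"
  have cA: "compact ?A" using D by (simp add: compact_Int_closed)
  then have cT: "compact ?T" by (simp add: compact_diff)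
  have "\<exists>C. C \<subseteq> ?A \<and> connected C \<and> p \<in> C \<and> C \<inter> ?T \<noteq> {}"
  proof (rule ccontr)
    assume "\<not> ?thesis"
    then have dis: "C \<inter> {p} = {} \<or> C \<inter> ?T = {}" if "C \<subseteq> ?A" "connected C" for C
      using that by blast
    have sub: "{p} \<subseteq> ?A" "?T \<subseteq> ?A" using D r by auto
    obtain P Q where PQ: "P \<union> Q = ?A" "P \<inter> Q = {}" "{p} \<subseteq> P" "?T \<subseteq> Q" "compact P" "compact Q"
      by (rule connected_or_separated[OF cA compact_sing cT sub dis])
    have "D \<subseteq> P \<union> (Q \<union> (D - ball p r))" using PQ(1) ball_subset_cball[of p r] by blast
    moreover have "P \<inter> (Q \<union> (D - ball p r)) = {}"
    proof -
      have "x \<notin> D - ball p r" if "x \<in> P" for x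
      proof
        assume "x \<in> D - ball p r"
        moreover have "x \<in> ?A" using that PQ(1) by blast
        ultimately have "x \<in> ?T" by blast
        then show False using PQ(2,4) that by blast
      qed
      then show ?thesis using PQ(2) by blast
    qed
    moreover have "closed P" "closed (Q \<union> (D - ball p r))"
      using PQ(5,6) D(1) by (simp_all add: closed_Un closed_Diff compact_imp_closed)
    moreover have "p \<in> P \<inter> D" using PQ(3) D(3) by blast
    moreover have "z \<in> (Q \<union> (D - ball p r)) \<inter> D" using z by simp
    ultimately show False using D(2) unfolding connected_closed by blast
  qed
  then obtain C q where C: "C \<subseteq> ?A" "connected C" "p \<in> C" "q \<in> C" "q \<in> ?T" by blast
  \<comment> \<open>The connected set C need not be closed; its closure is, and it stays in the
    compact set \<open>?A\<close>.\<close>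
  have "closure C \<subseteq> ?A"
    by (rule closure_minimal[OF C(1) compact_imp_closed[OF cA]])
  moreover have "compact (closure C)"
    using calculation cA closed_Int_compact[OF closed_closure, of ?A C] by (simp add: Int_absorb2)
  moreover have "p \<in> closure C" "q \<in> closure C" using C closure_subset by auto
  ultimately show ?thesis
    using that[of "closure C" q] C(2,5) by (auto simp: connected_imp_connected_closure)
qed

section \<open>Covering dimension\<close>

lemma eps_chain:
  fixes C :: "'a::metric_space set"
  assumes C: "connected C" "p \<in> C" "q \<in> C" and e: "e > 0"
  obtains n f where "f 0 = p" "\<And>i. i \<ge> n \<Longrightarrow> f i = q" "\<And>i. f i \<in> C"
    "\<And>i. dist (f i) (f (Suc i)) < e"
proof -
  define r where "r = (\<lambda>a b. a \<in> C \<and> b \<in> C \<and> dist a b < e)"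
  have sr: "symp r\<^sup>*\<^sup>*"
    by (rule symp_rtranclp) (auto simp: r_def symp_def dist_commute)
  have "r\<^sup>*\<^sup>* p q"
  proof (rule connected_equivalence_relation[OF C])
    show "r\<^sup>*\<^sup>* y x" if "r\<^sup>*\<^sup>* x y" for x y using sr that by (auto dest: sympD)
    show "r\<^sup>*\<^sup>* x z" if "r\<^sup>*\<^sup>* x y" "r\<^sup>*\<^sup>* y z" for x y z using that by simp
    show "\<exists>T. openin (top_of_set C) T \<and> a \<in> T \<and> (\<forall>x\<in>T. r\<^sup>*\<^sup>* a x)" if "a \<in> C" for a
    proof (intro exI conjI ballI)
      show "openin (top_of_set C) (C \<inter> ball a e)" by (simp add: openin_open_Int)
      show "a \<in> C \<inter> ball a e" using that e by simp
      show "r\<^sup>*\<^sup>* a x" if "x \<in> C \<inter> ball a e" for x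
        using that \<open>a \<in> C\<close> by (intro r_into_rtranclp) (auto simp: r_def)
    qed
  qed
  then obtain n f where f: "f 0 = p" "f n = q" "\<And>i. i < n \<Longrightarrow> r (f i) (f (Suc i))"
    by (metis relpowp_fun_conv rtranclp_imp_relpowp)
  \<comment> \<open>Made constant from n on, so that the chain can be read with any larger number of
    steps.\<close>
  define g where "g i = f (min i n)" for i
  have fC: "f i \<in> C" if "i \<le> n" for i
    using f(3)[of i] that f(2) C by (cases "i = n") (auto simp: r_def)
  show thesis
  proof (rule that[of g n])
    show "dist (g i) (g (Suc i)) < e" for i
      using f(3)[of i] e by (cases "i < n") (auto simp: g_def r_def min_def)
  qed (use f fC in \<open>auto simp: g_def\<close>)
qed

text \<open>The Poincare-Miranda theorem with one factor of the square replaced by a continuum. C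
  need not contain an arc from p to q, but the combinatorial proof by Kuhn's lemma only needs a fine
  chain of points as grid columns.\<close>

lemma hex_connected_interval:
  fixes C :: "'a::metric_space set" and f g :: "'a \<times> real \<Rightarrow> real"
  assumes C: "compact C" "connected C" "p \<in> C" "q \<in> C"
    and f: "continuous_on (C \<times> {0..1}) f" and g: "continuous_on (C \<times> {0..1}) g"
    and f0: "\<And>t. t \<in> {0..1} \<Longrightarrow> f (p, t) \<ge> 0" and f1: "\<And>t. t \<in> {0..1} \<Longrightarrow> f (q, t) < 0"
    and g0: "\<And>y. y \<in> C \<Longrightarrow> g (y, 0) \<ge> 0" and g1: "\<And>y. y \<in> C \<Longrightarrow> g (y, 1) < 0"
  shows "\<exists>z\<in>C \<times> {0..1}. f z = 0 \<and> g z = 0"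
proof (rule ccontr)
  assume contr: "\<not> ?thesis"
  let ?Y = "C \<times> {0..1::real}"
  have cY: "compact ?Y" using C by (simp add: compact_Times)
  have neY: "?Y \<noteq> {}" using C by auto
  let ?m = "\<lambda>z. max \<bar>f z\<bar> \<bar>g z\<bar>"
  have "continuous_on ?Y ?m" using f g by (intro continuous_intros)
  then obtain w where w: "w \<in> ?Y" "\<And>z. z \<in> ?Y \<Longrightarrow> ?m w \<le> ?m z"
    using continuous_attains_inf[OF cY neY] by blast
  define e where "e = ?m w / 2"
  have e: "e > 0" using contr w(1) by (auto simp: e_def max_def)
  obtain d1 where d1: "d1 > 0" "\<And>x y. x \<in> ?Y \<Longrightarrow> y \<in> ?Y \<Longrightarrow> dist x y < d1 \<Longrightarrow> dist (f x) (f y) < e"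
    using compact_uniformly_continuous[OF f cY] e unfolding uniformly_continuous_on_def by metis
  obtain d2 where d2: "d2 > 0" "\<And>x y. x \<in> ?Y \<Longrightarrow> y \<in> ?Y \<Longrightarrow> dist x y < d2 \<Longrightarrow> dist (g x) (g y) < e"
    using compact_uniformly_continuous[OF g cY] e unfolding uniformly_continuous_on_def by metis
  \<comment> \<open>Half of the modulus, because in one grid cell each of the two factors
    contributes less than d.\<close>
  define d where "d = min d1 d2 / 2"
  have d: "d > 0" using d1 d2 by (simp add: d_def)
  obtain n c where c: "c 0 = p" "\<And>i. i \<ge> n \<Longrightarrow> c i = q" "\<And>i. c i \<in> C"
    "\<And>i. dist (c i) (c (Suc i)) < d"
    using eps_chain[OF C(2-4) d] by metis
  obtain N0 where N0: "inverse (real (Suc N0)) < d" using reals_Archimedean[OF d] by blast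
  \<comment> \<open>One N serves both directions: N \<ge> n makes q the last column, and 1/N < d
    bounds the vertical mesh.\<close>
  define N where "N = n + Suc N0"
  have N: "N > 0" "N \<ge> n" "1 / real N < d"
  proof -
    have "1 / real N \<le> inverse (real (Suc N0))" unfolding N_def by (simp add: field_simps)
    then show "1 / real N < d" using N0 by linarith
  qed (simp_all add: N_def)
  define P where "P x = (c (x 0), real (x (1::nat)) / real N)" for x :: "nat \<Rightarrow> nat"
  define label where "label x i = (if i = (0::nat) then if f (P x) \<ge> 0 then 0 else (1::nat)
      else if g (P x) \<ge> 0 then 0 else 1)" for x i
  have PY: "P x \<in> ?Y" if "x 1 \<le> N" for x using that c(3) N(1) by (auto simp: P_def)
  obtain Q where Q: "\<forall>i<2. Q i < N"
    and Q2: "\<forall>i<2. \<exists>r s. (\<forall>j<2. Q j \<le> r j \<and> r j \<le> Q j + 1) \<and> (\<forall>j<2. Q j \<le> s j \<and> s j \<le> Q j + 1) \<and> label r i \<noteq> label s i"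
  proof (rule kuhn_lemma[of N 2 label])
    show "0 < N" by fact
    show "\<forall>x. (\<forall>i<2. x i \<le> N) \<longrightarrow> (\<forall>i<2. label x i = 0 \<or> label x i = 1)"
      by (simp add: label_def)
    show "\<forall>x. (\<forall>i<2. x i \<le> N) \<longrightarrow> (\<forall>i<2. x i = 0 \<longrightarrow> label x i = 0)"
    proof (intro allI impI)
      fix x :: "nat \<Rightarrow> nat" and i :: nat
      assume x: "\<forall>i<2. x i \<le> N" "i < 2" "x i = 0"
      show "label x i = 0"
        using x f0[of "x 1 / N"] g0[of "c (x 0)"] c(1,3) N(1)
        by (cases "i = 0") (auto simp: label_def P_def less_2_cases_iff)
    qed
    show "\<forall>x. (\<forall>i<2. x i \<le> N) \<longrightarrow> (\<forall>i<2. x i = N \<longrightarrow> label x i = 1)"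
    proof (intro allI impI)
      fix x :: "nat \<Rightarrow> nat" and i :: nat
      assume x: "\<forall>i<2. x i \<le> N" "i < 2" "x i = N"
      show "label x i = 1"
        using x f1[of "x 1 / N"] g1[of "c (x 0)"] c(2)[of N] c(3) N(1,2)
        by (cases "i = 0") (auto simp: label_def P_def less_2_cases_iff not_le)
    qed
  qed blast
  define close where "close r \<longleftrightarrow> (\<forall>j<2. Q j \<le> r j \<and> r j \<le> Q j + 1)" for r
  have P1: "P r \<in> ?Y" if "close r" for r
    using that Q PY[of r] unfolding close_def
    by (metis Suc_1 Suc_eq_plus1 Suc_leI le_trans lessI)
  have P2: "dist (P r) (P s) < min d1 d2" if "close r" "close s" for r s
  proof -
    have "r 0 = Q 0 \<or> r 0 = Suc (Q 0)" "s 0 = Q 0 \<or> s 0 = Suc (Q 0)"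
      and rs: "r 1 = Q 1 \<or> r 1 = Suc (Q 1)" "s 1 = Q 1 \<or> s 1 = Suc (Q 1)"
      using that unfolding close_def by (auto simp: less_2_cases_iff le_Suc_eq)
    then have "dist (c (r 0)) (c (s 0)) < d"
      using c(4)[of "Q 0"] d by (auto simp: dist_commute)
    moreover have "dist (r 1 / real N) (s 1 / real N) \<le> 1 / real N"
      using rs N(1) by (auto simp: dist_real_def field_simps)
    moreover have "dist (P r) (P s) \<le> dist (c (r 0)) (c (s 0)) + dist (r 1 / real N) (s 1 / real N)"
      unfolding P_def dist_Pair_Pair by (rule sqrt_sum_squares_le_sum) auto
    ultimately have "dist (P r) (P s) < d + d" using N(3) by linarith
    then show ?thesis by (simp add: d_def)
  qed
  have Qc: "close Q" by (simp add: close_def)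
  obtain r s where rs: "close r" "close s" "label r 0 \<noteq> label s 0"
    using Q2[rule_format, of 0] unfolding close_def by auto
  obtain r' s' where rs': "close r'" "close s'" "label r' 1 \<noteq> label s' 1"
    using Q2[rule_format, of 1] unfolding close_def by auto
  \<comment> \<open>Labels record signs. In the cell at Q both labels change, so f is within e of 0
    at some corner and within 2e of 0 at \<open>P Q\<close>; the same holds for g, against the
    minimality of \<open>w\<close>.\<close>
  have "\<bar>f (P Q)\<bar> < 2 * e"
    using d1(2)[OF P1 P1, of r s] d1(2)[OF P1 P1, of r Q] P2[of r s] P2[of r Q] rs Qc
    by (auto simp: label_def dist_real_def split: if_splits)
  moreover have "\<bar>g (P Q)\<bar> < 2 * e"
    using d2(2)[OF P1 P1, of r' s'] d2(2)[OF P1 P1, of r' Q] P2[of r' s'] P2[of r' Q] rs' Qc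
    by (auto simp: label_def dist_real_def split: if_splits)
  ultimately show False using w(2)[OF P1[OF Qc]] by (simp add: e_def) linarith
qed

text \<open>Each member of the refinement is assigned to one \<open>U i\<close> containing it, and
  the members with equal index are united. Distinct indices at x come from distinct members through
  x, so the order does not grow.\<close>

lemma covering_dim_le_shrink:
  assumes S: "covering_dim_le S n" and I: "finite I"
    and U: "\<And>i. i \<in> I \<Longrightarrow> openin (top_of_set S) (U i)" "(\<Union>i\<in>I. U i) = S"
  obtains V where "\<And>i. i \<in> I \<Longrightarrow> openin (top_of_set S) (V i)" "\<And>i. i \<in> I \<Longrightarrow> V i \<subseteq> U i"
    "(\<Union>i\<in>I. V i) = S" "\<And>x. x \<in> S \<Longrightarrow> card {i\<in>I. x \<in> V i} \<le> n + 1"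
proof -
  have cover: "finite (U ` I) \<and> (\<forall>V\<in>U ` I. openin (top_of_set S) V) \<and> \<Union>(U ` I) = S"
    using I U by blast
  obtain D where D: "finite D" "\<forall>V\<in>D. openin (top_of_set S) V" "\<Union>D = S"
    "\<forall>V\<in>D. \<exists>W\<in>U ` I. V \<subseteq> W" "\<forall>x\<in>S. card {V\<in>D. x \<in> V} \<le> n + 1"
    using S[unfolded covering_dim_le_def, THEN spec, THEN mp, OF cover] by (elim exE conjE) (rule that)
  have "\<forall>V\<in>D. \<exists>i. i \<in> I \<and> V \<subseteq> U i" using D(4) by blast
  then obtain a where a: "\<forall>V\<in>D. a V \<in> I \<and> V \<subseteq> U (a V)" by (rule bchoice[THEN exE])
  define V where "V i = \<Union>{W\<in>D. a W = i}" for i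
  show thesis
  proof (rule that[of V])
    show "openin (top_of_set S) (V i)" for i unfolding V_def using D(2) by (intro openin_Union) blast
    show "V i \<subseteq> U i" for i using a unfolding V_def by blast
    show "(\<Union>i\<in>I. V i) = S" using a D(3) unfolding V_def by blast
    fix x assume x: "x \<in> S"
    have fin: "finite {W\<in>D. x \<in> W}" using D(1) by simp
    have "{i\<in>I. x \<in> V i} \<subseteq> a ` {W\<in>D. x \<in> W}" unfolding V_def by blast
    then have "card {i\<in>I. x \<in> V i} \<le> card {W\<in>D. x \<in> W}"
      using fin by (meson card_image_le card_mono finite_imageI le_trans)
    then show "card {i\<in>I. x \<in> V i} \<le> n + 1" using D(5) x by fastforce
  qed
qed

text \<open>Lebesgue's covering argument. Four open sets, each omitting two adjacent sides, cover K.
  The weights of a refinement of order two define a map to the square that sends opposite sides to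
  opposite sides and so attains every interior value, but order two confines it to the segments
  between two corners. The map \<open>\<Psi>\<close> may fail to be injective as long as opposite
  sides have disjoint images.\<close>

lemma no_square_in_dim_one:
  fixes C :: "'b::metric_space set" and \<Psi> :: "'b \<times> real \<Rightarrow> 'a::metric_space"
  assumes K: "covering_dim_le K 1"
    and C: "compact C" "connected C" "p \<in> C" "q \<in> C"
    and \<Psi>: "continuous_on (C \<times> {0..1}) \<Psi>" "\<Psi> ` (C \<times> {0..1}) \<subseteq> K"
    and LR: "\<Psi> ` ({p} \<times> {0..1}) \<inter> \<Psi> ` ({q} \<times> {0..1}) = {}"
    and BT: "\<Psi> ` (C \<times> {0}) \<inter> \<Psi> ` (C \<times> {1}) = {}"
  shows False
proof -
  let ?L = "\<Psi> ` ({p} \<times> {0..1})" and ?R = "\<Psi> ` ({q} \<times> {0..1})"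
  let ?B = "\<Psi> ` (C \<times> {0})" and ?T = "\<Psi> ` (C \<times> {1})"
  \<comment> \<open>True in the first component omits the right side, in the second the top; False
    omits left and bottom. A point misses at least one of two opposite sides, hence lies in some
    \<open>U i\<close>.\<close>
  define U where "U i = K - ((if fst i then ?R else ?L) \<union> (if snd i then ?T else ?B))" for i
  have cl0: "closed (\<Psi> ` A)" if "A \<subseteq> C \<times> {0..1}" "compact A" for A
    by (intro compact_imp_closed compact_continuous_image continuous_on_subset[OF \<Psi>(1)] that)
  have cl: "closed ?L" "closed ?R" "closed ?B" "closed ?T"
    by (rule cl0; use C in \<open>auto simp: compact_Times\<close>)+
  have oU: "openin (top_of_set K) (U i)" for i
  proof -
    have "closed ((if fst i then ?R else ?L) \<union> (if snd i then ?T else ?B))" using cl by auto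
    then show ?thesis unfolding U_def Diff_eq by (intro openin_open_Int open_Compl)
  qed
  have cU: "(\<Union>i\<in>UNIV. U i) = K"
  proof
    show "K \<subseteq> (\<Union>i\<in>UNIV. U i)"
    proof
      fix y assume "y \<in> K"
      then have "y \<in> U (y \<notin> ?R, y \<notin> ?T)" using LR BT by (auto simp: U_def)
      then show "y \<in> (\<Union>i\<in>UNIV. U i)" by blast
    qed
  qed (auto simp: U_def)
  obtain V where V: "\<And>i. openin (top_of_set K) (V i)" "\<And>i. V i \<subseteq> U i"
    "(\<Union>i. V i) = K" "\<And>x. x \<in> K \<Longrightarrow> card {i. x \<in> V i} \<le> 2"
    using covering_dim_le_shrink[OF K, of UNIV U] oU cU by (auto simp: numeral_2_eq_2)
  \<comment> \<open>The value 1 covers the case \<open>V i = K\<close>: the distance to the empty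
    set is 0 by convention and would make the weight vanish everywhere.\<close>
  define g where "g i x = (if K - V i = {} then 1 else infdist x (K - V i))" for i x
  have g0: "g i x \<ge> 0" for i x by (simp add: g_def infdist_nonneg)
  have gpos: "g i x > 0 \<longleftrightarrow> x \<in> V i" if "x \<in> K" for i x
  proof (cases "K - V i = {}")
    case False
    have "closedin (top_of_set K) (K - V i)" using V(1) by (simp add: closedin_diff)
    then obtain F where F: "closed F" "K - V i = K \<inter> F" unfolding closedin_closed by blast
    have "infdist x (K - V i) = 0 \<longleftrightarrow> x \<in> closure (K - V i)"
      using in_closure_iff_infdist_zero[OF False] by simp
    also have "\<dots> \<longleftrightarrow> x \<in> K - V i"
    proof
      assume "x \<in> closure (K - V i)"
      then have "x \<in> F" using F closure_minimal[of "K - V i" F] by blast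
      then show "x \<in> K - V i" using F(2) that by blast
    next
      assume "x \<in> K - V i"
      then show "x \<in> closure (K - V i)" by (rule closure_subset[THEN subsetD])
    qed
    finally have c: "infdist x (K - V i) = 0 \<longleftrightarrow> x \<in> K - V i" .
    have eq: "g i x = infdist x (K - V i)" using False by (simp only: g_def if_False)
    show ?thesis
      using c that infdist_nonneg[of x "K - V i"] unfolding eq less_le by (metis Diff_iff)
  next
    case True
    then show ?thesis using that unfolding g_def by auto
  qed
  have cg: "continuous_on K (g i)" for i
    unfolding g_def by (cases "K - V i = {}") (simp_all add: continuous_on_infdist)
  let ?a = "g (True,True)" and ?b = "g (True,False)" and ?c = "g (False,True)" and ?d = "g (False,False)"
  define S where "S x = ?a x + ?b x + ?c x + ?d x" for x
  have S: "S x > 0" if "x \<in> K" for x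
  proof -
    obtain i where "x \<in> V i" using V(3) \<open>x \<in> K\<close> by blast
    then have "g i x > 0" using gpos that by blast
    moreover have "i \<in> {(True,True),(True,False),(False,True),(False,False)}"
      by (cases i) auto
    ultimately have "g (True,True) x > 0 \<or> g (True,False) x > 0 \<or> g (False,True) x > 0 \<or> g (False,False) x > 0"
      by blast
    then show ?thesis using g0[of "(True,True)" x] g0[of "(True,False)" x] g0[of "(False,True)" x]
      g0[of "(False,False)" x] unfolding S_def by linarith
  qed
  have three: "g i x = 0 \<or> g j x = 0 \<or> g k x = 0" if "x \<in> K" "i \<noteq> j" "j \<noteq> k" "i \<noteq> k" for i j k x
  proof (rule ccontr)
    assume "\<not> ?thesis"
    then have "{i,j,k} \<subseteq> {i. x \<in> V i}" using g0 gpos[OF that(1)] unfolding less_le by simp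
    then have "card {i,j,k} \<le> 2"
      using V(4)[OF that(1)] by (meson card_mono finite le_trans)
    then show False using that by simp
  qed
  \<comment> \<open>At most two of the four functions are nonzero at a point. The levels \<open>1/2\<close> and \<open>1/3\<close> differ so that
    the two level sets are disjoint also where the two nonzero functions belong to opposite corners.\<close>
  define s0 where "s0 x = (?a x + ?b x) / S x" for x
  define s1 where "s1 x = (?a x + ?c x) / S x" for x
  have cS: "continuous_on K s0" "continuous_on K s1"
    unfolding s0_def s1_def S_def
    using S[unfolded S_def, THEN less_imp_neq, THEN not_sym] cg
    by (auto intro!: continuous_on_divide continuous_on_add)
  \<comment> \<open>On each side the two weights whose sets omit it vanish. So s0 is 1 on the left
    and 0 on the right, and s1 is 1 at the bottom and 0 at the top.\<close>
  have "\<exists>z\<in>C \<times> {0..1}. s0 (\<Psi> z) - 1/2 = 0 \<and> s1 (\<Psi> z) - 1/3 = 0"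
  proof (rule hex_connected_interval[OF C])
    show "continuous_on (C \<times> {0..1}) (\<lambda>z. s0 (\<Psi> z) - 1/2)" "continuous_on (C \<times> {0..1}) (\<lambda>z. s1 (\<Psi> z) - 1/3)"
      by (rule continuous_on_diff[OF continuous_on_compose2[OF cS(1) \<Psi>] continuous_on_const]
        continuous_on_diff[OF continuous_on_compose2[OF cS(2) \<Psi>] continuous_on_const])+
    have z: "g i x = 0" if "x \<in> K" "x \<notin> U i" for i x
      using gpos[OF that(1), of i] g0[of i x] V(2)[of i] that(2) unfolding less_le by fastforce
    fix t :: real assume t: "t \<in> {0..1}"
    have K: "\<Psi> (p,t) \<in> K" "\<Psi> (q,t) \<in> K" using \<Psi>(2) t C by auto
    have "?c (\<Psi> (p,t)) = 0" "?d (\<Psi> (p,t)) = 0"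
      by (rule z[OF K(1)]; use t in \<open>auto simp: U_def\<close>)+
    then show "0 \<le> s0 (\<Psi> (p,t)) - 1/2" using S[OF K(1)] by (auto simp: s0_def S_def)
    have "?a (\<Psi> (q,t)) = 0" "?b (\<Psi> (q,t)) = 0"
      by (rule z[OF K(2)]; use t in \<open>auto simp: U_def\<close>)+
    then show "s0 (\<Psi> (q,t)) - 1/2 < 0" by (auto simp: s0_def S_def)
  next
    have z: "g i x = 0" if "x \<in> K" "x \<notin> U i" for i x
      using gpos[OF that(1), of i] g0[of i x] V(2)[of i] that(2) unfolding less_le by fastforce
    fix y assume y: "y \<in> C"
    have K: "\<Psi> (y,0) \<in> K" "\<Psi> (y,1) \<in> K" using \<Psi>(2) y by auto
    have "?b (\<Psi> (y,0)) = 0" "?d (\<Psi> (y,0)) = 0"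
      by (rule z[OF K(1)]; use y in \<open>auto simp: U_def\<close>)+
    then show "0 \<le> s1 (\<Psi> (y,0)) - 1/3" using S[OF K(1)] by (auto simp: s1_def S_def)
    have "?a (\<Psi> (y,1)) = 0" "?c (\<Psi> (y,1)) = 0"
      by (rule z[OF K(2)]; use y in \<open>auto simp: U_def\<close>)+
    then show "s1 (\<Psi> (y,1)) - 1/3 < 0" by (auto simp: s1_def S_def)
  qed
  then obtain z where z: "z \<in> C \<times> {0..1}" "s0 (\<Psi> z) = 1/2" "s1 (\<Psi> z) = 1/3" by auto
  define x where "x = \<Psi> z"
  have x: "x \<in> K" using z(1) \<Psi>(2) by (auto simp: x_def)
  have eq: "2 * (?a x + ?b x) = S x" "3 * (?a x + ?c x) = S x"
    using z S[OF x] by (auto simp: s0_def s1_def x_def[symmetric] field_simps)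
  have zero: "?a x = 0 \<or> ?b x = 0 \<or> ?c x = 0" "?a x = 0 \<or> ?b x = 0 \<or> ?d x = 0"
    "?a x = 0 \<or> ?c x = 0 \<or> ?d x = 0" "?b x = 0 \<or> ?c x = 0 \<or> ?d x = 0"
    by (rule three[OF x]; simp)+
  have contra: "False" if "a = 0 \<or> b = 0 \<or> c = 0" "a = 0 \<or> b = 0 \<or> d = 0"
    "a = 0 \<or> c = 0 \<or> d = 0" "b = 0 \<or> c = 0 \<or> d = 0" "a \<ge> 0" "b \<ge> 0" "c \<ge> 0" "d \<ge> 0"
    "2 * (a + b) = a + b + c + d" "3 * (a + c) = a + b + c + d" "a + b + c + d > 0" for a b c d :: real
    using that by (elim disjE) simp_all
  show False
    by (rule contra[OF zero g0 g0 g0 g0 eq[unfolded S_def] S[OF x, unfolded S_def]])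
qed

text \<open>A shrinking \<open>W\<close> of the cover restricted to A extends to X by removing from
  \<open>U i\<close> only the closed set \<open>A - W i\<close>: outside A nothing changes, and on A
  exactly \<open>W i\<close> remains.\<close>

lemma covering_dim_le_closed_part:
  assumes A: "covering_dim_le A n" "A \<subseteq> X" "closedin (top_of_set X) A" and I: "finite I"
    and U: "\<And>i. i \<in> I \<Longrightarrow> openin (top_of_set X) (U i)" "(\<Union>i\<in>I. U i) = X"
  obtains V where "\<And>i. i \<in> I \<Longrightarrow> openin (top_of_set X) (V i)" "\<And>i. i \<in> I \<Longrightarrow> V i \<subseteq> U i"
    "(\<Union>i\<in>I. V i) = X" "\<And>x. x \<in> A \<Longrightarrow> card {i\<in>I. x \<in> V i} \<le> n + 1"
proof -
  have op: "openin (top_of_set A) (A \<inter> U i)" if "i \<in> I" for i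
  proof -
    obtain W where "open W" "U i = X \<inter> W" using U(1)[OF \<open>i \<in> I\<close>] by (auto simp: openin_open)
    moreover then have "A \<inter> U i = A \<inter> W" using A(2) by blast
    ultimately show ?thesis by (simp add: openin_open_Int)
  qed
  have un: "(\<Union>i\<in>I. A \<inter> U i) = A" using U(2) A(2) by blast
  obtain W where W: "\<And>i. i \<in> I \<Longrightarrow> openin (top_of_set A) (W i)" "\<And>i. i \<in> I \<Longrightarrow> W i \<subseteq> A \<inter> U i"
    "(\<Union>i\<in>I. W i) = A" "\<And>x. x \<in> A \<Longrightarrow> card {i\<in>I. x \<in> W i} \<le> n + 1"
    by (rule covering_dim_le_shrink[OF A(1) I op un]) (assumption | rule that)+
  define V where "V i = U i - (A - W i)" for i
  show thesis
  proof (rule that[of V])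
    show "openin (top_of_set X) (V i)" if "i \<in> I" for i
    proof -
      have "closedin (top_of_set A) (A - W i)" using W(1)[OF that] by (simp add: closedin_diff)
      then have "closedin (top_of_set X) (A - W i)" using A(3) closedin_trans by blast
      then show ?thesis unfolding V_def using U(1)[OF that] by (rule openin_diff[rotated])
    qed
    show "V i \<subseteq> U i" for i by (auto simp: V_def)
    show "(\<Union>i\<in>I. V i) = X"
    proof
      show "X \<subseteq> (\<Union>i\<in>I. V i)"
      proof
        fix x assume x: "x \<in> X"
        show "x \<in> (\<Union>i\<in>I. V i)"
        proof (cases "x \<in> A")
          case True
          then obtain i where "i \<in> I" "x \<in> W i" using W(3) by blast
          then show ?thesis using W(2) unfolding V_def by blast
        next
          case False
          obtain i where "i \<in> I" "x \<in> U i" using x U(2) by blast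
          then show ?thesis using False unfolding V_def by blast
        qed
      qed
      show "(\<Union>i\<in>I. V i) \<subseteq> X" using U(2) unfolding V_def by blast
    qed
    fix x assume x: "x \<in> A"
    have "{i\<in>I. x \<in> V i} \<subseteq> {i\<in>I. x \<in> W i}" using x unfolding V_def by blast
    then show "card {i\<in>I. x \<in> V i} \<le> n + 1"
      using W(4)[OF x] I card_mono[of "{i\<in>I. x \<in> W i}" "{i\<in>I. x \<in> V i}"] by simp
  qed
qed

text \<open>The finite sum theorem. The cover is shrunk along one closed piece after another with a
  fixed index set; a later shrinking cannot raise the order on the pieces already treated.\<close>

lemma covering_dim_le_finite_closed_union:
  assumes fin: "finite \<A>" and A: "\<And>A. A \<in> \<A> \<Longrightarrow> covering_dim_le A n \<and> closedin (top_of_set X) A"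
    and X: "\<Union>\<A> = X"
  shows "covering_dim_le X n"
proof -
  have AX: "A \<subseteq> X" if "A \<in> \<A>" for A using that X by blast
  have step: "\<exists>V. (\<forall>i\<in>I. openin (top_of_set X) (V i) \<and> V i \<subseteq> U i) \<and> (\<Union>i\<in>I. V i) = X \<and>
      (\<forall>x\<in>\<Union>\<B>. card {i\<in>I. x \<in> V i} \<le> n + 1)"
    if "finite \<B>" "\<B> \<subseteq> \<A>" "finite I" "\<forall>i\<in>I. openin (top_of_set X) (U i)" "(\<Union>i\<in>I. U i) = X"
    for \<B> I and U :: "'a set \<Rightarrow> 'a set"
    using that
  proof (induction \<B> rule: finite_induct)
    case empty
    then show ?case by (intro exI[of _ U]) simp
  next
    case (insert A \<B>)
    have "\<B> \<subseteq> \<A>" using insert.prems(1) by blast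
    from insert.IH[OF this insert.prems(2) insert.prems(3) insert.prems(4)] obtain V where
      V': "\<forall>i\<in>I. openin (top_of_set X) (V i) \<and> V i \<subseteq> U i" "(\<Union>i\<in>I. V i) = X"
        "\<forall>x\<in>\<Union>\<B>. card {i\<in>I. x \<in> V i} \<le> n + 1"
      by (elim exE conjE) (rule that)
    then have V: "\<And>i. i \<in> I \<Longrightarrow> openin (top_of_set X) (V i)" "\<And>i. i \<in> I \<Longrightarrow> V i \<subseteq> U i" "(\<Union>i\<in>I. V i) = X"
      "\<And>x. x \<in> \<Union>\<B> \<Longrightarrow> card {i\<in>I. x \<in> V i} \<le> n + 1" by blast+
    have "A \<in> \<A>" using insert.prems by blast
    have "\<exists>W. (\<forall>i\<in>I. openin (top_of_set X) (W i) \<and> W i \<subseteq> V i) \<and> (\<Union>i\<in>I. W i) = X \<and>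
        (\<forall>x\<in>A. card {i\<in>I. x \<in> W i} \<le> n + 1)"
      by (rule covering_dim_le_closed_part[OF A[OF \<open>A \<in> \<A>\<close>, THEN conjunct1] AX[OF \<open>A \<in> \<A>\<close>]
          A[OF \<open>A \<in> \<A>\<close>, THEN conjunct2] \<open>finite I\<close> V(1,3)]) (assumption, blast)
    then obtain W where W': "\<forall>i\<in>I. openin (top_of_set X) (W i) \<and> W i \<subseteq> V i" "(\<Union>i\<in>I. W i) = X"
        "\<forall>x\<in>A. card {i\<in>I. x \<in> W i} \<le> n + 1" by (elim exE conjE) (rule that)
    then have W: "\<And>i. i \<in> I \<Longrightarrow> openin (top_of_set X) (W i)" "\<And>i. i \<in> I \<Longrightarrow> W i \<subseteq> V i" "(\<Union>i\<in>I. W i) = X"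
      "\<And>x. x \<in> A \<Longrightarrow> card {i\<in>I. x \<in> W i} \<le> n + 1" by blast+
    have "card {i\<in>I. x \<in> W i} \<le> n + 1" if "x \<in> \<Union>(insert A \<B>)" for x
    proof (cases "x \<in> A")
      case False
      then have "card {i\<in>I. x \<in> V i} \<le> n + 1" using that by (intro V(4)) blast
      moreover have "{i\<in>I. x \<in> W i} \<subseteq> {i\<in>I. x \<in> V i}" using W(2) by blast
      then have "card {i\<in>I. x \<in> W i} \<le> card {i\<in>I. x \<in> V i}"
        using \<open>finite I\<close> by (intro card_mono) simp_all
      ultimately show ?thesis by linarith
    qed (rule W(4))
    moreover have "W i \<subseteq> U i" if "i \<in> I" for i using W(2) V(2) that by blast
    ultimately show ?case using W(1,3) by blast
  qed
  show ?thesis unfolding covering_dim_le_def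
  proof (intro allI impI)
    fix C :: "'a set set"
    assume C: "finite C \<and> (\<forall>U\<in>C. openin (top_of_set X) U) \<and> \<Union>C = X"
    then obtain V where V: "\<forall>i\<in>C. openin (top_of_set X) (V i) \<and> V i \<subseteq> i" "(\<Union>i\<in>C. V i) = X"
      "\<forall>x\<in>\<Union>\<A>. card {i\<in>C. x \<in> V i} \<le> n + 1"
      using step[OF fin subset_refl, of C "\<lambda>U. U"] by auto
    show "\<exists>D. finite D \<and> (\<forall>V\<in>D. openin (top_of_set X) V) \<and> \<Union>D = X \<and>
        (\<forall>V\<in>D. \<exists>U\<in>C. V \<subseteq> U) \<and> (\<forall>x\<in>X. card {V\<in>D. x \<in> V} \<le> n + 1)"
    proof (intro exI[of _ "V ` C"] conjI ballI)
      fix x assume x: "x \<in> X"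
      have "{W \<in> V ` C. x \<in> W} = V ` {i\<in>C. x \<in> V i}" by blast
      then have "card {W \<in> V ` C. x \<in> W} \<le> card {i\<in>C. x \<in> V i}"
        using C by (simp add: card_image_le)
      then show "card {W \<in> V ` C. x \<in> W} \<le> n + 1" using V(3) x X by fastforce
    next
      show "finite (V ` C)" using C by simp
      show "\<Union>(V ` C) = X" by (rule V(2))
    next
      fix W assume "W \<in> V ` C"
      then obtain U where U: "U \<in> C" "W = V U" by blast
      show "openin (top_of_set X) W" using V(1) U by simp
      show "\<exists>U\<in>C. W \<subseteq> U" using V(1) U by blast
    qed
  qed
qed

lemma covering_dim_le_small_covers:
  assumes B: "compact B"
    and cov: "\<And>e. e > 0 \<Longrightarrow> \<exists>D. finite D \<and> (\<forall>V\<in>D. openin (top_of_set B) V) \<and> \<Union>D = B \<and>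
        (\<forall>V\<in>D. \<forall>x\<in>V. \<forall>y\<in>V. dist x y < e) \<and> (\<forall>x\<in>B. card {V\<in>D. x \<in> V} \<le> n + 1)"
  shows "covering_dim_le B n"
  unfolding covering_dim_le_def
proof (intro allI impI)
  fix C :: "'a set set"
  assume C: "finite C \<and> (\<forall>U\<in>C. openin (top_of_set B) U) \<and> \<Union>C = B"
  define O' where "O' U = (SOME W. open W \<and> U = B \<inter> W)" for U
  have O: "open (O' U) \<and> U = B \<inter> O' U" if "U \<in> C" for U
  proof -
    have "\<exists>W. open W \<and> U = B \<inter> W" using C that unfolding openin_open by blast
    then show ?thesis unfolding O'_def by (rule someI_ex)
  qed
  have "B \<subseteq> \<Union>(O' ` C)" using C O by blast
  then obtain e where e: "e > 0" "\<And>x. x \<in> B \<Longrightarrow> \<exists>G\<in>O' ` C. ball x e \<subseteq> G"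
    using Heine_Borel_lemma[OF B, of "O' ` C"] O by blast
  obtain D where D: "finite D" "\<forall>V\<in>D. openin (top_of_set B) V" "\<Union>D = B"
    "\<forall>V\<in>D. \<forall>x\<in>V. \<forall>y\<in>V. dist x y < e" "\<forall>x\<in>B. card {V\<in>D. x \<in> V} \<le> n + 1"
    using cov[OF e(1)] by (elim exE conjE) (rule that)
  have fine: "\<exists>U\<in>C. V \<subseteq> U" if "V \<in> D - {{}}" for V
  proof -
    obtain x where x: "x \<in> V" using \<open>V \<in> D - {{}}\<close> by blast
    then have "x \<in> B" using that D(3) by blast
    then obtain U where U: "U \<in> C" "ball x e \<subseteq> O' U" using e(2) by blast
    have "V \<subseteq> B" using that D(3) by blast
    moreover have "V \<subseteq> ball x e" 
    proof
      fix y assume "y \<in> V"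
      moreover have "V \<in> D" using that by blast
      ultimately show "y \<in> ball x e" using D(4) x unfolding mem_ball by blast
    qed
    ultimately have "V \<subseteq> B \<inter> O' U" using U(2) by blast
    then show ?thesis using U(1) O by blast
  qed
  show "\<exists>D. finite D \<and> (\<forall>V\<in>D. openin (top_of_set B) V) \<and> \<Union>D = B \<and>
        (\<forall>V\<in>D. \<exists>U\<in>C. V \<subseteq> U) \<and> (\<forall>x\<in>B. card {V\<in>D. x \<in> V} \<le> n + 1)"
  \<comment> \<open>The empty set is removed because it has no superset in C when B and C are
    empty.\<close>
  proof (intro exI[of _ "D - {{}}"] conjI ballI)
    fix x assume "x \<in> B"
    moreover have "{V \<in> D - {{}}. x \<in> V} = {V\<in>D. x \<in> V}" by blast
    ultimately show "card {V \<in> D - {{}}. x \<in> V} \<le> n + 1" using D(5) by metis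
  next
    show "\<Union>(D - {{}}) = B" using D(3) by blast
    show "finite (D - {{}})" using D(1) by simp
  next
    fix V assume "V \<in> D - {{}}"
    then show "openin (top_of_set B) V" using D(2) by blast
  next
    fix V assume "V \<in> D - {{}}"
    then show "\<exists>U\<in>C. V \<subseteq> U" by (rule fine)
  qed
qed

text \<open>All components are points, so z can be separated from the complement of a small ball by
  a clopen set. Compactness leaves finitely many of these sets.\<close>

lemma clopen_partition_small:
  fixes Z :: "'a::metric_space set"
  assumes Z: "compact Z" and dis: "\<And>C x y. C \<subseteq> Z \<Longrightarrow> connected C \<Longrightarrow> x \<in> C \<Longrightarrow> y \<in> C \<Longrightarrow> x = y"
    and e: "e > 0"
  obtains \<P> where "finite \<P>" "\<Union>\<P> = Z" "\<And>P. P \<in> \<P> \<Longrightarrow> openin (top_of_set Z) P"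
    "\<And>P Q. P \<in> \<P> \<Longrightarrow> Q \<in> \<P> \<Longrightarrow> P \<noteq> Q \<Longrightarrow> P \<inter> Q = {}"
    "\<And>P x y. P \<in> \<P> \<Longrightarrow> x \<in> P \<Longrightarrow> y \<in> P \<Longrightarrow> dist x y < e"
proof -
  define clopen where "clopen P \<longleftrightarrow> openin (top_of_set Z) P \<and> closedin (top_of_set Z) P" for P :: "'a set"
  define small where "small P \<longleftrightarrow> (\<forall>x\<in>P. \<forall>y\<in>P. dist x y < e)" for P :: "'a set"
  have nbhd: "\<exists>P. clopen P \<and> small P \<and> z \<in> P" if "z \<in> Z" for z
  proof -
    let ?T = "Z - ball z (e/2)"
    have T: "compact ?T" "?T \<subseteq> Z" "{z} \<subseteq> Z" using Z that by (auto simp: compact_diff)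
    have sep: "C \<inter> {z} = {} \<or> C \<inter> ?T = {}" if "C \<subseteq> Z" "connected C" for C
    proof (rule ccontr)
      assume "\<not> ?thesis"
      then obtain y where "z \<in> C" "y \<in> C" "y \<notin> ball z (e/2)" by blast
      then show False using dis[OF that, of z y] e by auto
    qed
    obtain P Q where PQ: "P \<union> Q = Z" "P \<inter> Q = {}" "{z} \<subseteq> P" "?T \<subseteq> Q"
        "openin (top_of_set Z) P" "openin (top_of_set Z) Q"
      by (rule connected_or_separated[OF Z compact_sing T(1) T(3) T(2) sep])
    have "P = Z - Q" using PQ(1,2) by blast
    then have "closedin (top_of_set Z) P" using PQ(6) by (metis closedin_diff closedin_topspace topspace_euclidean_subtopology)
    moreover have "small P" unfolding small_def
    proof (intro ballI)
      fix x y assume "x \<in> P" "y \<in> P"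
      then have "x \<in> ball z (e/2)" "y \<in> ball z (e/2)" using PQ by blast+
      then have "dist z x < e/2" "dist z y < e/2" by auto
      then show "dist x y < e" by (metis dist_commute dist_triangle_half_l)
    qed
    ultimately show ?thesis using PQ unfolding clopen_def by blast
  qed
  have part: "\<exists>\<P>. finite \<P> \<and> \<Union>\<P> = \<Union>\<C> \<and> (\<forall>P\<in>\<P>. clopen P \<and> small P) \<and> (\<forall>P\<in>\<P>. \<forall>Q\<in>\<P>. P \<noteq> Q \<longrightarrow> P \<inter> Q = {})"
    if "finite \<C>" "\<forall>C\<in>\<C>. clopen C \<and> small C" for \<C>
    using that
  proof (induction \<C> rule: finite_induct)
    case empty
    then show ?case by (intro exI[of _ "{}"]) simp
  next
    case (insert A \<C>)
    then obtain \<P> where P: "finite \<P>" "\<Union>\<P> = \<Union>\<C>" "\<forall>P\<in>\<P>. clopen P \<and> small P"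
      "\<forall>P\<in>\<P>. \<forall>Q\<in>\<P>. P \<noteq> Q \<longrightarrow> P \<inter> Q = {}" by auto
    have A: "clopen A" "small A" using insert.prems by auto
    show ?case
    \<comment> \<open>Subtracting the new clopen set from the old members makes the family disjoint
      and keeps its members clopen and small.\<close>
    proof (intro exI[of _ "insert A ((\<lambda>P. P - A) ` \<P>)"] conjI)
      show "finite (insert A ((\<lambda>P. P - A) ` \<P>))" using P(1) by simp
      show "\<Union>(insert A ((\<lambda>P. P - A) ` \<P>)) = \<Union>(insert A \<C>)" using P(2) by blast
      show "\<forall>P\<in>insert A ((\<lambda>P. P - A) ` \<P>). clopen P \<and> small P"
        using A P(3) by (auto simp: clopen_def small_def openin_diff closedin_diff)
      show "\<forall>P\<in>insert A ((\<lambda>P. P - A) ` \<P>). \<forall>Q\<in>insert A ((\<lambda>P. P - A) ` \<P>). P \<noteq> Q \<longrightarrow> P \<inter> Q = {}"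
        using P(4) by blast
    qed
  qed
  obtain N where N: "\<And>z. z \<in> Z \<Longrightarrow> clopen (N z) \<and> small (N z) \<and> z \<in> N z" using nbhd by metis
  define O' where "O' z = (SOME W. open W \<and> N z = Z \<inter> W)" for z
  have O: "open (O' z) \<and> N z = Z \<inter> O' z" if "z \<in> Z" for z
  proof -
    have "\<exists>W. open W \<and> N z = Z \<inter> W" using N[OF that] unfolding clopen_def openin_open by blast
    then show ?thesis unfolding O'_def by (rule someI_ex)
  qed
  have "Z \<subseteq> (\<Union>z\<in>Z. O' z)" using O N by blast
  then obtain F where F: "F \<subseteq> Z" "finite F" "Z \<subseteq> (\<Union>z\<in>F. O' z)"
    by (rule compactE_image[OF Z, rotated]) (simp_all add: O[THEN conjunct1])
  have fC: "finite (N ` F)" "\<forall>C\<in>N ` F. clopen C \<and> small C" using F N by blast+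
  have uC: "\<Union>(N ` F) = Z" using F O by blast
  obtain \<P> where "finite \<P>" "\<Union>\<P> = \<Union>(N ` F)" "\<forall>P\<in>\<P>. clopen P \<and> small P" "\<forall>P\<in>\<P>. \<forall>Q\<in>\<P>. P \<noteq> Q \<longrightarrow> P \<inter> Q = {}"
    using part[OF fC] by (elim exE conjE) (rule that)
  then show thesis using that[of \<P>] uC unfolding clopen_def small_def by blast
qed

section \<open>Local cross sections of a flow without fixed points\<close>

locale compact_flow =
  fixes X :: "'a::metric_space set" and \<phi> :: "real \<Rightarrow> 'a \<Rightarrow> 'a"
  assumes compact_X: "compact X" and flow: "continuous_flow X \<phi>"
begin

lemma flow_in: "x \<in> X \<Longrightarrow> \<phi> t x \<in> X"
  using flow unfolding continuous_flow_def by blast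

lemma flow_0 [simp]: "x \<in> X \<Longrightarrow> \<phi> 0 x = x"
  using flow unfolding continuous_flow_def by blast

lemma flow_add: "x \<in> X \<Longrightarrow> \<phi> s (\<phi> t x) = \<phi> (s + t) x"
  using flow unfolding continuous_flow_def by (metis add.commute)

lemma flow_inv: "x \<in> X \<Longrightarrow> \<phi> (- t) (\<phi> t x) = x" "x \<in> X \<Longrightarrow> \<phi> t (\<phi> (- t) x) = x"
  by (simp_all add: flow_add)

lemma flow_continuous:
  assumes "continuous_on S f" "continuous_on S g" "\<And>z. z \<in> S \<Longrightarrow> g z \<in> X"
  shows "continuous_on S (\<lambda>z. \<phi> (f z) (g z))"
proof -
  have "continuous_on (UNIV \<times> X) (\<lambda>(t, x). \<phi> t x)"
    using flow unfolding continuous_flow_def by blast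
  then have "continuous_on S (\<lambda>z. (\<lambda>(t, x). \<phi> t x) (f z, g z))"
    by (rule continuous_on_compose2) (use assms in \<open>auto intro!: continuous_on_Pair\<close>)
  then show ?thesis by simp
qed

lemma flow_tendsto:
  assumes "v \<longlonglongrightarrow> v'" "z \<longlonglongrightarrow> z'" "\<And>n. z n \<in> X" "z' \<in> X"
  shows "(\<lambda>n. \<phi> (v n) (z n)) \<longlonglongrightarrow> \<phi> v' z'"
proof -
  have "continuous_on (UNIV \<times> X) (\<lambda>w. \<phi> (fst w) (snd w))"
    by (intro flow_continuous continuous_intros) auto
  from continuous_on_tendsto_compose[OF this, of "\<lambda>n. (v n, z n)" "(v', z')" sequentially]
  show ?thesis using assms by (simp add: tendsto_Pair)
qed

lemma flow_uniform:
  assumes "e > 0"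
  obtains d where "d > 0" "\<And>x y s t. x \<in> X \<Longrightarrow> y \<in> X \<Longrightarrow> \<bar>s\<bar> \<le> b \<Longrightarrow> \<bar>t\<bar> \<le> b \<Longrightarrow>
    \<bar>s - t\<bar> \<le> d \<Longrightarrow> dist x y \<le> d \<Longrightarrow> dist (\<phi> s x) (\<phi> t y) \<le> e"
proof -
  let ?P = "{-b..b} \<times> X"
  have cP: "compact ?P" using compact_X by (simp add: compact_Times)
  have "continuous_on ?P (\<lambda>z. \<phi> (fst z) (snd z))"
    by (rule flow_continuous) (auto intro!: continuous_intros)
  from compact_uniformly_continuous[OF this cP] obtain d where d: "d > 0"
    "\<And>z w. z \<in> ?P \<Longrightarrow> w \<in> ?P \<Longrightarrow> dist w z < d \<Longrightarrow> dist (\<phi> (fst w) (snd w)) (\<phi> (fst z) (snd z)) < e"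
    by (rule uniformly_continuous_onE[OF _ assms]) blast
  show thesis
  proof (rule that[of "d/3"])
    fix x y s t assume a: "x \<in> X" "y \<in> X" "\<bar>s\<bar> \<le> b" "\<bar>t\<bar> \<le> b" "\<bar>s - t\<bar> \<le> d/3" "dist x y \<le> d/3"
    have "dist (s,x) (t,y) \<le> dist s t + dist x y"
      unfolding dist_Pair_Pair by (rule sqrt_sum_squares_le_sum) auto
    also have "\<dots> < d" using a d(1) by (simp add: dist_real_def)
    finally show "dist (\<phi> s x) (\<phi> t y) \<le> e"
      using d(2)[of "(t,y)" "(s,x)"] a by (force simp: abs_le_iff)
  qed (use d in simp)
qed

end

locale section_flow = compact_flow X \<phi> for X :: "'a::metric_space set" and \<phi> +
  fixes T c \<kappa>\<^sub>0 :: real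
  assumes T: "T > 0" and c: "c > 0" and \<kappa>\<^sub>0: "\<kappa>\<^sub>0 > 0"
    and far: "\<And>x. x \<in> X \<Longrightarrow> dist (\<phi> T x) x \<ge> 4 * c"
    and near: "\<And>x s. x \<in> X \<Longrightarrow> \<bar>s\<bar> \<le> \<kappa>\<^sub>0 \<Longrightarrow> dist (\<phi> s x) x \<le> c / 4"
begin

text \<open>Averaging makes the distance to x differentiable along orbits: the derivative at y is
  \<open>dist (\<phi> T y) x - dist y x\<close>, which is positive for y near x by
  \<open>far\<close>. Hence level sets of \<open>G x\<close> are transverse to the flow near
  x.\<close>

definition G :: "'a \<Rightarrow> 'a \<Rightarrow> real" where
  "G x y = integral {0..T} (\<lambda>s. dist (\<phi> s y) x)"

definition H :: "'a \<Rightarrow> 'a set" where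
  "H x = {y\<in>X. dist x y \<le> c/2 \<and> G x y = G x x}"

text \<open>Moving y by s shifts the window of integration from [0, T] to [s, T + s]. The part lost
  contributes at most c s. The part gained contributes at least 3 c s, for its points are
  T-translates of points within c of x, and T moves every point by at least 4 c.\<close>

lemma G_increasing:
  assumes x: "x \<in> X" and y: "y \<in> X" and s: "s \<ge> 0"
    and close: "\<And>r. 0 \<le> r \<Longrightarrow> r \<le> s \<Longrightarrow> dist (\<phi> r y) x \<le> c"
  shows "G x (\<phi> s y) \<ge> G x y + 2 * c * s"
proof -
  define f where "f r = dist (\<phi> r y) x" for r
  have cf: "continuous_on A f" for A
    unfolding f_def using y by (intro continuous_intros flow_continuous) auto
  have int: "f integrable_on {a..b}" for a b
    using integrable_continuous_interval[OF cf] .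
  have "G x (\<phi> s y) = integral {0..T} (f \<circ> ((+) s))"
    unfolding G_def f_def o_def flow_add[OF y] by (simp only: add.commute)
  also have "\<dots> = integral {s..T+s} f" by (simp add: integral_shift_Icc_real)
  finally have 1: "G x (\<phi> s y) = integral {s..T+s} f" .
  have "integral {0..s} f + integral {s..T+s} f = integral {0..T+s} f"
    by (rule Henstock_Kurzweil_Integration.integral_combine) (use T s int in auto)
  moreover have "integral {0..T} f + integral {T..T+s} f = integral {0..T+s} f"
    by (rule Henstock_Kurzweil_Integration.integral_combine) (use T s int in auto)
  moreover have "integral {0..T} f = G x y" unfolding G_def f_def[abs_def] ..
  moreover have "integral {0..s} f \<le> c * s"
  proof -
    have "integral {0..s} f \<le> integral {0..s} (\<lambda>_. c)"
      by (rule integral_le) (use int close in \<open>auto simp: f_def\<close>)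
    then show ?thesis using s by (simp add: mult.commute)
  qed
  moreover have "integral {T..T+s} f \<ge> 3 * c * s"
  proof -
    have "integral {T..T+s} (\<lambda>_. 3 * c) \<le> integral {T..T+s} f"
    proof (rule integral_le)
      fix r assume r: "r \<in> {T..T+s}"
      have "4 * c \<le> dist (\<phi> T (\<phi> (r - T) y)) (\<phi> (r - T) y)" using y by (intro far flow_in)
      also have "\<phi> T (\<phi> (r - T) y) = \<phi> r y" using y by (simp add: flow_add)
      also have "dist (\<phi> r y) (\<phi> (r - T) y) \<le> dist (\<phi> r y) x + dist (\<phi> (r - T) y) x" by (rule dist_triangle2)
      also have "dist (\<phi> (r - T) y) x \<le> c" using r by (intro close) auto
      finally show "3 * c \<le> f r" by (simp add: f_def)
    qed (use int in auto)
    then show ?thesis using s by (simp add: mult_ac)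
  qed
  ultimately show ?thesis using 1 by (simp add: algebra_simps)
qed

lemma G_increasing':
  assumes x: "x \<in> X" and y: "y \<in> X" "dist x y \<le> c/2" and s: "0 \<le> s" "s \<le> \<kappa>\<^sub>0"
  shows "G x (\<phi> s y) \<ge> G x y + 2 * c * s"
proof (rule G_increasing[OF x y(1) s(1)])
  fix r assume r: "0 \<le> r" "r \<le> s"
  have "dist (\<phi> r y) x \<le> dist (\<phi> r y) y + dist x y" by (rule dist_triangle2)
  also have "dist (\<phi> r y) y \<le> c/4" using r s y by (intro near) auto
  finally show "dist (\<phi> r y) x \<le> c" using y(2) c by simp
qed

lemma H_in: "y \<in> H x \<Longrightarrow> y \<in> X" by (simp add: H_def)

lemma H_unique:
  assumes x: "x \<in> X" and y: "y \<in> H x" "\<phi> s y \<in> H x" "\<bar>s\<bar> \<le> \<kappa>\<^sub>0"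
  shows "s = 0"
proof (rule ccontr)
  assume "s \<noteq> 0"
  then consider "s > 0" | "s < 0" by linarith
  then show False
  proof cases
    case 1
    then have "G x (\<phi> s y) \<ge> G x y + 2 * c * s" using x y by (intro G_increasing') (auto simp: H_def)
    then show False using y 1 c mult_pos_pos[of c s] by (simp add: H_def mult_le_0_iff)
  next
    case 2
    then have "G x (\<phi> (- s) (\<phi> s y)) \<ge> G x (\<phi> s y) + 2 * c * (- s)"
      using x y by (intro G_increasing') (auto simp: H_def)
    then show False using y 2 c mult_pos_neg[of c s] by (simp add: H_def flow_add zero_le_mult_iff)
  qed
qed

lemma G_continuous: "continuous_on (X \<times> X) (\<lambda>(x, y). G x y)"
proof -
  have "continuous_on ((X \<times> X) \<times> cbox 0 T) (\<lambda>(z, s). dist (\<phi> s (snd z)) (fst z))"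
    unfolding case_prod_beta by (intro continuous_intros flow_continuous) auto
  from integral_continuous_on_param[OF this] show ?thesis
    by (simp add: G_def case_prod_beta)
qed

lemma continuous_on_G:
  assumes "continuous_on S f" "continuous_on S g" "\<And>z. z \<in> S \<Longrightarrow> f z \<in> X" "\<And>z. z \<in> S \<Longrightarrow> g z \<in> X"
  shows "continuous_on S (\<lambda>z. G (f z) (g z))"
proof -
  have "continuous_on S (\<lambda>z. (\<lambda>(x, y). G x y) (f z, g z))"
    by (rule continuous_on_compose2[OF G_continuous]) (use assms in \<open>auto intro!: continuous_on_Pair\<close>)
  then show ?thesis by simp
qed

lemma H_self: "x \<in> X \<Longrightarrow> x \<in> H x" using c by (simp add: H_def)

text \<open>The sections form a closed relation, so limits may be taken while the base point
  varies.\<close>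

lemma H_limit:
  assumes "\<And>n. x n \<in> X" "\<And>n. y n \<in> H (x n)" "x \<longlonglongrightarrow> x'" "y \<longlonglongrightarrow> y'" "x' \<in> X"
  shows "y' \<in> H x'"
proof -
  have cX: "closed X" using compact_X by (rule compact_imp_closed)
  have yX: "y n \<in> X" for n using assms(2) H_in by blast
  have y': "y' \<in> X" using closed_sequentially[OF cX yX assms(4)] .
  have "(\<lambda>n. dist (x n) (y n)) \<longlonglongrightarrow> dist x' y'" using assms by (intro tendsto_intros)
  then have d: "dist x' y' \<le> c/2"
    by (rule LIMSEQ_le_const2) (use assms(2) in \<open>auto simp: H_def\<close>)
  have lim: "(\<lambda>n. G (x n) (z n)) \<longlonglongrightarrow> G x' z'" if "\<And>n. z n \<in> X" "z \<longlonglongrightarrow> z'" "z' \<in> X" for z z'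
  proof -
    have "(\<lambda>n. (x n, z n)) \<longlonglongrightarrow> (x', z')" using assms(3) that(2) by (rule tendsto_Pair)
    then show ?thesis
      using continuous_on_tendsto_compose[OF G_continuous, of "\<lambda>n. (x n, z n)" "(x', z')" sequentially]
        assms(1,5) that by simp
  qed
  have "(\<lambda>n. G (x n) (y n)) \<longlonglongrightarrow> G x' y'" "(\<lambda>n. G (x n) (x n)) \<longlonglongrightarrow> G x' x'"
    by (rule lim[OF yX assms(4) y'] lim[OF assms(1,3,5)])+
  moreover have "(\<lambda>n. G (x n) (y n)) = (\<lambda>n. G (x n) (x n))" using assms(2) by (auto simp: H_def)
  ultimately have "G x' y' = G x' x'" using LIMSEQ_unique by metis
  then show ?thesis using y' d by (simp add: H_def)
qed

lemma compact_H: "x \<in> X \<Longrightarrow> compact (H x)"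
proof -
  assume x: "x \<in> X"
  have "closed (H x)"
    unfolding closed_sequential_limits using H_limit[of "\<lambda>_. x"] x by auto
  then show ?thesis using compact_Int_closed[OF compact_X, of "H x"] H_in
    by (metis Int_absorb1 subsetI)
qed

text \<open>Within time k on either side \<open>G x\<close> changes by at least 2 c k, so the
  intermediate value theorem finds the level \<open>G x x\<close>. Distance c/4 at the start plus
  drift c/4 keeps the orbit inside the radius c/2 of the section.\<close>

lemma hit_H:
  assumes x: "x \<in> X" and y: "y \<in> X" "dist x y \<le> c/4" and k: "0 < k" "k \<le> \<kappa>\<^sub>0"
    and small: "\<bar>G x y - G x x\<bar> \<le> 2 * c * k"
  shows "\<exists>s. \<bar>s\<bar> \<le> k \<and> \<phi> s y \<in> H x"
proof -
  have cont: "continuous_on {-k..k} (\<lambda>s. G x (\<phi> s y))"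
    by (intro continuous_on_G flow_continuous continuous_intros flow_in) (use x y in auto)
  have d: "dist x (\<phi> s y) \<le> c/2" if "\<bar>s\<bar> \<le> k" for s
  proof -
    have "dist x (\<phi> s y) \<le> dist x y + dist (\<phi> s y) y" by (metis dist_triangle dist_commute)
    also have "dist (\<phi> s y) y \<le> c/4" using that k y by (intro near) auto
    finally show ?thesis using y by simp
  qed
  have "G x (\<phi> k y) \<ge> G x y + 2 * c * k" using x y c k by (intro G_increasing') auto
  then have 1: "G x x \<le> G x (\<phi> k y)" using small by linarith
  have "G x (\<phi> k (\<phi> (-k) y)) \<ge> G x (\<phi> (-k) y) + 2 * c * k"
    using x y k d[of "-k"] by (intro G_increasing' flow_in) auto
  then have 2: "G x (\<phi> (-k) y) \<le> G x x" using small y by (simp add: flow_add)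
  obtain s where "-k \<le> s" "s \<le> k" "G x (\<phi> s y) = G x x"
    using IVT'[OF 2 1 _ cont] k by auto
  then show ?thesis using d[of s] y by (intro exI[of _ s]) (auto simp: H_def flow_in abs_le_iff)
qed

section \<open>Dimension and cross sections\<close>

text \<open>An orbit meets \<open>H x\<close> at most once within time
  \<open>\<kappa>\<^sub>0\<close>, so the flow is injective on the closure of C times
  [0, \<open>\<kappa>\<^sub>0\<close>]. If p and q differed, this would be a square in K whose
  opposite sides are disjoint.\<close>

lemma section_continuum_trivial:
  assumes K: "K \<subseteq> X" "compact K" "covering_dim_le K 1" "\<And>t. \<phi> t ` K \<subseteq> K"
    and x: "x \<in> X" and C: "C \<subseteq> K \<inter> H x" "connected C" "p \<in> C" "q \<in> C"
  shows "p = q"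
proof (rule ccontr)
  assume pq: "p \<noteq> q"
  let ?D = "closure C"
  have KH: "compact (K \<inter> H x)" using compact_H[OF x] K(2) by (simp add: compact_Int)
  have D: "?D \<subseteq> K \<inter> H x" by (rule closure_minimal[OF C(1) compact_imp_closed[OF KH]])
  have cD: "compact ?D"
    using closed_Int_compact[OF closed_closure KH, of C] D by (simp add: Int_absorb2)
  have DX: "y \<in> X" if "y \<in> ?D" for y using D K(1) that by blast
  let ?\<Psi> = "\<lambda>z. \<phi> (\<kappa>\<^sub>0 * snd z) (fst z)"
  have same: "y = z \<and> s = t" if yz: "y \<in> ?D" "z \<in> ?D" and st: "s \<in> {0..1}" "t \<in> {0..1}"
    and eq: "\<phi> (\<kappa>\<^sub>0 * s) y = \<phi> (\<kappa>\<^sub>0 * t) z" for y z s t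
  proof -
    have "\<phi> (- (\<kappa>\<^sub>0 * t)) (\<phi> (\<kappa>\<^sub>0 * s) y) = z" using eq DX[OF yz(2)] by (simp add: flow_add)
    then have z: "z = \<phi> (\<kappa>\<^sub>0 * (s - t)) y" using DX[OF yz(1)] by (simp add: flow_add algebra_simps)
    have "\<bar>\<kappa>\<^sub>0 * (s - t)\<bar> \<le> \<kappa>\<^sub>0" using st \<kappa>\<^sub>0 by (auto simp: abs_mult abs_le_iff)
    moreover have "y \<in> H x" "\<phi> (\<kappa>\<^sub>0 * (s - t)) y \<in> H x" using yz D z by auto
    ultimately have "\<kappa>\<^sub>0 * (s - t) = 0" using H_unique[OF x] by blast
    then show ?thesis using z \<kappa>\<^sub>0 DX[OF yz(1)] by auto
  qed
  show False
  proof (rule no_square_in_dim_one[OF K(3) cD connected_imp_connected_closure[OF C(2)]])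
    show "p \<in> ?D" "q \<in> ?D" using C(3,4) closure_subset by blast+
    show "continuous_on (?D \<times> {0..1}) ?\<Psi>"
      by (intro flow_continuous continuous_intros) (use DX in auto)
    show "?\<Psi> ` (?D \<times> {0..1}) \<subseteq> K" using K(4) D by fastforce
    show "?\<Psi> ` ({p} \<times> {0..1}) \<inter> ?\<Psi> ` ({q} \<times> {0..1}) = {}"
    proof (rule equals0I)
      fix w assume "w \<in> ?\<Psi> ` ({p} \<times> {0..1}) \<inter> ?\<Psi> ` ({q} \<times> {0..1})"
      then obtain s t where "s \<in> {0..1}" "t \<in> {0..1}" "\<phi> (\<kappa>\<^sub>0 * s) p = \<phi> (\<kappa>\<^sub>0 * t) q" by auto
      then show False using same[OF \<open>p \<in> ?D\<close> \<open>q \<in> ?D\<close>] pq by blast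
    qed
    show "?\<Psi> ` (?D \<times> {0}) \<inter> ?\<Psi> ` (?D \<times> {1}) = {}"
      using same[of _ _ 0 1] by force
  qed
qed

text \<open>The box is homeomorphic to an interval times a zero-dimensional compact set. Products of
  short overlapping intervals with the members of a clopen partition of Z are small, and their order
  is that of the intervals, namely two.\<close>

lemma flow_box_dim:
  assumes x: "x \<in> X" and Z: "compact Z" "Z \<subseteq> H x"
    and dis: "\<And>C y z. C \<subseteq> Z \<Longrightarrow> connected C \<Longrightarrow> y \<in> C \<Longrightarrow> z \<in> C \<Longrightarrow> y = z"
  shows "covering_dim_le ((\<lambda>(t, z). \<phi> t z) ` ({- (\<kappa>\<^sub>0/2)..\<kappa>\<^sub>0/2} \<times> Z)) 1"
proof -
  \<comment> \<open>Two times in [-a, a] differ by at most \<open>\<kappa>\<^sub>0\<close>, as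
    \<open>H_unique\<close> requires.\<close>
  define a where "a = \<kappa>\<^sub>0 / 2"
  have a: "a > 0" using \<kappa>\<^sub>0 by (simp add: a_def)
  define h where "h = (\<lambda>(t, z). \<phi> t z)"
  let ?P = "{-a..a} \<times> Z"
  have ZX: "z \<in> X" if "z \<in> Z" for z using that Z(2) H_in by blast
  have ch: "continuous_on ?P h"
    unfolding h_def case_prod_beta by (intro flow_continuous continuous_intros) (use ZX in auto)
  have cP: "compact ?P" using Z by (simp add: compact_Times)
  have cB: "compact (h ` ?P)" by (rule compact_continuous_image[OF ch cP])
  have inj: "inj_on h ?P"
  proof (rule inj_onI)
    fix u v assume u: "u \<in> ?P" and v: "v \<in> ?P" and eq: "h u = h v"
    obtain s y t z where uv: "u = (s, y)" "v = (t, z)" by fastforce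
    have "y \<in> X" "z \<in> X" using u v uv ZX by auto
    have "\<phi> (-t) (\<phi> s y) = z" using eq uv \<open>z \<in> X\<close> by (simp add: h_def flow_add)
    then have z: "z = \<phi> (s - t) y" using \<open>y \<in> X\<close> by (simp add: flow_add)
    have "\<bar>s - t\<bar> \<le> \<kappa>\<^sub>0" using u v uv by (auto simp: a_def)
    moreover have "y \<in> H x" "\<phi> (s - t) y \<in> H x" using u v uv Z(2) z by auto
    ultimately have "s - t = 0" using H_unique[OF x] by blast
    then show "u = v" using z \<open>y \<in> X\<close> uv by simp
  qed
  \<comment> \<open>A continuous injection of a compact space is open onto its image, because
    complements have compact images.\<close>
  have oh: "openin (top_of_set (h ` ?P)) (h ` W)" if "openin (top_of_set ?P) W" for W
  proof -
    have W: "W \<subseteq> ?P" using that openin_imp_subset by blast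
    have "closedin (top_of_set ?P) (?P - W)" using that by (simp add: closedin_diff)
    then have "compact (?P - W)" using closedin_compact[OF cP] by blast
    then have "closed (h ` (?P - W))"
      by (intro compact_imp_closed compact_continuous_image continuous_on_subset[OF ch]) auto
    moreover have "h ` (?P - W) = h ` ?P - h ` W" by (rule inj_on_image_set_diff[OF inj _ W]) blast
    then have "h ` W = h ` ?P \<inter> - h ` (?P - W)" using image_mono[OF W, of h] by blast
    ultimately show ?thesis by (simp only:) (intro openin_open_Int open_Compl)
  qed
  have "covering_dim_le (h ` ?P) 1"
  proof (rule covering_dim_le_small_covers[OF cB])
    fix e :: real assume e: "e > 0"
    obtain d where d: "d > 0" "\<And>y z s t. y \<in> X \<Longrightarrow> z \<in> X \<Longrightarrow> \<bar>s\<bar> \<le> a \<Longrightarrow> \<bar>t\<bar> \<le> a \<Longrightarrow>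
      \<bar>s - t\<bar> \<le> d \<Longrightarrow> dist y z \<le> d \<Longrightarrow> dist (\<phi> s y) (\<phi> t z) \<le> e/2"
      by (rule flow_uniform[of "e/2" a]) (use e in auto)
    obtain \<P> where P: "finite \<P>" "\<Union>\<P> = Z" "\<And>P. P \<in> \<P> \<Longrightarrow> openin (top_of_set Z) P"
      "\<And>P Q. P \<in> \<P> \<Longrightarrow> Q \<in> \<P> \<Longrightarrow> P \<noteq> Q \<Longrightarrow> P \<inter> Q = {}"
      "\<And>P x y. P \<in> \<P> \<Longrightarrow> x \<in> P \<Longrightarrow> y \<in> P \<Longrightarrow> dist x y < d"
      by (rule clopen_partition_small[OF Z(1) dis d(1)]) (assumption | rule that)+
    define w where "w = d / 2"
    have w: "w > 0" using d by (simp add: w_def)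
    define N where "N = nat \<lceil>2 * a / w\<rceil>"
    \<comment> \<open>Intervals of radius w around -a + k w: each has length at most 2 w = d, and a
      time lies in at most two of them, necessarily consecutive ones.\<close>
    define J where "J k = {t \<in> {-a..a}. \<bar>t + a - real k * w\<bar> < w}" for k
    define D where "D = (\<lambda>(k, P). h ` (J k \<times> P)) ` ({..N} \<times> \<P>)"
    have Jcover: "\<exists>k\<le>N. t \<in> J k" if t: "t \<in> {-a..a}" for t
    proof -
      define k where "k = nat \<lfloor>(t + a) / w\<rfloor>"
      have "(t + a) / w \<ge> 0" using t w by simp
      then have k: "real k \<le> (t + a) / w" "(t + a) / w < real k + 1" unfolding k_def by linarith+
      then have "real k * w \<le> t + a" "t + a < real k * w + w" using w by (simp_all add: field_simps)
      then have "t \<in> J k" using t w by (simp add: J_def)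
      moreover have "(t + a) / w \<le> 2 * a / w" using t w by (intro divide_right_mono) auto
      then have "k \<le> N" using k unfolding N_def by linarith
      ultimately show ?thesis by blast
    qed
    have Jo: "openin (top_of_set {-a..a}) (J k)" for k
    proof -
      have "J k = {-a..a} \<inter> {t. \<bar>t + a - real k * w\<bar> < w}" by (auto simp: J_def)
      moreover have "open {t. \<bar>t + a - real k * w\<bar> < w}"
        by (intro open_Collect_less continuous_intros)
      ultimately show ?thesis by (simp add: openin_open_Int)
    qed
    have sub: "J k \<times> P \<subseteq> ?P" if "P \<in> \<P>" for k P using that P(2) by (auto simp: J_def)
    show "\<exists>D. finite D \<and> (\<forall>V\<in>D. openin (top_of_set (h ` ?P)) V) \<and> \<Union>D = h ` ?P \<and>
        (\<forall>V\<in>D. \<forall>x\<in>V. \<forall>y\<in>V. dist x y < e) \<and> (\<forall>x\<in>h ` ?P. card {V\<in>D. x \<in> V} \<le> 1 + 1)"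
    proof (intro exI[of _ D] conjI ballI)
      show "finite D" using P(1) by (simp add: D_def)
    next
      fix V assume "V \<in> D"
      then obtain k P where V: "V = h ` (J k \<times> P)" "P \<in> \<P>" unfolding D_def by auto
      show "openin (top_of_set (h ` ?P)) V" unfolding V(1)
        by (intro oh openin_Times Jo P(3) V(2))
    next
      show "\<Union>D = h ` ?P"
      proof
        show "\<Union>D \<subseteq> h ` ?P" unfolding D_def using sub by fast
        show "h ` ?P \<subseteq> \<Union>D"
        proof
          fix y assume "y \<in> h ` ?P"
          then obtain t z where tz: "t \<in> {-a..a}" "z \<in> Z" "y = h (t, z)" by blast
          then obtain k Q where "k \<le> N" "t \<in> J k" "Q \<in> \<P>" "z \<in> Q" using Jcover P(2) by blast
          then show "y \<in> \<Union>D" using tz(3) unfolding D_def by (intro UnionI[of "h ` (J k \<times> Q)"]) auto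
        qed
      qed
    next
      fix V u v assume V: "V \<in> D" and uv: "u \<in> V" "v \<in> V"
      obtain k P where kP: "V = h ` (J k \<times> P)" "P \<in> \<P>" using V unfolding D_def by auto
      obtain s y t z where st: "s \<in> J k" "y \<in> P" "u = \<phi> s y" "t \<in> J k" "z \<in> P" "v = \<phi> t z"
        using uv unfolding kP(1) h_def by auto
      have "y \<in> X" "z \<in> X" using st(2,5) kP(2) P(2) ZX by blast+
      moreover have "\<bar>s + a - real k * w\<bar> < w" "\<bar>t + a - real k * w\<bar> < w" using st(1,4) by (simp_all add: J_def)
      then have "\<bar>s - t\<bar> \<le> 2 * w" by linarith
      then have "\<bar>s - t\<bar> \<le> d" by (simp add: w_def)
      moreover have "\<bar>s\<bar> \<le> a" "\<bar>t\<bar> \<le> a" using st(1,4) by (auto simp: J_def)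
      ultimately have "dist u v \<le> e/2" unfolding st(3,6) using P(5)[OF kP(2) st(2,5)] by (intro d(2)) auto
      then show "dist u v < e" using e by simp
    next
      fix u assume "u \<in> h ` ?P"
      then obtain t z where tz: "t \<in> {-a..a}" "z \<in> Z" "u = h (t, z)" by blast
      obtain Q where Q: "Q \<in> \<P>" "z \<in> Q" using tz(2) P(2) by blast
      define k where "k = nat \<lfloor>(t + a) / w\<rfloor>"
      have "(t + a) / w \<ge> 0" using tz w by simp
      then have "real k \<le> (t + a) / w" "(t + a) / w < real k + 1" unfolding k_def by linarith+
      then have k: "real k * w \<le> t + a" "t + a < real k * w + w" using w by (simp_all add: field_simps)
      have "V \<in> (\<lambda>j. h ` (J j \<times> Q)) ` {k, Suc k}" if V: "V \<in> D" "u \<in> V" for V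
      proof -
        obtain j P where jP: "V = h ` (J j \<times> P)" "P \<in> \<P>" using V unfolding D_def by auto
        then obtain s y where sy: "s \<in> J j" "y \<in> P" "u = h (s, y)" using V(2) by blast
        have "(s, y) \<in> ?P" using sy sub[OF jP(2)] by blast
        moreover have "(t, z) \<in> ?P" using tz by blast
        ultimately have "(s, y) = (t, z)" using inj_onD[OF inj] sy(3) tz(3) by metis
        then have "P = Q" and tJ: "t \<in> J j" using P(4)[OF jP(2) Q(1)] sy Q by auto
        have "real j * w < (real k + 2) * w" "(real k - 1) * w < real j * w"
          using tJ k by (auto simp: J_def abs_less_iff algebra_simps)
        then have "real j < real k + 2" "real k - 1 < real j" using w by simp_all
        then have "j = k \<or> j = Suc k" by linarith
        then show ?thesis using jP(1) \<open>P = Q\<close> by blast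
      qed
      then have "{V\<in>D. u \<in> V} \<subseteq> (\<lambda>j. h ` (J j \<times> Q)) ` {k, Suc k}" by blast
      then have "card {V\<in>D. u \<in> V} \<le> card ((\<lambda>j. h ` (J j \<times> Q)) ` {k, Suc k})" by (intro card_mono) auto
      also have "\<dots> \<le> card {k, Suc k}" by (rule card_image_le) simp
      finally show "card {V\<in>D. u \<in> V} \<le> 1 + 1" by simp
    qed
  qed
  then show ?thesis by (simp add: h_def a_def)
qed

text \<open>An orbit arc of duration at most \<open>\<kappa>\<^sub>0\<close> meets a section only
  once, so under \<open>orb\<close> a piece of section of diameter at most r contains no nontrivial
  connected set, and its flow box has dimension at most one.\<close>

lemma flow_dim_le_1:
  assumes r: "r > 0"
    and orb: "\<And>C p q. C \<subseteq> X \<Longrightarrow> compact C \<Longrightarrow> connected C \<Longrightarrow> (\<And>y z. y \<in> C \<Longrightarrow> z \<in> C \<Longrightarrow> dist y z \<le> r) \<Longrightarrow>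
      p \<in> C \<Longrightarrow> q \<in> C \<Longrightarrow> \<exists>s. \<bar>s\<bar> \<le> \<kappa>\<^sub>0 \<and> q = \<phi> s p"
  shows "covering_dim_le X 1"
proof -
  define B where "B x = (\<lambda>(t, z). \<phi> t z) ` ({- (\<kappa>\<^sub>0/2)..\<kappa>\<^sub>0/2} \<times> (H x \<inter> cball x (r/2)))" for x
  have cZ: "compact (H x \<inter> cball x (r/2))" if "x \<in> X" for x
    using compact_H[OF that] by (simp add: compact_Int_closed)
  have BX: "B x \<subseteq> X" for x unfolding B_def by (auto intro!: flow_in dest: H_in)
  have cB: "compact (B x)" if "x \<in> X" for x
    unfolding B_def case_prod_beta
    by (intro compact_continuous_image flow_continuous continuous_intros compact_Times compact_Icc cZ that)
      (auto dest: H_in)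
  have dimB: "covering_dim_le (B x) 1" if x: "x \<in> X" for x
    unfolding B_def
  proof (rule flow_box_dim[OF x cZ[OF x]])
    show "H x \<inter> cball x (r/2) \<subseteq> H x" by blast
    fix C y z assume C: "C \<subseteq> H x \<inter> cball x (r/2)" "connected C" "y \<in> C" "z \<in> C"
    let ?D = "closure C"
    have D: "?D \<subseteq> H x \<inter> cball x (r/2)" by (rule closure_minimal[OF C(1) compact_imp_closed[OF cZ[OF x]]])
    have cD: "compact ?D"
      using closed_Int_compact[OF closed_closure cZ[OF x], of C] D by (simp add: Int_absorb2)
    have "\<exists>s. \<bar>s\<bar> \<le> \<kappa>\<^sub>0 \<and> z = \<phi> s y"
    proof (rule orb[OF _ cD connected_imp_connected_closure[OF C(2)]])
      show "?D \<subseteq> X" using D H_in by blast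
      show "y \<in> ?D" "z \<in> ?D" using C closure_subset by blast+
      show "dist u v \<le> r" if "u \<in> ?D" "v \<in> ?D" for u v
      proof -
        have "dist x u \<le> r/2" "dist x v \<le> r/2" using that D by auto
        then show ?thesis using dist_triangle3[of u v x] by linarith
      qed
    qed
    then obtain s where s: "\<bar>s\<bar> \<le> \<kappa>\<^sub>0" "z = \<phi> s y" by blast
    have "y \<in> H x" "\<phi> s y \<in> H x" using C s by auto
    then have "s = 0" using H_unique[OF x] s(1) by blast
    then show "y = z" using s(2) \<open>y \<in> H x\<close> H_in by simp
  qed
  have nbhd: "\<exists>e>0. X \<inter> ball x e \<subseteq> B x" if x: "x \<in> X" for x
  proof -
    obtain d where d: "d > 0" "\<And>y z s t. y \<in> X \<Longrightarrow> z \<in> X \<Longrightarrow> \<bar>s\<bar> \<le> \<kappa>\<^sub>0 \<Longrightarrow> \<bar>t\<bar> \<le> \<kappa>\<^sub>0 \<Longrightarrow>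
      \<bar>s - t\<bar> \<le> d \<Longrightarrow> dist y z \<le> d \<Longrightarrow> dist (\<phi> s y) (\<phi> t z) \<le> r/2"
      by (rule flow_uniform[of "r/2" \<kappa>\<^sub>0]) (use r in auto)
    \<comment> \<open>The bound \<open>\<kappa>\<^sub>0/2\<close> keeps the hitting time inside the
      box; the bound d keeps the hitting point within r/2 of x.\<close>
    define k where "k = min d (\<kappa>\<^sub>0/2)"
    have k: "0 < k" "k \<le> \<kappa>\<^sub>0/2" "k \<le> d" using d \<kappa>\<^sub>0 by (auto simp: k_def)
    have "continuous_on X (\<lambda>y. G x y)" by (intro continuous_on_G continuous_intros) (use x in auto)
    then have "\<exists>e>0. \<forall>y\<in>X. dist y x < e \<longrightarrow> dist (G x y) (G x x) < 2 * c * k"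
      using x c k(1) unfolding continuous_on_iff by auto
    then obtain e where e: "e > 0" "\<And>y. y \<in> X \<Longrightarrow> dist y x < e \<Longrightarrow> dist (G x y) (G x x) < 2 * c * k"
      by blast
    show ?thesis
    proof (intro exI[of _ "min e (min d (c/4))"] conjI subsetI)
      show "min e (min d (c/4)) > 0" using e d c by simp
      fix y assume "y \<in> X \<inter> ball x (min e (min d (c/4)))"
      then have y: "y \<in> X" "dist x y < e" "dist x y < d" "dist x y < c/4" by auto
      have "\<bar>G x y - G x x\<bar> \<le> 2 * c * k" using e(2)[OF y(1)] y(2) by (simp add: dist_commute dist_real_def)
      then obtain s where s: "\<bar>s\<bar> \<le> k" "\<phi> s y \<in> H x"
        using hit_H[OF x y(1) _ k(1)] y(4) k(2) \<kappa>\<^sub>0 by fastforce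
      have "dist (\<phi> 0 x) (\<phi> s y) \<le> r/2" using x y s k \<kappa>\<^sub>0 by (intro d(2)) auto
      then have "\<phi> s y \<in> H x \<inter> cball x (r/2)" using s(2) x by simp
      moreover have "y = (\<lambda>(t, z). \<phi> t z) (-s, \<phi> s y)" using y by (simp add: flow_add)
      moreover have "-s \<in> {- (\<kappa>\<^sub>0/2)..\<kappa>\<^sub>0/2}" using s(1) k(2) by auto
      ultimately show "y \<in> B x" unfolding B_def by blast
    qed
  qed
  then obtain e where e: "\<And>x. x \<in> X \<Longrightarrow> e x > 0 \<and> X \<inter> ball x (e x) \<subseteq> B x" by metis
  have "X \<subseteq> (\<Union>x\<in>X. ball x (e x))" using e by auto
  then obtain F where F: "F \<subseteq> X" "finite F" "X \<subseteq> (\<Union>x\<in>F. ball x (e x))"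
    by (rule compactE_image[OF compact_X, rotated]) simp_all
  show ?thesis
  proof (rule covering_dim_le_finite_closed_union[of "B ` F"])
    show "finite (B ` F)" using F(2) by simp
    show "\<Union>(B ` F) = X" using F e BX by blast
    fix A assume "A \<in> B ` F"
    then obtain x where "x \<in> X" "A = B x" using F(1) by blast
    then show "covering_dim_le A 1 \<and> closedin (top_of_set X) A"
      using dimB[of x] closed_subset[OF BX compact_imp_closed[OF cB, of x]] by simp
  qed
qed

end

section \<open>Projection to cross sections along an orbit\<close>

text \<open>
  All constants are chosen symmetric under time reversal, so that the locale can be interpreted for the
  reversed flow. The clock of an orbit is discrete: instead of a reparametrization in \<open>Rep\<close>, a pair of time
  sequences with increments in \<open>[1 - \<kappa>, 1 + \<kappa>]\<close> is used.
\<close>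

locale expansive_section = section_flow X \<phi> T c \<kappa>\<^sub>0
  for X :: "'a::metric_space set" and \<phi> T c \<kappa>\<^sub>0 +
  fixes \<kappa> \<rho> \<delta> :: real
  assumes \<kappa>: "0 < \<kappa>" "\<kappa> \<le> \<kappa>\<^sub>0 / 2" "\<kappa> \<le> 1/2"
    and \<rho>: "0 < \<rho>" "\<rho> \<le> c / 4"
    and \<rho>_close: "\<And>x y s. x \<in> X \<Longrightarrow> y \<in> X \<Longrightarrow> dist x y \<le> \<rho> \<Longrightarrow> \<bar>s\<bar> \<le> T \<Longrightarrow> dist (\<phi> s x) (\<phi> s y) \<le> 2 * c * \<kappa> / T"
    and \<delta>: "0 < \<delta>" "\<delta> \<le> \<rho>"
    and \<delta>_close: "\<And>x y s. x \<in> X \<Longrightarrow> y \<in> X \<Longrightarrow> dist x y \<le> \<delta> \<Longrightarrow> \<bar>s\<bar> \<le> 1 \<Longrightarrow> dist (\<phi> s x) (\<phi> s y) \<le> \<rho>"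
    and expand: "\<And>x y (t :: int \<Rightarrow> real) u. x \<in> X \<Longrightarrow> y \<in> X \<Longrightarrow> t 0 = 0 \<Longrightarrow> u 0 = 0 \<Longrightarrow>
      (\<And>n. t (n + 1) - t n \<in> {1 - \<kappa>..1 + \<kappa>}) \<Longrightarrow> (\<And>n. u (n + 1) - u n \<in> {1 - \<kappa>..1 + \<kappa>}) \<Longrightarrow>
      (\<And>n. dist (\<phi> (t n) x) (\<phi> (u n) y) \<le> \<delta>) \<Longrightarrow> \<exists>s. \<bar>s\<bar> \<le> \<kappa>\<^sub>0 \<and> y = \<phi> s x"
begin

text \<open>The constant in \<open>\<rho>_close\<close> is made for this: integrated over [0, T] it
  gives the tolerance that \<open>hit_H\<close> allows for hitting times up to \<kappa>.\<close>

lemma G_close: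
  assumes "x \<in> X" "y \<in> X" "dist x y \<le> \<rho>"
  shows "\<bar>G x y - G x x\<bar> \<le> 2 * c * \<kappa>"
proof -
  have int: "(\<lambda>s. dist (\<phi> s z) x) integrable_on {0..T}" if "z \<in> X" for z
    by (intro integrable_continuous_interval continuous_intros flow_continuous) (use that in auto)
  have "G x y - G x x = integral {0..T} (\<lambda>s. dist (\<phi> s y) x - dist (\<phi> s x) x)"
    unfolding G_def using int assms by (intro integral_diff[symmetric]) auto
  also have "norm \<dots> \<le> 2 * c * \<kappa> / T * (T - 0)"
  proof (rule integral_bound)
    show "continuous_on {0..T} (\<lambda>s. dist (\<phi> s y) x - dist (\<phi> s x) x)"
      by (intro continuous_intros flow_continuous) (use assms in auto)
    fix s assume s: "s \<in> {0..T}"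
    have "\<bar>dist (\<phi> s y) x - dist (\<phi> s x) x\<bar> \<le> dist (\<phi> s x) (\<phi> s y)"
      by (metis abs_dist_diff_le dist_commute)
    also have "\<dots> \<le> 2 * c * \<kappa> / T" using assms s by (intro \<rho>_close) auto
    finally show "norm (dist (\<phi> s y) x - dist (\<phi> s x) x) \<le> 2 * c * \<kappa> / T" by simp
  qed (use T in simp)
  finally show ?thesis using T by simp
qed

text \<open>For y within \<rho> of x the choice is forced: two such times differ by at most 2
  \<kappa> \<le> \<open>\<kappa>\<^sub>0\<close>, and an orbit meets \<open>H x\<close> only once in
  that time.\<close>

definition tau :: "'a \<Rightarrow> 'a \<Rightarrow> real" where
  "tau x y = (SOME s. \<bar>s\<bar> \<le> \<kappa> \<and> \<phi> s y \<in> H x)"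

lemma tau:
  assumes "x \<in> X" "y \<in> X" "dist x y \<le> \<rho>"
  shows "\<bar>tau x y\<bar> \<le> \<kappa>" "\<phi> (tau x y) y \<in> H x"
proof -
  have "\<exists>s. \<bar>s\<bar> \<le> \<kappa> \<and> \<phi> s y \<in> H x"
    using assms \<rho> \<kappa> \<kappa>\<^sub>0 by (intro hit_H G_close) auto
  from someI_ex[OF this] show "\<bar>tau x y\<bar> \<le> \<kappa>" "\<phi> (tau x y) y \<in> H x"
    unfolding tau_def by blast+
qed

lemma tau_unique:
  assumes "x \<in> X" "y \<in> X" "dist x y \<le> \<rho>" "\<bar>s\<bar> \<le> \<kappa>" "\<phi> s y \<in> H x"
  shows "s = tau x y"
proof -
  have "\<phi> (s - tau x y) (\<phi> (tau x y) y) = \<phi> s y" using assms by (simp add: flow_add)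
  moreover have "\<bar>s - tau x y\<bar> \<le> \<kappa>\<^sub>0" using tau(1)[OF assms(1-3)] assms(4) \<kappa> by linarith
  ultimately have "s - tau x y = 0"
    using H_unique[OF assms(1) tau(2)[OF assms(1-3)]] assms(5) by metis
  then show ?thesis by simp
qed

lemma tau_self: "x \<in> X \<Longrightarrow> tau x x = 0"
  using tau_unique[of x x 0] \<rho> \<kappa> H_self by simp

text \<open>The graph \<Gamma> is compact and projects injectively to the first coordinate, so the
  inverse of the projection is continuous.\<close>

lemma tau_continuous:
  assumes x: "x \<in> X"
  shows "continuous_on (X \<inter> cball x \<rho>) (tau x)"
proof -
  let ?D = "X \<inter> cball x \<rho>"
  let ?P = "?D \<times> {-\<kappa>..\<kappa>}"
  define \<Gamma> where "\<Gamma> = ?P \<inter> (\<lambda>z. \<phi> (snd z) (fst z)) -` H x"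
  have cP: "compact ?P" using compact_X by (simp add: compact_Times compact_Int_closed)
  have "continuous_on ?P (\<lambda>z. \<phi> (snd z) (fst z))"
    by (intro flow_continuous continuous_intros) auto
  then have "closedin (top_of_set ?P) \<Gamma>"
    unfolding \<Gamma>_def using compact_H[OF x] by (intro continuous_closedin_preimage compact_imp_closed)
  then have c\<Gamma>: "compact \<Gamma>" using closedin_compact[OF cP] by blast
  have graph: "z = (fst z, tau x (fst z))" if "z \<in> \<Gamma>" for z
    using that tau_unique[OF x, of "fst z" "snd z"] by (auto simp: \<Gamma>_def abs_le_iff)
  have "(y, tau x y) \<in> \<Gamma>" if "y \<in> ?D" for y
    using that tau[OF x, of y] by (auto simp: \<Gamma>_def abs_le_iff)
  then have "fst ` \<Gamma> = ?D" by (force simp: \<Gamma>_def)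
  moreover have "continuous_on (fst ` \<Gamma>) (\<lambda>y. (y, tau x y))"
    by (rule continuous_on_inv[OF _ c\<Gamma>]) (use graph in \<open>auto intro: continuous_intros\<close>)
  ultimately have "continuous_on ?D (\<lambda>y. snd (y, tau x y))" by (intro continuous_on_snd) simp
  then show ?thesis by simp
qed

text \<open>\<open>evo x n y\<close> is the time at which the orbit of \<open>y\<close> meets the cross section through \<open>\<phi> n x\<close>.\<close>

primrec evo :: "'a \<Rightarrow> nat \<Rightarrow> 'a \<Rightarrow> real" where
  "evo x 0 y = 0"
| "evo x (Suc n) y = evo x n y + 1 + tau (\<phi> (real (Suc n)) x) (\<phi> (evo x n y + 1) y)"

definition pos :: "'a \<Rightarrow> nat \<Rightarrow> 'a \<Rightarrow> 'a" where
  "pos x n y = \<phi> (evo x n y) y"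

lemma pos_0 [simp]: "y \<in> X \<Longrightarrow> pos x 0 y = y" by (simp add: pos_def)

lemma pos_in: "y \<in> X \<Longrightarrow> pos x n y \<in> X" by (simp add: pos_def flow_in)

lemma step_close:
  assumes x: "x \<in> X" and y: "y \<in> X" and d: "dist (\<phi> (real n) x) (pos x n y) \<le> \<delta>"
  shows "dist (\<phi> (real (Suc n)) x) (\<phi> (evo x n y + 1) y) \<le> \<rho>"
proof -
  have "dist (\<phi> 1 (\<phi> (real n) x)) (\<phi> 1 (pos x n y)) \<le> \<rho>"
    using x y d by (intro \<delta>_close flow_in pos_in) auto
  then show ?thesis using x y by (simp add: flow_add pos_def add.commute)
qed

lemma evo_step:
  assumes x: "x \<in> X" and y: "y \<in> X" and d: "dist (\<phi> (real n) x) (pos x n y) \<le> \<delta>"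
  shows "evo x (Suc n) y - evo x n y \<in> {1 - \<kappa>..1 + \<kappa>}"
    and "pos x (Suc n) y \<in> H (\<phi> (real (Suc n)) x)"
proof -
  let ?x = "\<phi> (real (Suc n)) x" and ?y = "\<phi> (evo x n y + 1) y"
  have xy: "?x \<in> X" "?y \<in> X" "dist ?x ?y \<le> \<rho>"
    using x y step_close[OF x y d] by (auto intro: flow_in)
  show "evo x (Suc n) y - evo x n y \<in> {1 - \<kappa>..1 + \<kappa>}"
    using tau(1)[OF xy] by (simp del: of_nat_Suc add: abs_le_iff)
  have "pos x (Suc n) y = \<phi> (tau ?x ?y) ?y" using y by (simp del: of_nat_Suc add: pos_def flow_add algebra_simps)
  then show "pos x (Suc n) y \<in> H ?x" using tau(2)[OF xy] by simp
qed

lemma evo_self: "x \<in> X \<Longrightarrow> evo x n x = real n"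
proof (induction n)
  case (Suc n)
  then have "evo x (Suc n) x = real n + 1 + tau (\<phi> (real (Suc n)) x) (\<phi> (real n + 1) x)" by simp
  also have "\<phi> (real n + 1) x = \<phi> (real (Suc n)) x" by (simp add: add.commute)
  finally show ?case using Suc.prems by (simp add: tau_self flow_in)
qed simp

text \<open>Each step composes with \<open>tau\<close>, which is continuous on the \<rho>-ball only;
  \<delta>-closeness at the earlier steps keeps all arguments there.\<close>

lemma evo_continuous:
  assumes x: "x \<in> X" and C: "C \<subseteq> X"
    and d: "\<And>k y. k < n \<Longrightarrow> y \<in> C \<Longrightarrow> dist (\<phi> (real k) x) (pos x k y) \<le> \<delta>"
  shows "continuous_on C (evo x n)"
  using d
proof (induction n)
  case 0
  then show ?case by (simp add: continuous_on_const[unfolded o_def] evo.simps(1)[abs_def])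
next
  case (Suc n)
  then have IH: "continuous_on C (evo x n)" by simp
  have c1: "continuous_on C (\<lambda>y. \<phi> (evo x n y + 1) y)"
    by (intro flow_continuous continuous_intros IH) (use C in auto)
  have "\<phi> (evo x n y + 1) y \<in> X \<inter> cball (\<phi> (real (Suc n)) x) \<rho>" if "y \<in> C" for y
    using step_close[OF x, of y n] Suc.prems[of n y] that C by (auto intro: flow_in)
  then have "continuous_on C (\<lambda>y. tau (\<phi> (real (Suc n)) x) (\<phi> (evo x n y + 1) y))"
    by (intro continuous_on_compose2[OF tau_continuous[OF flow_in[OF x]] c1]) blast
  then show ?case unfolding evo.simps(2)[abs_def] by (intro continuous_intros IH)
qed

text \<open>Pairs that stay \<delta>-close for longer and longer would have a limit pair, together
  with limit clocks, that stays close for all integers. By \<open>expand\<close> it lies on one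
  short orbit arc, while the lower bound \<eta> passes to the limit.\<close>

lemma separation_time:
  assumes \<eta>: "\<eta> > 0"
  shows "\<exists>N::nat. \<forall>x\<in>X. \<forall>y\<in>X. \<forall>t u :: int \<Rightarrow> real. (\<forall>s. \<bar>s\<bar> \<le> \<kappa>\<^sub>0 \<longrightarrow> dist (\<phi> s x) y \<ge> \<eta>) \<longrightarrow>
    t 0 = 0 \<longrightarrow> u 0 = 0 \<longrightarrow> (\<forall>n. t (n + 1) - t n \<in> {1 - \<kappa>..1 + \<kappa>}) \<longrightarrow> (\<forall>n. u (n + 1) - u n \<in> {1 - \<kappa>..1 + \<kappa>}) \<longrightarrow>
    (\<exists>n\<in>{- int N..int N}. dist (\<phi> (t n) x) (\<phi> (u n) y) > \<delta>)"
proof (rule ccontr)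
  define S where "S = {t :: int \<Rightarrow> real. t 0 = 0 \<and> (\<forall>n. t (n + 1) - t n \<in> {1 - \<kappa>..1 + \<kappa>})}"
  assume "\<not> ?thesis"
  then have "\<forall>N::nat. \<exists>x y t u. x \<in> X \<and> y \<in> X \<and> (\<forall>s. \<bar>s\<bar> \<le> \<kappa>\<^sub>0 \<longrightarrow> dist (\<phi> s x) y \<ge> \<eta>) \<and> t \<in> S \<and> u \<in> S \<and>
    (\<forall>n\<in>{- int N..int N}. dist (\<phi> (t n) x) (\<phi> (u n) y) \<le> \<delta>)"
    unfolding S_def mem_Collect_eq by (meson not_le)
  then obtain x y t u where xy: "\<And>N::nat. x N \<in> X" "\<And>N. y N \<in> X"
      "\<And>N s. \<bar>s\<bar> \<le> \<kappa>\<^sub>0 \<Longrightarrow> dist (\<phi> s (x N)) (y N) \<ge> \<eta>"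
    and tu: "\<And>N. t N \<in> S" "\<And>N. u N \<in> S"
    and close: "\<And>N n. n \<in> {- int N..int N} \<Longrightarrow> dist (\<phi> (t N n) (x N)) (\<phi> (u N n) (y N)) \<le> \<delta>"
    by metis
  \<comment> \<open>The clocks must converge too. Their increments are at most 3/2, so coordinate n
    is bounded by 2 |n|, and the product of these intervals is compact.\<close>
  let ?\<Pi> = "Pi UNIV (\<lambda>n::int. {- 2 * real_of_int \<bar>n\<bar>..2 * real_of_int \<bar>n\<bar>})"
  have c\<Pi>: "compact ?\<Pi>"
  proof -
    have "compactin (product_topology (\<lambda>_::int. euclidean :: real topology) UNIV)
        (PiE UNIV (\<lambda>n::int. {- 2 * real_of_int \<bar>n\<bar>..2 * real_of_int \<bar>n\<bar>}))"
      by (subst compactin_PiE) auto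
    then show ?thesis by (simp only: euclidean_product_topology PiE_UNIV_domain compactin_euclidean_iff)
  qed
  have S\<Pi>: "S \<subseteq> ?\<Pi>"
  proof
    fix t assume t: "t \<in> S"
    have inc: "1 - \<kappa> \<le> t (n + 1) - t n" "t (n + 1) - t n \<le> 1 + \<kappa>" for n
      using t by (auto simp: S_def)
    have pos: "\<bar>t (int k)\<bar> \<le> 2 * real k" for k
    proof (induction k)
      case (Suc k)
      then show ?case using inc[of "int k"] \<kappa> by (auto simp: add.commute)
    qed (use t in \<open>simp add: S_def\<close>)
    have neg: "\<bar>t (- int k)\<bar> \<le> 2 * real k" for k
    proof (induction k)
      case (Suc k)
      have "- int (Suc k) + 1 = - int k" by simp
      then show ?case using inc[of "- int (Suc k)"] Suc \<kappa> by (auto simp: abs_le_iff)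
    qed (use t in \<open>simp add: S_def\<close>)
    show "t \<in> ?\<Pi>"
    proof (rule Pi_I)
      fix n :: int
      have "\<bar>t n\<bar> \<le> 2 * real_of_int \<bar>n\<bar>" using pos[of "nat n"] neg[of "nat (-n)"] by (cases "n \<ge> 0") auto
      then show "t n \<in> {- 2 * real_of_int \<bar>n\<bar>..2 * real_of_int \<bar>n\<bar>}" by auto
    qed
  qed
  have "compact (X \<times> X \<times> ?\<Pi> \<times> ?\<Pi>)" using compact_X c\<Pi> by (intro compact_Times)
  then have "seq_compact (X \<times> X \<times> ?\<Pi> \<times> ?\<Pi>)" by (rule compact_imp_seq_compact)
  moreover have "\<forall>N. (x N, y N, t N, u N) \<in> X \<times> X \<times> ?\<Pi> \<times> ?\<Pi>" using xy(1,2) tu S\<Pi> by blast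
  ultimately obtain l r where l: "l \<in> X \<times> X \<times> ?\<Pi> \<times> ?\<Pi>" and r: "strict_mono (r :: nat \<Rightarrow> nat)"
    and lim: "((\<lambda>N. (x N, y N, t N, u N)) \<circ> r) \<longlonglongrightarrow> l"
    by (rule seq_compactE)
  obtain a b p q where abpq: "l = (a, b, p, q)" by (cases l)
  have lims: "(\<lambda>N. x (r N)) \<longlonglongrightarrow> a" "(\<lambda>N. y (r N)) \<longlonglongrightarrow> b" "(\<lambda>N. t (r N)) \<longlonglongrightarrow> p" "(\<lambda>N. u (r N)) \<longlonglongrightarrow> q"
    using tendsto_fst[OF lim] tendsto_fst[OF tendsto_snd[OF lim]] tendsto_fst[OF tendsto_snd[OF tendsto_snd[OF lim]]]
      tendsto_snd[OF tendsto_snd[OF tendsto_snd[OF lim]]]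
    by (simp_all add: abpq o_def)
  have ab: "a \<in> X" "b \<in> X" using l abpq by auto
  have coord: "(\<lambda>N. v (r N) n) \<longlonglongrightarrow> w n" if "(\<lambda>N. v (r N)) \<longlonglongrightarrow> w" for v :: "nat \<Rightarrow> int \<Rightarrow> real" and w n
  proof -
    have "continuous_on UNIV (\<lambda>f :: int \<Rightarrow> real. f n)" by simp
    from continuous_on_tendsto_compose[OF this that] show ?thesis by simp
  qed
  have limS: "w 0 = 0 \<and> (\<forall>n. w (n + 1) - w n \<in> {1 - \<kappa>..1 + \<kappa>})"
    if "(\<lambda>N. v (r N)) \<longlonglongrightarrow> w" "\<And>N. v N \<in> S" for v :: "nat \<Rightarrow> int \<Rightarrow> real" and w
  proof (intro conjI allI)
    have "(\<lambda>N. v (r N) 0) \<longlonglongrightarrow> w 0" by (rule coord[OF that(1)])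
    moreover have "(\<lambda>N. v (r N) 0) = (\<lambda>N. 0)" using that(2) by (simp add: S_def)
    ultimately show "w 0 = 0" by (simp add: LIMSEQ_const_iff)
    fix n
    have "(\<lambda>N. v (r N) (n + 1) - v (r N) n) \<longlonglongrightarrow> w (n + 1) - w n"
      by (intro tendsto_diff coord[OF that(1)])
    then show "w (n + 1) - w n \<in> {1 - \<kappa>..1 + \<kappa>}"
      by (rule closed_sequentially[OF closed_atLeastAtMost, rotated]) (use that(2) in \<open>auto simp: S_def\<close>)
  qed
  have "\<exists>s. \<bar>s\<bar> \<le> \<kappa>\<^sub>0 \<and> b = \<phi> s a"
  proof (rule expand[OF ab])
    fix n
    have "(\<lambda>N. dist (\<phi> (t (r N) n) (x (r N))) (\<phi> (u (r N) n) (y (r N)))) \<longlonglongrightarrow> dist (\<phi> (p n) a) (\<phi> (q n) b)"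
      by (intro tendsto_dist flow_tendsto coord lims ab xy)
    moreover have "\<exists>M. \<forall>N\<ge>M. dist (\<phi> (t (r N) n) (x (r N))) (\<phi> (u (r N) n) (y (r N))) \<le> \<delta>"
    proof (intro exI allI impI)
      fix N assume "nat \<bar>n\<bar> \<le> N"
      then have "nat \<bar>n\<bar> \<le> r N" using seq_suble[OF r, of N] by linarith
      then show "dist (\<phi> (t (r N) n) (x (r N))) (\<phi> (u (r N) n) (y (r N))) \<le> \<delta>"
        by (intro close) auto
    qed
    ultimately show "dist (\<phi> (p n) a) (\<phi> (q n) b) \<le> \<delta>" by (rule LIMSEQ_le_const2)
  qed (use limS[OF lims(3) tu(1)] limS[OF lims(4) tu(2)] in auto)
  then obtain s where s: "\<bar>s\<bar> \<le> \<kappa>\<^sub>0" "b = \<phi> s a" by blast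
  have "(\<lambda>N. dist (\<phi> s (x (r N))) (y (r N))) \<longlonglongrightarrow> dist (\<phi> s a) b"
    by (intro tendsto_dist flow_tendsto lims tendsto_const ab xy)
  then have "\<eta> \<le> dist (\<phi> s a) b" by (rule LIMSEQ_le_const) (use xy(3)[OF s(1)] in blast)
  then show False using s(2) \<eta> by simp
qed

end

section \<open>Cutting continua away from an invariant set\<close>

locale avoiding_flow = expansive_section X \<phi> T c \<kappa>\<^sub>0 \<kappa> \<rho> \<delta>
  for X :: "'a::metric_space set" and \<phi> T c \<kappa>\<^sub>0 \<kappa> \<rho> \<delta> +
  fixes K :: "'a set"
  assumes K_sub: "K \<subseteq> X" and K_compact: "compact K" and K_ne: "K \<noteq> {}"
    and K_inv: "\<And>t. \<phi> t ` K \<subseteq> K" and K_dim: "covering_dim_le K 1"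
begin

text \<open>Otherwise continua in sections accumulate on \<open>K \<inter> H a\<close>, with
  distinct limits a and b of the marked points. That set has no nontrivial continua, so it splits
  into compact parts P and Q containing a and b. Disjoint neighbourhoods of P and Q eventually
  contain the continua and disconnect them.\<close>

lemma section_continuum_leaves_K:
  "\<exists>\<eta>>0. \<forall>x D y. x \<in> X \<longrightarrow> D \<subseteq> H x \<longrightarrow> connected D \<longrightarrow> x \<in> D \<longrightarrow> y \<in> D \<longrightarrow>
     dist x y \<ge> \<delta>/2 \<longrightarrow> (\<exists>p\<in>D. infdist p K \<ge> 2 * \<eta>)"
proof (rule ccontr)
  assume contr: "\<not> ?thesis"
  have "\<exists>x D y. x \<in> X \<and> D \<subseteq> H x \<and> connected D \<and> x \<in> D \<and> y \<in> D \<and> dist x y \<ge> \<delta>/2 \<and>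
      (\<forall>p\<in>D. infdist p K < 2 * inverse (real (Suc n)))" for n
  proof -
    have "inverse (real (Suc n)) > 0" by simp
    then show ?thesis using contr by (meson not_le)
  qed
  then obtain x D y where x: "\<And>n. x n \<in> X" and D: "\<And>n. D n \<subseteq> H (x n)" "\<And>n. connected (D n)"
      "\<And>n. x n \<in> D n" "\<And>n. y n \<in> D n"
    and far: "\<And>n. dist (x n) (y n) \<ge> \<delta>/2"
    and near: "\<And>n p. p \<in> D n \<Longrightarrow> infdist p K < 2 * inverse (real (Suc n))"
    by metis
  have DX: "D n \<subseteq> X" for n using D(1) H_in by blast
  have sc: "seq_compact X" using compact_X by (rule compact_imp_seq_compact)
  have "\<forall>n. x n \<in> X" using x by blast
  then obtain a r where a: "a \<in> X" and r: "strict_mono (r :: nat \<Rightarrow> nat)" and xa: "(x \<circ> r) \<longlonglongrightarrow> a"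
    by (rule seq_compactE[OF sc]) (rule that)
  \<comment> \<open>Stated for index sequences that merely tend to infinity, since those chosen in
    \<open>sub\<close> need not be monotone.\<close>
  have lim: "z' \<in> K \<inter> H a" if i: "filterlim i at_top sequentially" "(\<lambda>n. x (i n)) \<longlonglongrightarrow> a"
    and z: "\<And>n. z n \<in> D (i n)" "z \<longlonglongrightarrow> z'" for i z z'
  proof
    show "z' \<in> H a" by (rule H_limit[OF x _ i(2) z(2) a]) (use z(1) D(1) in blast)
    have "(\<lambda>n. 2 * inverse (real (Suc (i n)))) \<longlonglongrightarrow> 2 * 0"
      by (intro tendsto_mult tendsto_const filterlim_compose[OF LIMSEQ_inverse_real_of_nat i(1)])
    then have lim0: "(\<lambda>n. 2 * inverse (real (Suc (i n)))) \<longlonglongrightarrow> 0" by simp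
    have "(\<lambda>n. infdist (z n) K) \<longlonglongrightarrow> 0"
    proof (rule tendsto_sandwich[OF _ _ tendsto_const lim0])
      show "\<forall>\<^sub>F n in sequentially. 0 \<le> infdist (z n) K" by (simp add: infdist_nonneg)
      show "\<forall>\<^sub>F n in sequentially. infdist (z n) K \<le> 2 * inverse (real (Suc (i n)))"
        using less_imp_le[OF near[OF z(1)]] by (intro always_eventually allI)
    qed
    moreover have "(\<lambda>n. infdist (z n) K) \<longlonglongrightarrow> infdist z' K" by (intro tendsto_infdist z(2))
    ultimately have "infdist z' K = 0" using LIMSEQ_unique by blast
    then show "z' \<in> K" using in_closed_iff_infdist_zero[OF compact_imp_closed[OF K_compact] K_ne] by blast
  qed
  obtain b r' where b: "b \<in> X" and r': "strict_mono (r' :: nat \<Rightarrow> nat)" and yb: "((y \<circ> r) \<circ> r') \<longlonglongrightarrow> b"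
  proof -
    have "\<forall>n. (y \<circ> r) n \<in> X" using D(4) DX by auto
    then show thesis by (rule seq_compactE[OF sc]) (rule that)
  qed
  define s where "s = r \<circ> r'"
  have s: "strict_mono s" unfolding s_def using r r' by (rule strict_mono_o)
  have xs: "(\<lambda>n. x (s n)) \<longlonglongrightarrow> a" using LIMSEQ_subseq_LIMSEQ[OF xa r'] by (simp add: s_def o_def)
  have ys: "(\<lambda>n. y (s n)) \<longlonglongrightarrow> b" using yb by (simp add: s_def o_def)
  have aK: "a \<in> K \<inter> H a" by (rule lim[OF filterlim_subseq[OF s] xs D(3) xs])
  have bK: "b \<in> K \<inter> H a" by (rule lim[OF filterlim_subseq[OF s] xs D(4) ys])
  have "(\<lambda>n. dist (x (s n)) (y (s n))) \<longlonglongrightarrow> dist a b" by (intro tendsto_dist xs ys)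
  then have "\<delta>/2 \<le> dist a b" by (rule LIMSEQ_le_const) (use far in blast)
  then have ab: "a \<noteq> b" using \<delta> by auto
  have cKH: "compact (K \<inter> H a)" using K_compact compact_H[OF a] by (simp add: compact_Int)
  have "{a} \<subseteq> K \<inter> H a" "{b} \<subseteq> K \<inter> H a" using aK bK by auto
  moreover have "C \<inter> {a} = {} \<or> C \<inter> {b} = {}" if "C \<subseteq> K \<inter> H a" "connected C" for C
    using section_continuum_trivial[OF K_sub K_compact K_dim K_inv a that] ab by blast
  ultimately obtain P Q where PQ: "P \<union> Q = K \<inter> H a" "P \<inter> Q = {}" "{a} \<subseteq> P" "{b} \<subseteq> Q" "compact P" "compact Q"
    by (rule connected_or_separated[OF cKH compact_sing compact_sing])
  obtain U V where UV: "open U" "open V" "P \<subseteq> U" "Q \<subseteq> V" "U \<inter> V = {}"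
    using t4_space[OF compact_imp_closed[OF PQ(5)] compact_imp_closed[OF PQ(6)] PQ(2)] by blast
  have sub: "\<exists>m. \<forall>n\<ge>m. D (s n) \<subseteq> U \<union> V"
  proof (rule ccontr)
    assume "\<not> ?thesis"
    then have "\<forall>m. \<exists>n z. n \<ge> m \<and> z \<in> D (s n) \<and> z \<notin> U \<union> V" by blast
    then obtain f z where f: "\<And>m. f m \<ge> m" and z: "\<And>m. z m \<in> D (s (f m))" "\<And>m. z m \<notin> U \<union> V" by metis
    have "\<forall>n. z n \<in> X" using z(1) DX by blast
    then obtain z' q where q: "strict_mono (q :: nat \<Rightarrow> nat)" and zz: "(z \<circ> q) \<longlonglongrightarrow> z'"
      by (rule seq_compactE[OF sc]) (rule that)
    have fq: "filterlim (\<lambda>n. f (q n)) at_top sequentially"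
      by (rule filterlim_at_top_mono[OF filterlim_subseq[OF q]]) (use f in simp)
    have "z' \<in> K \<inter> H a"
    proof (rule lim)
      show "filterlim (\<lambda>n. s (f (q n))) at_top sequentially"
        by (rule filterlim_compose[OF filterlim_subseq[OF s] fq])
      show "(\<lambda>n. x (s (f (q n)))) \<longlonglongrightarrow> a" by (rule filterlim_compose[OF xs fq])
      show "(z \<circ> q) n \<in> D (s (f (q n)))" for n using z(1) by simp
    qed (rule zz)
    then have "z' \<in> U \<union> V" using PQ(1) UV by blast
    then have "\<forall>\<^sub>F n in sequentially. (z \<circ> q) n \<in> U \<union> V"
      using topological_tendstoD[OF zz, of "U \<union> V"] UV(1,2) by blast
    then show False using z(2) by (auto simp: eventually_sequentially)
  qed
  have "\<forall>\<^sub>F n in sequentially. x (s n) \<in> U" using topological_tendstoD[OF xs UV(1)] PQ(3) UV(3) by blast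
  moreover have "\<forall>\<^sub>F n in sequentially. y (s n) \<in> V" using topological_tendstoD[OF ys UV(2)] PQ(4) UV(4) by blast
  moreover have "\<forall>\<^sub>F n in sequentially. D (s n) \<subseteq> U \<union> V" using sub by (simp add: eventually_sequentially)
  ultimately have "\<forall>\<^sub>F n in sequentially. x (s n) \<in> U \<and> y (s n) \<in> V \<and> D (s n) \<subseteq> U \<union> V"
    by (intro eventually_conj)
  then obtain n where n: "x (s n) \<in> U" "y (s n) \<in> V" "D (s n) \<subseteq> U \<union> V"
    unfolding eventually_sequentially by blast
  then show False
    using connectedD[OF D(2) UV(1,2), of "s n"] UV(5) D(3,4) by blast
qed

text \<open>Turns distance inside a section into distance from a short orbit arc, the form in which
  \<open>separation_time\<close> takes it. In a limit of counterexamples p' and q' lie in one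
  section and on one arc, so they coincide.\<close>

lemma section_points_transverse:
  assumes \<eta>: "\<eta> > 0"
  shows "\<exists>e>0. \<forall>x p q s. x \<in> X \<longrightarrow> p \<in> H x \<longrightarrow> q \<in> H x \<longrightarrow> dist p q = \<eta> \<longrightarrow> \<bar>s\<bar> \<le> \<kappa>\<^sub>0 \<longrightarrow> dist (\<phi> s p) q \<ge> e"
proof (rule ccontr)
  assume contr: "\<not> ?thesis"
  have "\<exists>x p q s. x \<in> X \<and> p \<in> H x \<and> q \<in> H x \<and> dist p q = \<eta> \<and> \<bar>s\<bar> \<le> \<kappa>\<^sub>0 \<and>
      dist (\<phi> s p) q < inverse (real (Suc n))" for n
  proof -
    have "inverse (real (Suc n)) > 0" by simp
    then show ?thesis using contr by (meson not_le)
  qed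
  then obtain x p q s where x: "\<And>n. x n \<in> X" and pq: "\<And>n. p n \<in> H (x n)" "\<And>n. q n \<in> H (x n)" "\<And>n. dist (p n) (q n) = \<eta>"
    and s: "\<And>n. \<bar>s n\<bar> \<le> \<kappa>\<^sub>0" and close: "\<And>n. dist (\<phi> (s n) (p n)) (q n) < inverse (real (Suc n))"
    by metis
  have pqX: "p n \<in> X" "q n \<in> X" for n using pq H_in by blast+
  have "compact (X \<times> X \<times> X \<times> {-\<kappa>\<^sub>0..\<kappa>\<^sub>0})" using compact_X by (intro compact_Times compact_Icc)
  then have "seq_compact (X \<times> X \<times> X \<times> {-\<kappa>\<^sub>0..\<kappa>\<^sub>0})" by (rule compact_imp_seq_compact)
  moreover have "\<forall>n. (x n, p n, q n, s n) \<in> X \<times> X \<times> X \<times> {-\<kappa>\<^sub>0..\<kappa>\<^sub>0}"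
    using x pqX s by (auto simp: abs_le_iff) (meson minus_le_iff)
  ultimately obtain l r where l: "l \<in> X \<times> X \<times> X \<times> {-\<kappa>\<^sub>0..\<kappa>\<^sub>0}" and r: "strict_mono (r :: nat \<Rightarrow> nat)"
    and lim: "((\<lambda>n. (x n, p n, q n, s n)) \<circ> r) \<longlonglongrightarrow> l"
    by (rule seq_compactE)
  obtain x' p' q' s' where l': "l = (x', p', q', s')" by (cases l)
  have lims: "(\<lambda>n. x (r n)) \<longlonglongrightarrow> x'" "(\<lambda>n. p (r n)) \<longlonglongrightarrow> p'" "(\<lambda>n. q (r n)) \<longlonglongrightarrow> q'" "(\<lambda>n. s (r n)) \<longlonglongrightarrow> s'"
    using tendsto_fst[OF lim] tendsto_fst[OF tendsto_snd[OF lim]] tendsto_fst[OF tendsto_snd[OF tendsto_snd[OF lim]]]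
      tendsto_snd[OF tendsto_snd[OF tendsto_snd[OF lim]]]
    by (simp_all add: l' o_def)
  have X': "x' \<in> X" "p' \<in> X" "q' \<in> X" "\<bar>s'\<bar> \<le> \<kappa>\<^sub>0" using l l' by (auto simp: abs_le_iff)
  have "p' \<in> H x'" by (rule H_limit[OF _ _ lims(1,2) X'(1)]) (use x pq in auto)
  moreover have q': "q' \<in> H x'" by (rule H_limit[OF _ _ lims(1,3) X'(1)]) (use x pq in auto)
  moreover have "(\<lambda>n. dist (\<phi> (s (r n)) (p (r n))) (q (r n))) \<longlonglongrightarrow> dist (\<phi> s' p') q'"
    by (intro tendsto_dist flow_tendsto lims pqX X')
  then have "dist (\<phi> s' p') q' \<le> 0"
  proof (rule LIMSEQ_le[OF _ LIMSEQ_inverse_real_of_nat], intro exI allI impI)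
    fix n :: nat
    have "inverse (real (Suc (r n))) \<le> inverse (real (Suc n))"
      using seq_suble[OF r, of n] by (intro le_imp_inverse_le) auto
    then show "dist (\<phi> (s (r n)) (p (r n))) (q (r n)) \<le> inverse (real (Suc n))"
      using close[of "r n"] by linarith
  qed
  then have eq: "\<phi> s' p' = q'" by simp
  ultimately have "s' = 0" using H_unique[OF X'(1), of p' s'] X'(4) by simp
  then have "p' = q'" using eq X' by simp
  moreover have "(\<lambda>n. dist (p (r n)) (q (r n))) \<longlonglongrightarrow> dist p' q'" by (intro tendsto_dist lims)
  then have "dist p' q' = \<eta>" using pq(3) by (simp add: LIMSEQ_const_iff)
  ultimately show False using \<eta> by simp
qed

text \<open>Everything that the iteration uses about the dimension of K, with constants that depend
  neither on x nor on D.\<close>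

definition cutting :: "real \<Rightarrow> real \<Rightarrow> bool" where
  "cutting \<eta> \<theta> \<longleftrightarrow> (\<forall>x D y. x \<in> X \<longrightarrow> D \<subseteq> H x \<longrightarrow> compact D \<longrightarrow> connected D \<longrightarrow> x \<in> D \<longrightarrow> y \<in> D \<longrightarrow>
     dist x y \<ge> \<delta>/2 \<longrightarrow> (\<exists>E p q. E \<subseteq> D \<and> compact E \<and> connected E \<and> p \<in> E \<and> q \<in> E \<and>
       (\<forall>z\<in>E. \<forall>w\<in>E. dist z w \<le> \<delta>) \<and> (\<forall>z\<in>E. infdist z K \<ge> \<eta>) \<and> (\<forall>s. \<bar>s\<bar> \<le> \<kappa>\<^sub>0 \<longrightarrow> dist (\<phi> s p) q \<ge> \<theta>)))"

lemma cutting_exists: "\<exists>\<eta>>0. \<exists>\<theta>>0. cutting \<eta> \<theta>"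
proof -
  obtain \<eta>' where \<eta>': "\<eta>' > 0" "\<And>x D y. x \<in> X \<Longrightarrow> D \<subseteq> H x \<Longrightarrow> connected D \<Longrightarrow> x \<in> D \<Longrightarrow> y \<in> D \<Longrightarrow>
     dist x y \<ge> \<delta>/2 \<Longrightarrow> \<exists>p\<in>D. infdist p K \<ge> 2 * \<eta>'"
    using section_continuum_leaves_K by blast
  \<comment> \<open>As D contains two points at distance \<delta>/2, one of them is at distance at
    least \<delta>/4 from p, so a piece of radius \<eta> can be cut at p. Moving by \<eta> \<le>
    \<open>\<eta>'\<close> from a point at distance 2 \<open>\<eta>'\<close> from K leaves distance
    at least \<eta>.\<close>
  define \<eta> where "\<eta> = min \<eta>' (\<delta>/4)"
  have \<eta>: "\<eta> > 0" "\<eta> \<le> \<eta>'" "\<eta> \<le> \<delta>/4" using \<eta>'(1) \<delta> by (auto simp: \<eta>_def)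
  obtain \<theta> where \<theta>: "\<theta> > 0" "\<And>x p q s. x \<in> X \<Longrightarrow> p \<in> H x \<Longrightarrow> q \<in> H x \<Longrightarrow> dist p q = \<eta> \<Longrightarrow> \<bar>s\<bar> \<le> \<kappa>\<^sub>0 \<Longrightarrow> dist (\<phi> s p) q \<ge> \<theta>"
    using section_points_transverse[OF \<eta>(1)] by blast
  have "cutting \<eta> \<theta>"
    unfolding cutting_def
  proof (intro allI impI)
    fix x D y
    assume D: "x \<in> X" "D \<subseteq> H x" "compact D" "connected D" "x \<in> D" "y \<in> D" "dist x y \<ge> \<delta>/2"
    obtain p where p: "p \<in> D" "infdist p K \<ge> 2 * \<eta>'" using \<eta>'(2)[OF D(1,2,4-7)] by blast
    have "dist x y \<le> dist p x + dist p y" by (rule dist_triangle3)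
    then have "dist p x \<ge> \<eta> \<or> dist p y \<ge> \<eta>" using D(7) \<eta>(3) by linarith
    then obtain z where z: "z \<in> D" "dist p z \<ge> \<eta>" using D(5,6) by blast
    obtain E q where E: "E \<subseteq> D" "compact E" "connected E" "p \<in> E" "q \<in> E" "dist p q = \<eta>" "E \<subseteq> cball p \<eta>"
      by (rule boundary_bumping_cball[OF D(3,4) p(1) \<eta>(1) z])
    show "\<exists>E p q. E \<subseteq> D \<and> compact E \<and> connected E \<and> p \<in> E \<and> q \<in> E \<and>
       (\<forall>z\<in>E. \<forall>w\<in>E. dist z w \<le> \<delta>) \<and> (\<forall>z\<in>E. infdist z K \<ge> \<eta>) \<and> (\<forall>s. \<bar>s\<bar> \<le> \<kappa>\<^sub>0 \<longrightarrow> dist (\<phi> s p) q \<ge> \<theta>)"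
    proof (rule exI[of _ E], rule exI[of _ p], rule exI[of _ q], intro conjI ballI allI impI E(1-5))
      show "dist z w \<le> \<delta>" if "z \<in> E" "w \<in> E" for z w
      proof -
        have "dist p z \<le> \<eta>" "dist p w \<le> \<eta>" using that E(7) by auto
        then show ?thesis using dist_triangle3[of z w p] \<eta>(3) \<delta> by linarith
      qed
      show "\<eta> \<le> infdist z K" if "z \<in> E" for z
      proof -
        have "dist p z \<le> \<eta>" using that E(7) by auto
        then show ?thesis using infdist_triangle[of p K z] p(2) \<eta>(2) by linarith
      qed
      show "\<theta> \<le> dist (\<phi> s p) q" if "\<bar>s\<bar> \<le> \<kappa>\<^sub>0" for s
        using \<theta>(2)[OF D(1) _ _ E(6) that] E(1,4,5) D(2) by blast
    qed
  qed
  then show ?thesis using \<eta>(1) \<theta>(1) by blast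
qed

text \<open>
  Continuity of the backward times \<open>g j\<close> in the point is not required: only the forward evolution has to
  preserve connectedness.
\<close>

definition history :: "nat \<Rightarrow> 'a set \<Rightarrow> bool" where
  "history N E \<longleftrightarrow> (\<exists>g :: nat \<Rightarrow> 'a \<Rightarrow> real.
     (\<forall>y\<in>E. g 0 y = 0 \<and> (\<forall>j. g j y - g (Suc j) y \<in> {1 - \<kappa>..1 + \<kappa>})) \<and>
     (\<forall>y\<in>E. \<forall>z\<in>E. \<forall>j\<le>N. dist (\<phi> (g j y) y) (\<phi> (g j z) z) \<le> \<delta>))"

text \<open>E is carried along the orbit of p up to the first step n at which some point is more
  than \<delta>/2 away from it. The image is then a continuum in one section, large enough to be
  cut. Before n all points are within \<delta>/2 of the orbit of p, hence \<delta>-close to each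
  other, which supplies the most recent part of the new history.\<close>

lemma advance:
  assumes cut: "cutting \<eta> \<theta>" and E: "E \<subseteq> X" "compact E" "connected E" "p \<in> E" and hist: "history N E"
    and m: "m \<ge> 1" "y\<^sub>0 \<in> E" "dist (\<phi> (real m) p) (pos p m y\<^sub>0) > \<delta>/2"
  shows "\<exists>E' p' q'. E' \<subseteq> X \<and> compact E' \<and> connected E' \<and> p' \<in> E' \<and> q' \<in> E' \<and> history N E' \<and>
    (\<forall>s. \<bar>s\<bar> \<le> \<kappa>\<^sub>0 \<longrightarrow> dist (\<phi> s p') q' \<ge> \<theta>) \<and>
    (\<forall>z\<in>E'. infdist z K \<ge> \<eta> \<and> (\<exists>y\<in>E. \<exists>s\<in>{1/2..2 * real m}. z = \<phi> s y))"
proof -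
  \<comment> \<open>Step 0 is excluded: E is only known to have diameter at most \<delta>, so
    \<delta>/2 may already be exceeded there.\<close>
  define bad where "bad n \<longleftrightarrow> n \<ge> 1 \<and> (\<exists>y\<in>E. dist (\<phi> (real n) p) (pos p n y) > \<delta>/2)" for n
  define n where "n = (LEAST n. bad n)"
  have "bad m" using m by (auto simp: bad_def)
  then have bn: "bad n" and nm: "n \<le> m" unfolding n_def by (auto intro: LeastI Least_le)
  have ok: "dist (\<phi> (real k) p) (pos p k y) \<le> \<delta>/2" if "1 \<le> k" "k < n" "y \<in> E" for k y
  proof -
    have "\<not> bad k" by (rule not_less_Least) (use that in \<open>simp add: n_def\<close>)
    then show ?thesis using that unfolding bad_def by (meson not_le)
  qed
  obtain g where g: "\<And>y. y \<in> E \<Longrightarrow> g 0 y = 0" "\<And>y j. y \<in> E \<Longrightarrow> g j y - g (Suc j) y \<in> {1 - \<kappa>..1 + \<kappa>}"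
      "\<And>y z j. y \<in> E \<Longrightarrow> z \<in> E \<Longrightarrow> j \<le> N \<Longrightarrow> dist (\<phi> (g j y) y) (\<phi> (g j z) z) \<le> \<delta>"
    using hist unfolding history_def by blast
  have pX: "p \<in> X" using E by blast
  have ok': "dist (\<phi> (real k) p) (pos p k y) \<le> \<delta>" if "k < n" "y \<in> E" for k y
  proof (cases "k = 0")
    case True
    have "y \<in> X" using that E by blast
    then show ?thesis using g(3)[OF E(4) that(2), of 0] g(1) E(4) that(2) pX True by simp
  next
    case False
    then have "dist (\<phi> (real k) p) (pos p k y) \<le> \<delta>/2" using that by (intro ok) auto
    then show ?thesis using \<delta> by linarith
  qed
  have step: "evo p (Suc k) y - evo p k y \<in> {1 - \<kappa>..1 + \<kappa>}" if "k < n" "y \<in> E" for k y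
    using evo_step(1)[OF pX _ ok'[OF that]] that E by blast
  have n1: "n \<ge> 1" using bn by (simp add: bad_def)
  define x where "x = \<phi> (real n) p"
  have x: "x \<in> X" unfolding x_def by (rule flow_in[OF pX])
  define D where "D = pos p n ` E"
  have DH: "D \<subseteq> H x"
  proof
    fix z assume "z \<in> D"
    then obtain y where y: "y \<in> E" "z = pos p n y" by (auto simp: D_def)
    obtain k where k: "n = Suc k" using n1 by (cases n) auto
    have "pos p (Suc k) y \<in> H (\<phi> (real (Suc k)) p)"
      using y E k by (intro evo_step(2)[OF pX _ ok']) auto
    then show "z \<in> H x" by (simp only: y(2) x_def k)
  qed
  have contE: "continuous_on E (evo p n)" by (rule evo_continuous[OF pX E(1) ok'])
  have contp: "continuous_on E (pos p n)"
    unfolding pos_def by (intro flow_continuous contE continuous_intros) (use E in auto)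
  have D: "compact D" "connected D"
    unfolding D_def using contp E(2,3) by (auto intro: compact_continuous_image connected_continuous_image)
  have xD: "x \<in> D" unfolding D_def x_def using E(4) evo_self[OF pX] by (intro image_eqI[of _ _ p]) (simp add: pos_def)
  obtain y where y: "y \<in> D" "dist x y \<ge> \<delta>/2" using bn unfolding bad_def D_def x_def by (auto intro: less_imp_le)
  obtain E' p' q' where E': "E' \<subseteq> D" "compact E'" "connected E'" "p' \<in> E'" "q' \<in> E'"
      "\<forall>z\<in>E'. \<forall>w\<in>E'. dist z w \<le> \<delta>" "\<forall>z\<in>E'. infdist z K \<ge> \<eta>" "\<forall>s. \<bar>s\<bar> \<le> \<kappa>\<^sub>0 \<longrightarrow> dist (\<phi> s p') q' \<ge> \<theta>"
    using cut[unfolded cutting_def, rule_format, OF x DH D xD y] by (elim exE conjE) (rule that)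
  have "\<forall>z\<in>E'. \<exists>y. y \<in> E \<and> z = pos p n y" using E'(1) unfolding D_def by blast
  then obtain b where b: "\<And>z. z \<in> E' \<Longrightarrow> b z \<in> E" "\<And>z. z \<in> E' \<Longrightarrow> z = pos p n (b z)" by metis
  \<comment> \<open>The new clock runs back through the n steps from a chosen preimage
    \<open>b z\<close> and then through the old history, shifted so that the present is 0. At j = n
    the two branches agree, because both clocks vanish on E.\<close>
  define g' where "g' j z = (if j \<le> n then evo p (n - j) (b z) else g (j - n) (b z)) - evo p n (b z)" for j z
  have bX: "b z \<in> X" if "z \<in> E'" for z using b(1) that E by blast
  have flow_b: "\<phi> (s - evo p n (b z)) z = \<phi> s (b z)" if "z \<in> E'" for s z
  proof -
    have "\<phi> (s - evo p n (b z)) z = \<phi> (s - evo p n (b z)) (\<phi> (evo p n (b z)) (b z))"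
      using b(2)[OF that] by (simp add: pos_def)
    then show ?thesis using bX[OF that] by (simp add: flow_add)
  qed
  have "history N E'"
    unfolding history_def
  proof (intro exI[of _ g'] conjI ballI allI impI)
    fix z assume z: "z \<in> E'"
    show "g' 0 z = 0" by (simp add: g'_def)
    fix j
    show "g' j z - g' (Suc j) z \<in> {1 - \<kappa>..1 + \<kappa>}"
    proof (cases "j < n")
      case True
      then have "n - j = Suc (n - Suc j)" by simp
      then show ?thesis using step[of "n - Suc j" "b z"] b(1)[OF z] True by (simp add: g'_def)
    next
      case False
      then have "Suc j - n = Suc (j - n)" "(if j \<le> n then evo p (n - j) (b z) else g (j - n) (b z)) = g (j - n) (b z)"
        using g(1)[OF b(1)[OF z]] by auto
      then show ?thesis using g(2)[OF b(1)[OF z], of "j - n"] False by (simp add: g'_def)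
    qed
  next
    fix z w j assume z: "z \<in> E'" and w: "w \<in> E'" and j: "j \<le> N"
    \<comment> \<open>Closeness comes from the cut at j = 0, from the orbit of p as an intermediary
      for 1 \<le> j < n, and from the history of E for j \<ge> n.\<close>
    consider "j = 0" | "1 \<le> j" "j < n" | "n \<le> j" by linarith
    then show "dist (\<phi> (g' j z) z) (\<phi> (g' j w) w) \<le> \<delta>"
    proof cases
      case 1
      have "z \<in> X" "w \<in> X" using z w E'(1) DH H_in by blast+
      then show ?thesis using 1 E'(6) z w by (simp add: g'_def)
    next
      case 2
      have "\<phi> (g' j z) z = pos p (n - j) (b z)" "\<phi> (g' j w) w = pos p (n - j) (b w)"
        using 2 flow_b z w by (simp_all add: g'_def pos_def)
      moreover have "dist (\<phi> (real (n - j)) p) (pos p (n - j) (b z)) \<le> \<delta>/2"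
        using 2 b(1)[OF z] by (intro ok) auto
      moreover have "dist (\<phi> (real (n - j)) p) (pos p (n - j) (b w)) \<le> \<delta>/2"
        using 2 b(1)[OF w] by (intro ok) auto
      ultimately show ?thesis
        using dist_triangle3[of "pos p (n - j) (b z)" "pos p (n - j) (b w)" "\<phi> (real (n - j)) p"] by simp
    next
      case 3
      have "g' j v = g (j - n) (b v) - evo p n (b v)" if "v \<in> E'" for v
        using 3 g(1)[OF b(1)[OF that]] by (auto simp: g'_def)
      then have "\<phi> (g' j z) z = \<phi> (g (j - n) (b z)) (b z)" "\<phi> (g' j w) w = \<phi> (g (j - n) (b w)) (b w)"
        using flow_b z w by simp_all
      then show ?thesis using g(3)[OF b(1)[OF z] b(1)[OF w], of "j - n"] j by simp
    qed
  qed
  moreover have "\<exists>y\<in>E. \<exists>s\<in>{1/2..2 * real m}. z = \<phi> s y" if z: "z \<in> E'" for z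
  proof (intro bexI)
    have bound: "k \<le> n \<Longrightarrow> real k / 2 \<le> evo p k (b z) \<and> evo p k (b z) \<le> 2 * real k" for k
    proof (induction k)
      case (Suc k)
      then have "real k / 2 \<le> evo p k (b z)" "evo p k (b z) \<le> 2 * real k" by simp_all
      moreover have "1 - \<kappa> \<le> evo p (Suc k) (b z) - evo p k (b z)" "evo p (Suc k) (b z) - evo p k (b z) \<le> 1 + \<kappa>"
        using step[of k "b z"] Suc.prems b(1)[OF z] by (simp_all del: evo.simps)
      moreover have "real (Suc k) / 2 = real k / 2 + 1/2" "2 * real (Suc k) = 2 * real k + 2" by simp_all
      ultimately show ?case using \<kappa> by linarith
    qed simp
    show "z = \<phi> (evo p n (b z)) (b z)" using b(2)[OF z] by (simp add: pos_def)
    have "real n \<ge> 1" "real n \<le> real m" using n1 nm by simp_all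
    then show "evo p n (b z) \<in> {1/2..2 * real m}" using bound[of n] by auto
    show "b z \<in> E" by (rule b(1)[OF z])
  qed
  moreover have "E' \<subseteq> X" using E'(1) DH H_in by blast
  ultimately show ?thesis using E'(2-5,7,8) by blast
qed

end

section \<open>Minimal sets away from an invariant set\<close>

text \<open>Joins a forward and a backward clock at 0. The index of b counts steps into the past,
  hence the reversed difference.\<close>

lemma glue_sequences:
  fixes a b :: "nat \<Rightarrow> real"
  assumes "a 0 = 0" "b 0 = 0" "\<And>k. a (Suc k) - a k \<in> I" "\<And>k. b k - b (Suc k) \<in> I"
  defines "t \<equiv> \<lambda>n::int. if n \<ge> 0 then a (nat n) else b (nat (- n))"
  shows "t 0 = 0" "\<And>n. t (n + 1) - t n \<in> I"
proof -
  show "t 0 = 0" using assms by simp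
  fix n :: int
  show "t (n + 1) - t n \<in> I"
  proof (cases "n \<ge> 0")
    case True
    then have "nat (n + 1) = Suc (nat n)" by simp
    then show ?thesis using True assms(3)[of "nat n"] by (simp add: t_def)
  next
    case False
    define j where "j = nat (- n - 1)"
    have j: "nat (- n) = Suc j" using False by (simp add: j_def)
    have "t (n + 1) = b j"
    \<comment> \<open>At the seam n + 1 = 0 belongs to the branch of a, which agrees with b
      there.\<close>
    proof (cases "n = -1")
      case True
      then show ?thesis using assms(1,2) by (simp add: t_def j_def)
    next
      case False
      then have "\<not> n + 1 \<ge> 0" using \<open>\<not> n \<ge> 0\<close> by simp
      moreover have "nat (- (n + 1)) = j" unfolding j_def by (rule arg_cong[of _ _ nat]) simp
      ultimately show ?thesis by (simp only: t_def if_False)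
    qed
    moreover have "t n = b (Suc j)" using False j by (simp add: t_def)
    ultimately show ?thesis using assms(4)[of j] by simp
  qed
qed

section \<open>Existence of minimal sets\<close>

context compact_flow
begin

lemma flow_invariant_iff:
  assumes "M \<subseteq> X"
  shows "flow_invariant \<phi> M \<longleftrightarrow> (\<forall>t. \<forall>x\<in>M. \<phi> t x \<in> M)"
proof
  assume "flow_invariant \<phi> M"
  then show "\<forall>t. \<forall>x\<in>M. \<phi> t x \<in> M" unfolding flow_invariant_def by blast
next
  assume inv: "\<forall>t. \<forall>x\<in>M. \<phi> t x \<in> M"
  show "flow_invariant \<phi> M" unfolding flow_invariant_def
  proof (intro allI equalityI subsetI)
    fix t x assume "x \<in> M"
    then have "\<phi> t (\<phi> (-t) x) = x" "\<phi> (-t) x \<in> M" using assms inv flow_inv(2) by auto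
    then show "x \<in> \<phi> t ` M" by (metis imageI)
  qed (use inv in blast)
qed

lemma minimal_subset_exists:
  assumes N: "N \<subseteq> X" "N \<noteq> {}" "compact N" "flow_invariant \<phi> N"
  shows "\<exists>M\<subseteq>N. minimal_subset X \<phi> M"
proof -
  define \<N> where "\<N> = {M. M \<subseteq> N \<and> M \<noteq> {} \<and> compact M \<and> flow_invariant \<phi> M}"
  have chain: "\<Inter>\<C> \<in> \<N>" if ne: "\<C> \<noteq> {}" and C: "\<C> \<subseteq> \<N>" and lin: "\<And>A B. A \<in> \<C> \<Longrightarrow> B \<in> \<C> \<Longrightarrow> A \<subseteq> B \<or> B \<subseteq> A" for \<C>
  proof -
    obtain A where A: "A \<in> \<C>" using ne by blast
    have fin: "\<exists>B\<in>\<C>. B \<subseteq> \<Inter>\<F>" if "finite \<F>" "\<F> \<subseteq> \<C>" for \<F>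
      using that
    proof (induction \<F> rule: finite_induct)
      case empty
      then show ?case using A by blast
    next
      case (insert F \<F>)
      then obtain B where B: "B \<in> \<C>" "B \<subseteq> \<Inter>\<F>" by blast
      have "F \<in> \<C>" using insert.prems by blast
      then show ?case using lin[OF B(1)] B by (metis Inter_insert Int_subset_iff order.trans subset_refl)
    qed
    have comp: "compact B" if "B \<in> \<C>" for B using that C unfolding \<N>_def by blast
    have "A \<inter> \<Inter>\<C> \<noteq> {}"
    proof (rule compact_imp_fip)
      show "compact A" by (rule comp[OF A])
      show "closed B" if "B \<in> \<C>" for B using comp[OF that] by (rule compact_imp_closed)
      fix \<F> assume F: "finite \<F>" "\<F> \<subseteq> \<C>"
      then obtain B where "B \<in> \<C>" "B \<subseteq> \<Inter>(insert A \<F>)" using fin[of "insert A \<F>"] A by auto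
      moreover then have "B \<noteq> {}" using C unfolding \<N>_def by blast
      ultimately show "A \<inter> \<Inter>\<F> \<noteq> {}" unfolding Inter_insert by blast
    qed
    then have 1: "\<Inter>\<C> \<noteq> {}" by blast
    have 2: "\<Inter>\<C> \<subseteq> N" using A C unfolding \<N>_def by blast
    have "\<Inter>\<C> = A \<inter> \<Inter>\<C>" using A by blast
    then have 3: "compact (\<Inter>\<C>)"
      using compact_Int_closed[OF comp[OF A], of "\<Inter>\<C>"] closed_Inter[of \<C>] comp compact_imp_closed by metis
    have "\<phi> t x \<in> B" if "x \<in> \<Inter>\<C>" "B \<in> \<C>" for t x B
    proof -
      have "flow_invariant \<phi> B" using that(2) C unfolding \<N>_def by blast
      then show ?thesis using that unfolding flow_invariant_def by blast
    qed
    then have "flow_invariant \<phi> (\<Inter>\<C>)"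
      using 2 N(1) by (subst flow_invariant_iff) auto
    then show ?thesis using 1 2 3 unfolding \<N>_def by blast
  qed
  have "N \<in> \<N>" using N by (simp add: \<N>_def)
  \<comment> \<open>Passing to complements turns the maximal element given by Zorn's lemma into a
    minimal invariant set; unions of chains become intersections, nonempty by compactness.\<close>
  have "\<exists>M\<in>uminus ` \<N>. \<forall>B\<in>uminus ` \<N>. M \<subseteq> B \<longrightarrow> B = M"
  proof (rule subset_Zorn_nonempty)
    show "uminus ` \<N> \<noteq> {}" using \<open>N \<in> \<N>\<close> by blast
    fix \<C> assume C: "\<C> \<noteq> {}" "subset.chain (uminus ` \<N>) \<C>"
    have "\<Inter>(uminus ` \<C>) \<in> \<N>"
    proof (rule chain)
      show "uminus ` \<C> \<noteq> {}" using C by blast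
      show "uminus ` \<C> \<subseteq> \<N>" using C(2) unfolding subset.chain_def by force
      show "A \<subseteq> B \<or> B \<subseteq> A" if "A \<in> uminus ` \<C>" "B \<in> uminus ` \<C>" for A B
      proof -
        obtain U V where UV: "U \<in> \<C>" "V \<in> \<C>" "A = - U" "B = - V"
          using \<open>A \<in> uminus ` \<C>\<close> \<open>B \<in> uminus ` \<C>\<close> by blast
        then have "U \<subseteq> V \<or> V \<subseteq> U" using C(2) unfolding subset_chain_def by blast
        then show ?thesis using UV(3,4) by blast
      qed
    qed
    then have "- \<Inter>(uminus ` \<C>) \<in> uminus ` \<N>" by (rule imageI)
    moreover have "- \<Inter>(uminus ` \<C>) = \<Union>\<C>" by auto
    ultimately show "\<Union>\<C> \<in> uminus ` \<N>" by simp
  qed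
  then obtain M' where "M' \<in> uminus ` \<N>" and max: "\<forall>B\<in>uminus ` \<N>. M' \<subseteq> B \<longrightarrow> B = M'" by (elim bexE) (rule that)
  then obtain M where M1: "M \<in> \<N>" "M' = - M" by (elim imageE) (rule that)
  have M: "M \<in> \<N>" "\<And>B. B \<in> \<N> \<Longrightarrow> - M \<subseteq> - B \<Longrightarrow> - B = - M"
    using M1 max by (auto simp del: Compl_subset_Compl_iff)
  have "minimal_subset X \<phi> M"
    unfolding minimal_subset_def
  proof (intro conjI allI impI)
    fix B assume B: "B \<subseteq> M \<and> B \<noteq> {} \<and> compact B \<and> flow_invariant \<phi> B"
    then have "B \<in> \<N>" using M(1) unfolding \<N>_def by blast
    then have "- B = - M" using B by (intro M(2)) auto
    then show "B = M" by simp
  qed (use M(1) N(1) in \<open>auto simp: \<N>_def\<close>)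
  then show ?thesis using M(1) unfolding \<N>_def by blast
qed

text \<open>A limit of the points w n has its whole orbit at distance at least \<zeta> from K. All
  such points form a compact invariant set, which contains a minimal one.\<close>

lemma minimal_subset_avoiding:
  assumes \<zeta>: "\<zeta> > 0" and w: "\<And>n::nat. \<exists>w\<in>X. \<forall>t. \<bar>t\<bar> \<le> real n \<longrightarrow> infdist (\<phi> t w) K \<ge> \<zeta>"
  shows "\<exists>M. minimal_subset X \<phi> M \<and> M \<inter> K = {}"
proof -
  define N where "N = {x\<in>X. \<forall>t. infdist (\<phi> t x) K \<ge> \<zeta>}"
  obtain w where w: "\<And>n. w n \<in> X" "\<And>n t. \<bar>t\<bar> \<le> real n \<Longrightarrow> infdist (\<phi> t (w n)) K \<ge> \<zeta>" using w by metis
  have cont: "continuous_on X (\<lambda>x. infdist (\<phi> t x) K)" for t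
    by (intro continuous_on_infdist flow_continuous continuous_intros) auto
  have "\<forall>n. w n \<in> X" using w(1) by blast
  then obtain a r where a: "a \<in> X" and r: "strict_mono (r :: nat \<Rightarrow> nat)" and lim: "(w \<circ> r) \<longlonglongrightarrow> a"
    by (rule seq_compactE[OF compact_imp_seq_compact[OF compact_X]]) (rule that)
  have "infdist (\<phi> t a) K \<ge> \<zeta>" for t
  proof (rule LIMSEQ_le_const)
    show "(\<lambda>n. infdist (\<phi> t ((w \<circ> r) n)) K) \<longlonglongrightarrow> infdist (\<phi> t a) K"
      by (rule continuous_on_tendsto_compose[OF cont lim a]) (simp add: w(1))
    show "\<exists>M. \<forall>n\<ge>M. \<zeta> \<le> infdist (\<phi> t ((w \<circ> r) n)) K"
    proof (intro exI allI impI)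
      fix n assume "nat \<lceil>\<bar>t\<bar>\<rceil> \<le> n"
      then have "\<bar>t\<bar> \<le> real n" by linarith
      also have "n \<le> r n" by (rule seq_suble[OF r])
      finally show "\<zeta> \<le> infdist (\<phi> t ((w \<circ> r) n)) K" using w(2) by simp
    qed
  qed
  then have ne: "N \<noteq> {}" using a by (auto simp: N_def)
  have NX: "N \<subseteq> X" by (auto simp: N_def)
  have N_eq: "N = X \<inter> (\<Inter>t. X \<inter> (\<lambda>x. infdist (\<phi> t x) K) -` {\<zeta>..})" by (auto simp: N_def)
  have "closed (X \<inter> (\<lambda>x. infdist (\<phi> t x) K) -` {\<zeta>..})" for t
    by (rule continuous_closed_preimage[OF cont compact_imp_closed[OF compact_X]]) simp
  then have "compact N" unfolding N_eq by (intro compact_Int_closed[OF compact_X] closed_INT) auto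
  moreover have "flow_invariant \<phi> N"
    by (subst flow_invariant_iff[OF NX]) (simp add: N_def flow_add flow_in)
  ultimately obtain M where M: "M \<subseteq> N" "minimal_subset X \<phi> M"
    using minimal_subset_exists[OF NX ne] by blast
  have "x \<notin> K" if "x \<in> M" for x
  proof
    assume "x \<in> K"
    have "infdist (\<phi> 0 x) K \<ge> \<zeta>" "x \<in> X" using that M(1) by (auto simp: N_def)
    then show False using \<open>x \<in> K\<close> \<zeta> by simp
  qed
  then show ?thesis using M(2) by blast
qed

end

section \<open>Unbounded growth and forward tracking\<close>

context avoiding_flow
begin

text \<open>Were the earlier point within d of K, flowing forward for time t would bring z within
  \<eta>/2 of K, since K is invariant.\<close>

lemma backward_avoid:
  assumes \<eta>: "\<eta> > 0"
  shows "\<exists>\<zeta>>0. \<forall>z t. z \<in> X \<longrightarrow> 0 \<le> t \<longrightarrow> t \<le> b \<longrightarrow> infdist z K \<ge> \<eta> \<longrightarrow> infdist (\<phi> (- t) z) K \<ge> \<zeta>"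
proof -
  obtain d where d: "d > 0" "\<And>x y s t. x \<in> X \<Longrightarrow> y \<in> X \<Longrightarrow> \<bar>s\<bar> \<le> b \<Longrightarrow> \<bar>t\<bar> \<le> b \<Longrightarrow>
    \<bar>s - t\<bar> \<le> d \<Longrightarrow> dist x y \<le> d \<Longrightarrow> dist (\<phi> s x) (\<phi> t y) \<le> \<eta>/2"
    by (rule flow_uniform[of "\<eta>/2" b]) (use \<eta> in auto)
  have "infdist (\<phi> (- t) z) K \<ge> d" if z: "z \<in> X" "0 \<le> t" "t \<le> b" "infdist z K \<ge> \<eta>" for z t
  proof (rule ccontr)
    assume neg: "\<not> ?thesis"
    have "\<exists>k\<in>K. dist (\<phi> (- t) z) k < d"
    proof (rule ccontr)
      assume "\<not> (\<exists>k\<in>K. dist (\<phi> (- t) z) k < d)"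
      then have "d \<le> infdist (\<phi> (- t) z) K"
        unfolding infdist_notempty[OF K_ne] by (intro cINF_greatest K_ne) (simp add: not_less)
      then show False using neg by blast
    qed
    then obtain k where k: "k \<in> K" "dist (\<phi> (- t) z) k < d" by blast
    have kX: "k \<in> X" using k(1) K_sub by blast
    have "dist (\<phi> t (\<phi> (- t) z)) (\<phi> t k) \<le> \<eta>/2"
      using k z kX d(1) by (intro d(2) flow_in) auto
    then have "dist z (\<phi> t k) \<le> \<eta>/2" using z by (simp add: flow_add)
    moreover have "\<phi> t k \<in> K" using K_inv k(1) by blast
    then have "infdist z K \<le> dist z (\<phi> t k)" by (rule infdist_le)
    ultimately show False using z(4) \<eta> by linarith
  qed
  then show ?thesis using d(1) by blast
qed

definition tracks_forward :: "'a \<Rightarrow> 'a \<Rightarrow> bool" where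
  "tracks_forward p q \<longleftrightarrow> (\<exists>u::nat \<Rightarrow> real. u 0 = 0 \<and> (\<forall>n. u (Suc n) - u n \<in> {1 - \<kappa>..1 + \<kappa>}) \<and>
     (\<forall>n. dist (\<phi> (real n) p) (\<phi> (u n) q) \<le> \<delta>))"

text \<open>If a sufficiently small continuum ever grew, \<open>advance\<close> could be repeated
  forever and would produce a minimal set off K. Under \<open>none\<close> its evolution therefore
  stays \<delta>-close at all steps, and \<open>evo\<close> is the required clock.\<close>

lemma forward_tracking:
  assumes none: "\<not> (\<exists>M. minimal_subset X \<phi> M \<and> M \<inter> K = {})"
  shows "\<exists>r>0. \<forall>C p q. C \<subseteq> X \<and> compact C \<and> connected C \<and> p \<in> C \<and> q \<in> C \<and>
    (\<forall>y\<in>C. \<forall>z\<in>C. dist y z \<le> r) \<longrightarrow> tracks_forward p q"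
proof -
  obtain \<eta> \<theta> where \<eta>: "\<eta> > 0" and \<theta>: "\<theta> > 0" and cut: "cutting \<eta> \<theta>" using cutting_exists by blast
  obtain N :: nat where "\<forall>x\<in>X. \<forall>y\<in>X. \<forall>t u :: int \<Rightarrow> real. (\<forall>s. \<bar>s\<bar> \<le> \<kappa>\<^sub>0 \<longrightarrow> dist (\<phi> s x) y \<ge> \<theta>) \<longrightarrow>
    t 0 = 0 \<longrightarrow> u 0 = 0 \<longrightarrow> (\<forall>n. t (n + 1) - t n \<in> {1 - \<kappa>..1 + \<kappa>}) \<longrightarrow> (\<forall>n. u (n + 1) - u n \<in> {1 - \<kappa>..1 + \<kappa>}) \<longrightarrow>
    (\<exists>n\<in>{- int N..int N}. dist (\<phi> (t n) x) (\<phi> (u n) y) > \<delta>)"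
    using separation_time[OF \<theta>] by (elim exE) (rule that)
  note N = this[rule_format]
  obtain \<zeta> where \<zeta>: "\<zeta> > 0" "\<And>z t. z \<in> X \<Longrightarrow> 0 \<le> t \<Longrightarrow> t \<le> 2 * real N \<Longrightarrow> infdist z K \<ge> \<eta> \<Longrightarrow> infdist (\<phi> (- t) z) K \<ge> \<zeta>"
    using backward_avoid[OF \<eta>, of "2 * real N"] by blast
  define state where "state E p q \<longleftrightarrow> E \<subseteq> X \<and> compact E \<and> connected E \<and> p \<in> E \<and> q \<in> E \<and> history N E \<and>
      (\<forall>s. \<bar>s\<bar> \<le> \<kappa>\<^sub>0 \<longrightarrow> dist (\<phi> s p) q \<ge> \<theta>)" for E p q
  \<comment> \<open>Otherwise p and q would be close at the N backward steps of the history and at N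
    forward steps, although they are not on a common short orbit arc.\<close>
  have escape: "\<exists>m y. 1 \<le> m \<and> m \<le> N \<and> y \<in> E \<and> dist (\<phi> (real m) p) (pos p m y) > \<delta>/2" if st: "state E p q" for E p q
  proof (rule ccontr)
    assume contr: "\<not> ?thesis"
    have E: "E \<subseteq> X" "p \<in> E" "q \<in> E" and sep: "\<And>s. \<bar>s\<bar> \<le> \<kappa>\<^sub>0 \<Longrightarrow> dist (\<phi> s p) q \<ge> \<theta>"
      using st unfolding state_def by blast+
    have X: "p \<in> X" "q \<in> X" using E by blast+
    obtain g where g: "\<And>y. y \<in> E \<Longrightarrow> g 0 y = 0" "\<And>y j. y \<in> E \<Longrightarrow> g j y - g (Suc j) y \<in> {1 - \<kappa>..1 + \<kappa>}"
      "\<And>y z j. y \<in> E \<Longrightarrow> z \<in> E \<Longrightarrow> j \<le> N \<Longrightarrow> dist (\<phi> (g j y) y) (\<phi> (g j z) z) \<le> \<delta>"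
      using st unfolding state_def history_def by blast
    have ok: "dist (\<phi> (real k) p) (pos p k q) \<le> \<delta>" if "k \<le> N" for k
    proof (cases "k = 0")
      case True
      then show ?thesis using g(3)[OF E(2,3), of 0] g(1)[OF E(2)] g(1)[OF E(3)] X by simp
    next
      case False
      then have "1 \<le> k" by simp
      then have "\<not> dist (\<phi> (real k) p) (pos p k q) > \<delta>/2" using contr that E(3) by blast
      then show ?thesis using \<delta> by linarith
    qed
    \<comment> \<open>Beyond N nothing is known about the evolution of q, so the clock continues by
      unit steps. \<open>N\<close> requires a clock on all integers but inspects only -N to
      N.\<close>
    define e where "e k = (if k \<le> N then evo p k q else evo p N q + real (k - N))" for k
    have e: "e 0 = 0" "e (Suc k) - e k \<in> {1 - \<kappa>..1 + \<kappa>}" for k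
    proof -
      show "e (Suc k) - e k \<in> {1 - \<kappa>..1 + \<kappa>}"
      proof (cases "Suc k \<le> N")
        case True
        then show ?thesis using evo_step(1)[OF X ok, of k] by (simp add: e_def del: evo.simps)
      next
        case False
        then have "e (Suc k) = evo p N q + real (Suc k - N)" "e k = evo p N q + real (k - N)" "N \<le> k"
          by (cases "k = N"; simp add: e_def)+
        then have "e (Suc k) - e k = 1" by simp
        then show ?thesis using \<kappa> by simp
      qed
    qed (simp add: e_def)
    define t where "t = (\<lambda>n::int. if n \<ge> 0 then real (nat n) else g (nat (- n)) p)"
    define u where "u = (\<lambda>n::int. if n \<ge> 0 then e (nat n) else g (nat (- n)) q)"
    have t: "t 0 = 0" "t (n + 1) - t n \<in> {1 - \<kappa>..1 + \<kappa>}" for n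
      unfolding t_def
      by (rule glue_sequences[where a = real and I = "{1 - \<kappa>..1 + \<kappa>}"]; use g E \<kappa> in simp)+
    have u: "u 0 = 0" "u (n + 1) - u n \<in> {1 - \<kappa>..1 + \<kappa>}" for n
      unfolding u_def
      by (rule glue_sequences[where a = e and I = "{1 - \<kappa>..1 + \<kappa>}"]; use g E e in simp)+
    have "dist (\<phi> (t n) p) (\<phi> (u n) q) \<le> \<delta>" if n: "n \<in> {- int N..int N}" for n
    proof (cases "n \<ge> 0")
      case True
      then have "nat n \<le> N" using n by simp
      then show ?thesis using ok[of "nat n"] True by (simp add: t_def u_def e_def pos_def)
    next
      case False
      then show ?thesis using g(3)[OF E(2,3), of "nat (- n)"] n by (simp add: t_def u_def)
    qed
    moreover have "\<exists>n\<in>{- int N..int N}. dist (\<phi> (t n) p) (\<phi> (u n) q) > \<delta>"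
      by (rule N[OF X sep t(1) u(1) t(2) u(2)])
    ultimately show False by (meson not_le)
  qed
  \<comment> \<open>The strict bound makes n = 0 vacuous. Each round gains at least 1/2, the least
    time by which \<open>advance\<close> moves a point.\<close>
  have long: "\<exists>E' p' q'. state E' p' q' \<and> (\<forall>z\<in>E'. \<forall>t. 0 \<le> t \<longrightarrow> t < real n / 2 \<longrightarrow> infdist (\<phi> (- t) z) K \<ge> \<zeta>)"
    if st: "state E p q" for E p q n
  proof (induction n)
    case 0
    then show ?case using st by fastforce
  next
    case (Suc n)
    then obtain E p q where E: "state E p q" and av: "\<And>z t. z \<in> E \<Longrightarrow> 0 \<le> t \<Longrightarrow> t < real n / 2 \<Longrightarrow> infdist (\<phi> (- t) z) K \<ge> \<zeta>"
      by blast
    obtain m y where m: "1 \<le> m" "m \<le> N" "y \<in> E" "dist (\<phi> (real m) p) (pos p m y) > \<delta>/2"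
      using escape[OF E] by blast
    have E': "E \<subseteq> X" "compact E" "connected E" "p \<in> E" "history N E" using E unfolding state_def by blast+
    obtain F p' q' where F: "F \<subseteq> X" "compact F" "connected F" "p' \<in> F" "q' \<in> F" "history N F"
        "\<forall>s. \<bar>s\<bar> \<le> \<kappa>\<^sub>0 \<longrightarrow> dist (\<phi> s p') q' \<ge> \<theta>"
        "\<forall>z\<in>F. infdist z K \<ge> \<eta> \<and> (\<exists>y\<in>E. \<exists>s\<in>{1/2..2 * real m}. z = \<phi> s y)"
      using advance[OF cut E' m(1,3,4)] by (elim exE conjE) (rule that)
    have "infdist (\<phi> (- t) z) K \<ge> \<zeta>" if z: "z \<in> F" and t: "0 \<le> t" "t < real (Suc n) / 2" for z t
    proof -
      have zX: "z \<in> X" using z F(1) by blast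
      obtain y s where ys: "y \<in> E" "1/2 \<le> s" "s \<le> 2 * real m" "z = \<phi> s y"
      proof -
        have "\<exists>y\<in>E. \<exists>s\<in>{1/2..2 * real m}. z = \<phi> s y" using F(8) z by blast
        then show thesis by (elim bexE) (rule that, auto)
      qed
      show ?thesis
      \<comment> \<open>Either the backward time stays within the last round, which lasts at most 2
        N, or it reaches past the preimage in E, where the induction hypothesis applies.\<close>
      proof (cases "t \<le> s")
        case True
        have "real m \<le> real N" using m(2) by simp
        then have "t \<le> 2 * real N" using True ys(3) by linarith
        then show ?thesis using F(8) z t(1) zX by (intro \<zeta>(2)) auto
      next
        case False
        have "y \<in> X" using ys(1) E'(1) by blast
        then have "\<phi> (- t) z = \<phi> (- (t - s)) y" using ys(4) by (simp add: flow_add)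
        moreover have "t - s < real n / 2" using t(2) ys(2) by (simp add: field_simps)
        ultimately show ?thesis using av[OF ys(1), of "t - s"] False by simp
      qed
    qed
    moreover have "state F p' q'" using F unfolding state_def by blast
    ultimately show ?case by blast
  qed
  have conclude: "\<exists>M. minimal_subset X \<phi> M \<and> M \<inter> K = {}" if st: "state E p q" for E p q
  proof (rule minimal_subset_avoiding[OF \<zeta>(1)])
    fix n :: nat
    \<comment> \<open>Avoidance along a past longer than 2 n, recentred at its point at time -n,
      covers the times from -n to n.\<close>
    obtain F p' q' where F: "state F p' q'" and av: "\<And>z t. z \<in> F \<Longrightarrow> 0 \<le> t \<Longrightarrow> t < real (4 * n + 1) / 2 \<Longrightarrow> infdist (\<phi> (- t) z) K \<ge> \<zeta>"
      using long[OF st, of "4 * n + 1"] by blast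
    have p': "p' \<in> F" "p' \<in> X" using F unfolding state_def by blast+
    show "\<exists>w\<in>X. \<forall>t. \<bar>t\<bar> \<le> real n \<longrightarrow> infdist (\<phi> t w) K \<ge> \<zeta>"
    proof (intro bexI allI impI)
      fix t :: real assume "\<bar>t\<bar> \<le> real n"
      then have t: "0 \<le> real n - t" "real n - t < real (4 * n + 1) / 2" by (simp_all add: field_simps)
      have "\<phi> t (\<phi> (- real n) p') = \<phi> (- (real n - t)) p'" using p' by (simp add: flow_add)
      then show "\<zeta> \<le> infdist (\<phi> t (\<phi> (- real n) p')) K" using av[OF p'(1) t] by simp
    qed (rule flow_in[OF p'(2)])
  qed
  obtain d where d: "d > 0" "\<And>x y s t. x \<in> X \<Longrightarrow> y \<in> X \<Longrightarrow> \<bar>s\<bar> \<le> real N \<Longrightarrow> \<bar>t\<bar> \<le> real N \<Longrightarrow>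
    \<bar>s - t\<bar> \<le> d \<Longrightarrow> dist x y \<le> d \<Longrightarrow> dist (\<phi> s x) (\<phi> t y) \<le> \<delta>"
    by (rule flow_uniform[OF \<delta>(1), of "real N"]) (rule that)
  show ?thesis
  proof (intro exI[of _ "min d \<delta>"] conjI allI impI)
    show "min d \<delta> > 0" using d \<delta> by simp
    fix C p q
    assume "C \<subseteq> X \<and> compact C \<and> connected C \<and> p \<in> C \<and> q \<in> C \<and> (\<forall>y\<in>C. \<forall>z\<in>C. dist y z \<le> min d \<delta>)"
    then have C: "C \<subseteq> X" "compact C" "connected C" "p \<in> C" "\<forall>y\<in>C. \<forall>z\<in>C. dist y z \<le> min d \<delta>" and q: "q \<in> C"
      by blast+
    have pX: "p \<in> X" "q \<in> X" using C q by blast+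
    have stay: "\<not> dist (\<phi> (real m) p) (pos p m y) > \<delta>/2" if m: "1 \<le> m" "y \<in> C" for m y
    proof
      assume exit: "dist (\<phi> (real m) p) (pos p m y) > \<delta>/2"
      \<comment> \<open>For the initial continuum the constant-speed clock serves as history, since
        C is small enough for N backward steps.\<close>
      have "history N C"
        unfolding history_def
      proof (intro exI[of _ "\<lambda>j y. - real j"] conjI ballI allI impI)
        fix y z j assume "y \<in> C" "z \<in> C" "j \<le> N"
        then show "dist (\<phi> (- real j) y) (\<phi> (- real j) z) \<le> \<delta>" using C(1,5) d(1) by (intro d(2)) auto
      qed (use \<kappa> in auto)
      from advance[OF cut C(1-4) this m exit] obtain F p' q' where F: "F \<subseteq> X" "compact F" "connected F" "p' \<in> F" "q' \<in> F" "history N F"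
        "\<forall>s. \<bar>s\<bar> \<le> \<kappa>\<^sub>0 \<longrightarrow> dist (\<phi> s p') q' \<ge> \<theta>"
        by (elim exE conjE) (rule that)
      then have "state F p' q'" unfolding state_def by blast
      then show False using conclude none by blast
    qed
    have ok: "dist (\<phi> (real k) p) (pos p k q) \<le> \<delta>" for k
    proof (cases "k = 0")
      case True
      have "dist p q \<le> min d \<delta>" using q C by blast
      then show ?thesis using True pX by simp
    next
      case False
      then show ?thesis using stay[of k q] q \<delta> by simp
    qed
    show "tracks_forward p q"
      unfolding tracks_forward_def
    proof (intro exI[of _ "\<lambda>n. evo p n q"] conjI allI)
      show "evo p (Suc n) q - evo p n q \<in> {1 - \<kappa>..1 + \<kappa>}" for n by (rule evo_step(1)[OF pX ok])
      show "dist (\<phi> (real n) p) (\<phi> (evo p n q) q) \<le> \<delta>" for n using ok[of n] by (simp add: pos_def)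
    qed simp
  qed
qed

end

section \<open>Expansivity in discrete time\<close>

lemma strict_mono_surj_continuous:
  fixes f :: "real \<Rightarrow> real"
  assumes "strict_mono f" "surj f"
  shows "continuous_on UNIV f"
proof (rule continuous_onI_mono)
  show "open (range f)" using assms(2) by simp
  show "f x \<le> f y" if "x \<le> y" for x y using assms(1) that by (simp add: strict_mono_less_eq)
qed

lemma strict_mono_surj_in_Rep:
  assumes "strict_mono h" "surj h" "h 0 = 0"
  shows "h \<in> Rep"
proof -
  have inj: "inj h" using assms(1) by (rule strict_mono_imp_inj_on)
  have inv: "inv h (h x) = x" "h (inv h x) = x" for x
    using inj assms(2) by (simp_all add: surj_f_inv_f)
  have "strict_mono (inv h)"
  proof (rule strict_monoI)
    fix x y :: real assume "x < y"
    then show "inv h x < inv h y" using assms(1) inv(2) by (metis strict_mono_less)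
  qed
  moreover have "surj (inv h)" using inj by (rule inj_imp_surj_inv)
  ultimately have "homeomorphism UNIV UNIV h (inv h)"
    using assms inv strict_mono_surj_continuous unfolding homeomorphism_def by auto
  then show ?thesis using assms unfolding Rep_def by blast
qed

definition interpolate :: "(int \<Rightarrow> real) \<Rightarrow> real \<Rightarrow> real" where
  "interpolate t v = t \<lfloor>v\<rfloor> + frac v * (t (\<lfloor>v\<rfloor> + 1) - t \<lfloor>v\<rfloor>)"

lemma interpolate_int [simp]: "interpolate t (of_int n) = t n"
  by (simp add: interpolate_def)

context
  fixes t :: "int \<Rightarrow> real"
  assumes inc: "\<And>n. t (n + 1) - t n \<ge> 1/2"
begin

lemma increments_mono: "m \<le> n \<Longrightarrow> t n - t m \<ge> real_of_int (n - m) / 2"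
proof (induction n rule: int_ge_induct)
  case (step i)
  then show ?case using inc[of i] by simp
qed simp

lemma interpolate_strict_mono: "strict_mono (interpolate t)"
proof (rule strict_monoI)
  fix v w :: real assume vw: "v < w"
  have pos: "t (n + 1) - t n > 0" for n using inc[of n] by linarith
  show "interpolate t v < interpolate t w"
  proof (cases "\<lfloor>v\<rfloor> = \<lfloor>w\<rfloor>")
    case True
    then have "frac v < frac w" using vw by (simp add: frac_def)
    then show ?thesis using True pos[of "\<lfloor>w\<rfloor>"] by (simp add: interpolate_def)
  next
    case False
    then have fl: "\<lfloor>v\<rfloor> + 1 \<le> \<lfloor>w\<rfloor>" using vw floor_mono[of v w] by linarith
    have "frac v * (t (\<lfloor>v\<rfloor> + 1) - t \<lfloor>v\<rfloor>) < 1 * (t (\<lfloor>v\<rfloor> + 1) - t \<lfloor>v\<rfloor>)"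
      by (intro mult_strict_right_mono frac_lt_1 pos)
    then have "interpolate t v < t (\<lfloor>v\<rfloor> + 1)" by (simp add: interpolate_def)
    also have "\<dots> \<le> t \<lfloor>w\<rfloor>" using increments_mono[OF fl] fl by simp
    also have "\<dots> \<le> interpolate t w" using pos[of "\<lfloor>w\<rfloor>"] by (simp add: interpolate_def)
    finally show ?thesis .
  qed
qed

lemma interpolate_surj: "surj (interpolate t)"
  unfolding surj_def
proof
  fix y :: real
  \<comment> \<open>Increments are at least 1/2, so this many steps back from 0 the sequence is
    below y; y is then bracketed at the first later index exceeding it.\<close>
  define a where "a = - (nat \<lceil>2 * \<bar>y - t 0\<bar>\<rceil> + 1 :: int)"
  have "real (nat \<lceil>2 * \<bar>y - t 0\<bar>\<rceil>) \<ge> 2 * \<bar>y - t 0\<bar>" by (rule real_nat_ceiling_ge)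
  then have "real_of_int (0 - a) / 2 \<ge> \<bar>y - t 0\<bar>" by (simp add: a_def) linarith
  moreover have "a \<le> 0" unfolding a_def by linarith
  then have "t 0 - t a \<ge> real_of_int (0 - a) / 2" by (rule increments_mono)
  ultimately have a: "t a \<le> y" by linarith
  obtain m :: nat where m: "2 * (y - t a) < real m" using reals_Archimedean2 by blast
  have "t (a + int m) - t a \<ge> real_of_int (a + int m - a) / 2" by (rule increments_mono) simp
  then have "real m / 2 \<le> t (a + int m) - t a" by simp
  then have "y < t (a + int m)" using m by argo
  then have ex: "\<exists>k::nat. y < t (a + int k)" by blast
  define k where "k = (LEAST k::nat. y < t (a + int k))"
  have k: "y < t (a + int k)" unfolding k_def by (rule LeastI_ex[OF ex])
  have "k \<noteq> 0" using k a by (intro notI) simp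
  then obtain j where j: "k = Suc j" by (cases k) auto
  have "\<not> y < t (a + int j)" by (rule not_less_Least) (use j in \<open>simp add: k_def\<close>)
  define n where "n = a + int j"
  have n: "t n \<le> y" "y < t (n + 1)" using \<open>\<not> y < t (a + int j)\<close> k j by (simp_all add: n_def algebra_simps)
  define s where "s = (y - t n) / (t (n + 1) - t n)"
  have s: "0 \<le> s" "s < 1" "s * (t (n + 1) - t n) = y - t n" using n by (auto simp: s_def field_simps)
  have fl: "\<lfloor>of_int n + s\<rfloor> = n" using s by (simp add: floor_unique)
  then have fr: "frac (of_int n + s) = s" by (simp add: frac_def)
  have "interpolate t (of_int n + s) = y" unfolding interpolate_def fl fr s(3) by simp
  then show "\<exists>x. y = interpolate t x" by metis
qed

end

context compact_flow
begin

text \<open>The piecewise linear interpolations of t and u are increasing bijections, and h is the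
  second after the inverse of the first. Between two nodes the clocks drift apart by at most the
  difference of their increments, at most 2 \<kappa> \<le> d, so closeness at the nodes gives
  closeness at all times.\<close>

lemma discrete_expansive:
  assumes exp: "expansive_flow X \<phi>" and e: "\<epsilon> > 0"
  shows "\<exists>\<delta>>0. \<exists>\<kappa>>0. \<kappa> \<le> 1/2 \<and>
    (\<forall>x\<in>X. \<forall>y\<in>X. \<forall>t u :: int \<Rightarrow> real. t 0 = 0 \<and> u 0 = 0 \<and>
      (\<forall>n. t (n + 1) - t n \<in> {1 - \<kappa>..1 + \<kappa>}) \<and> (\<forall>n. u (n + 1) - u n \<in> {1 - \<kappa>..1 + \<kappa>}) \<and>
      (\<forall>n. dist (\<phi> (t n) x) (\<phi> (u n) y) \<le> \<delta>) \<longrightarrow> (\<exists>s. \<bar>s\<bar> \<le> \<epsilon> \<and> y = \<phi> s x))"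
proof -
  have "\<exists>\<delta>'>0. \<forall>x\<in>X. \<forall>y\<in>X. \<forall>h\<in>Rep.
        (\<forall>t. dist (\<phi> t x) (\<phi> (h t) y) \<le> \<delta>') \<longrightarrow> (\<exists>s\<in>{-\<epsilon>..\<epsilon>}. y = \<phi> s x)"
    using exp[unfolded expansive_flow_def, THEN spec, THEN mp, OF e] .
  then obtain \<delta>' where \<delta>': "\<delta>' > 0" "\<And>x y h. x \<in> X \<Longrightarrow> y \<in> X \<Longrightarrow> h \<in> Rep \<Longrightarrow>
      (\<And>t. dist (\<phi> t x) (\<phi> (h t) y) \<le> \<delta>') \<Longrightarrow> \<exists>s\<in>{-\<epsilon>..\<epsilon>}. y = \<phi> s x"
    by (elim exE conjE) (rule that, simp, blast)
  obtain d where d: "d > 0" "\<And>x y s t. x \<in> X \<Longrightarrow> y \<in> X \<Longrightarrow> \<bar>s\<bar> \<le> 2 \<Longrightarrow> \<bar>t\<bar> \<le> 2 \<Longrightarrow>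
    \<bar>s - t\<bar> \<le> d \<Longrightarrow> dist x y \<le> d \<Longrightarrow> dist (\<phi> s x) (\<phi> t y) \<le> \<delta>'"
    by (rule flow_uniform[OF \<delta>'(1), of 2]) (rule that)
  define \<kappa> where "\<kappa> = min (1/2) (d/2)"
  have \<kappa>: "\<kappa> > 0" "\<kappa> \<le> 1/2" "\<kappa> \<le> d/2" using d(1) by (auto simp: \<kappa>_def)
  show ?thesis
  proof (rule exI[of _ d], rule conjI[OF d(1)], rule exI[of _ \<kappa>], rule conjI[OF \<kappa>(1)], rule conjI[OF \<kappa>(2)],
      intro ballI allI impI)
    fix x y and t u :: "int \<Rightarrow> real"
    assume xy: "x \<in> X" "y \<in> X"
    assume "t 0 = 0 \<and> u 0 = 0 \<and> (\<forall>n. t (n + 1) - t n \<in> {1 - \<kappa>..1 + \<kappa>}) \<and>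
      (\<forall>n. u (n + 1) - u n \<in> {1 - \<kappa>..1 + \<kappa>}) \<and> (\<forall>n. dist (\<phi> (t n) x) (\<phi> (u n) y) \<le> d)"
    then have 0: "t 0 = 0" "u 0 = 0"
      and t: "\<And>n. t (n + 1) - t n \<in> {1 - \<kappa>..1 + \<kappa>}" and u: "\<And>n. u (n + 1) - u n \<in> {1 - \<kappa>..1 + \<kappa>}"
      and close: "\<And>n. dist (\<phi> (t n) x) (\<phi> (u n) y) \<le> d"
      by blast+
    have inc: "t (n + 1) - t n \<ge> 1/2" "u (n + 1) - u n \<ge> 1/2" for n
      using t[of n] u[of n] \<kappa>(2) unfolding atLeastAtMost_iff by linarith+
    let ?A = "interpolate t" and ?B = "interpolate u"
    define h where "h = ?B \<circ> inv ?A"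
    have A: "strict_mono ?A" "surj ?A" using interpolate_strict_mono interpolate_surj inc(1) by blast+
    have B: "strict_mono ?B" "surj ?B" using interpolate_strict_mono interpolate_surj inc(2) by blast+
    have injA: "inj ?A" using A(1) by (rule strict_mono_imp_inj_on)
    have hA: "h (?A v) = ?B v" for v unfolding h_def by (simp add: inv_f_f[OF injA])
    have "h \<in> Rep"
    proof (rule strict_mono_surj_in_Rep)
      show "strict_mono h"
      proof (rule strict_monoI)
        fix a b :: real assume "a < b"
        moreover obtain v w where vw: "a = ?A v" "b = ?A w" using A(2) by (metis surj_def)
        ultimately have "v < w" using A(1) by (simp add: strict_mono_less)
        then show "h a < h b" using B(1) by (simp add: vw hA strict_mono_less)
      qed
      show "surj h" unfolding h_def by (intro comp_surj inj_imp_surj_inv injA B(2))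
      show "h 0 = 0" using hA[of "of_int 0"] 0 by (simp only: interpolate_int)
    qed
    moreover have "dist (\<phi> a x) (\<phi> (h a) y) \<le> \<delta>'" for a
    proof -
      obtain v where v: "a = ?A v" using A(2) by (metis surj_def)
      define n where "n = \<lfloor>v\<rfloor>"
      define a' where "a' = frac v * (t (n + 1) - t n)"
      define b' where "b' = frac v * (u (n + 1) - u n)"
      have fr: "0 \<le> frac v" "frac v \<le> 1" using frac_lt_1[of v] by auto
      have tn: "0 \<le> t (n + 1) - t n" "t (n + 1) - t n \<le> 2" "0 \<le> u (n + 1) - u n" "u (n + 1) - u n \<le> 2"
        "\<bar>(t (n + 1) - t n) - (u (n + 1) - u n)\<bar> \<le> d"
        using t[of n] u[of n] \<kappa> unfolding atLeastAtMost_iff by linarith+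
      have a'b': "\<bar>a'\<bar> \<le> 2" "\<bar>b'\<bar> \<le> 2"
        using mult_mono[OF fr(2) tn(2)] mult_mono[OF fr(2) tn(4)] fr(1) tn by (auto simp: a'_def b'_def abs_mult)
      have "a' - b' = frac v * ((t (n + 1) - t n) - (u (n + 1) - u n))" by (simp add: a'_def b'_def algebra_simps)
      then have "\<bar>a' - b'\<bar> = frac v * \<bar>(t (n + 1) - t n) - (u (n + 1) - u n)\<bar>" using fr by (simp add: abs_mult)
      also have "\<dots> \<le> 1 * d" using fr tn by (intro mult_mono) auto
      finally have ab: "\<bar>a' - b'\<bar> \<le> d" by simp
      have "dist (\<phi> a' (\<phi> (t n) x)) (\<phi> b' (\<phi> (u n) y)) \<le> \<delta>'"
        using xy by (intro d(2) flow_in a'b' ab close)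
      moreover have "\<phi> a' (\<phi> (t n) x) = \<phi> a x" "\<phi> b' (\<phi> (u n) y) = \<phi> (h a) y"
        using xy unfolding v hA by (simp_all add: flow_add interpolate_def a'_def b'_def n_def add.commute)
      ultimately show ?thesis by simp
    qed
    ultimately obtain s where "s \<in> {-\<epsilon>..\<epsilon>}" "y = \<phi> s x" using \<delta>'(2)[OF xy] by blast
    then show "\<exists>s. \<bar>s\<bar> \<le> \<epsilon> \<and> y = \<phi> s x" by (intro exI[of _ s]) (auto simp: abs_le_iff)
  qed
qed

lemma flow_periodic:
  assumes x: "x \<in> X" and per: "\<phi> T x = x"
  shows "\<phi> (of_int k * T) x = x"
proof -
  have nat: "\<phi> (real n * T) x = x" for n
  proof (induction n)
    case (Suc n)
    have "\<phi> (real (Suc n) * T) x = \<phi> T (\<phi> (real n * T) x)" using x by (simp add: flow_add algebra_simps)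
    then show ?case using Suc per by simp
  qed (use x in simp)
  show ?thesis
  proof (cases "k \<ge> 0")
    case True
    then show ?thesis using nat[of "nat k"] by simp
  next
    case False
    have "\<phi> (of_int k * T) (\<phi> (real (nat (-k)) * T) x) = x" using False x by (simp add: flow_add)
    then show ?thesis using nat[of "nat (-k)"] by simp
  qed
qed

text \<open>If every T > 0 fixed some point, there would be points x n fixed by the time 1/(n + 1).
  A limit of these is a fixed point of the flow, against regularity; c then comes from a minimum
  over X.\<close>

lemma uniformly_moving_time:
  assumes reg: "regular_flow X \<phi>" and ne: "X \<noteq> {}"
  shows "\<exists>T>0. \<exists>c>0. \<forall>x\<in>X. dist (\<phi> T x) x \<ge> 4 * c"
proof -
  have "\<exists>T>0. \<forall>x\<in>X. \<phi> T x \<noteq> x"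
  proof (rule ccontr)
    assume contr: "\<not> ?thesis"
    have "\<forall>n. \<exists>x. x \<in> X \<and> \<phi> (inverse (real (Suc n))) x = x"
    proof
      fix n
      have "inverse (real (Suc n)) > 0" by simp
      then show "\<exists>x. x \<in> X \<and> \<phi> (inverse (real (Suc n))) x = x" using contr by blast
    qed
    then obtain x where x: "\<And>n. x n \<in> X" "\<And>n. \<phi> (inverse (real (Suc n))) (x n) = x n" by metis
    have "\<forall>n. x n \<in> X" using x by blast
    then obtain a r where a: "a \<in> X" and r: "strict_mono (r :: nat \<Rightarrow> nat)" and lim: "(x \<circ> r) \<longlonglongrightarrow> a"
      by (rule seq_compactE[OF compact_imp_seq_compact[OF compact_X]]) (rule that)
    have "\<phi> t a = a" for t
    proof -
      \<comment> \<open>The remainder of t modulo the period 1/(n + 1) of \<open>x n\<close>; it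
        tends to 0, so time t acts like time 0 in the limit.\<close>
      define e where "e n = t - of_int \<lfloor>t * real (Suc n)\<rfloor> * inverse (real (Suc n))" for n
      have e: "0 \<le> e n" "e n \<le> inverse (real (Suc n))" for n
      proof -
        have "e n = frac (t * real (Suc n)) * inverse (real (Suc n))"
          by (simp add: e_def frac_def field_simps)
        then show "0 \<le> e n" "e n \<le> inverse (real (Suc n))"
          using frac_lt_1[of "t * real (Suc n)"] by (auto intro!: mult_left_le_one_le simp del: of_nat_Suc)
      qed
      have "e \<longlonglongrightarrow> 0"
      proof (rule tendsto_sandwich[OF _ _ tendsto_const LIMSEQ_inverse_real_of_nat])
        show "\<forall>\<^sub>F n in sequentially. 0 \<le> e n" using e(1) by (intro always_eventually allI)
        show "\<forall>\<^sub>F n in sequentially. e n \<le> inverse (real (Suc n))" using e(2) by (intro always_eventually allI)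
      qed
      then have er: "(e \<circ> r) \<longlonglongrightarrow> 0" by (rule LIMSEQ_subseq_LIMSEQ[OF _ r])
      have eq: "\<phi> t (x n) = \<phi> (e n) (x n)" for n
      proof -
        have "\<phi> (e n) (\<phi> (of_int \<lfloor>t * real (Suc n)\<rfloor> * inverse (real (Suc n))) (x n)) = \<phi> t (x n)"
          using x(1) by (simp add: flow_add e_def)
        then show ?thesis using flow_periodic[OF x] by simp
      qed
      have "(\<lambda>n. \<phi> ((e \<circ> r) n) ((x \<circ> r) n)) \<longlonglongrightarrow> \<phi> 0 a" by (rule flow_tendsto[OF er lim _ a]) (simp add: x)
      moreover have "(\<lambda>n. \<phi> t ((x \<circ> r) n)) \<longlonglongrightarrow> \<phi> t a" by (rule flow_tendsto[OF tendsto_const lim _ a]) (simp add: x)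
      ultimately have "\<phi> t a = \<phi> 0 a" using eq LIMSEQ_unique by (simp add: o_def)
      then show ?thesis using a by simp
    qed
    then show False using reg a unfolding regular_flow_def by blast
  qed
  then obtain T where T: "T > 0" "\<And>x. x \<in> X \<Longrightarrow> \<phi> T x \<noteq> x" by blast
  have "continuous_on X (\<lambda>x. dist (\<phi> T x) x)" by (intro continuous_intros flow_continuous) auto
  then obtain w where w: "w \<in> X" "\<And>x. x \<in> X \<Longrightarrow> dist (\<phi> T w) w \<le> dist (\<phi> T x) x"
    using continuous_attains_inf[OF compact_X ne] by blast
  show ?thesis
    using T w by (intro exI[of _ T] conjI exI[of _ "dist (\<phi> T w) w / 4"]) auto
qed

end

section \<open>Time reversal and conclusion\<close>

lemma avoiding_flow_reverse:
  assumes "avoiding_flow X \<phi> T c \<kappa>\<^sub>0 \<kappa> \<rho> \<delta> K"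
  shows "avoiding_flow X (\<lambda>t. \<phi> (- t)) T c \<kappa>\<^sub>0 \<kappa> \<rho> \<delta> K"
proof -
  interpret avoiding_flow X \<phi> T c \<kappa>\<^sub>0 \<kappa> \<rho> \<delta> K by fact
  show ?thesis
  proof (unfold_locales)
    show "continuous_flow X (\<lambda>t. \<phi> (- t))"
      unfolding continuous_flow_def case_prod_beta
      by (intro conjI flow_continuous continuous_intros) (auto intro: flow_in simp: flow_add add.commute)
    show "4 * c \<le> dist (\<phi> (- T) x) x" if "x \<in> X" for x
      using far[OF flow_in[OF that, of "- T"]] that by (simp add: flow_add dist_commute)
    show "dist (\<phi> (- s) x) x \<le> c / 4" if "x \<in> X" "\<bar>s\<bar> \<le> \<kappa>\<^sub>0" for x s
      using near[of x "- s"] that by simp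
    show "dist (\<phi> (- s) x) (\<phi> (- s) y) \<le> 2 * c * \<kappa> / T" if "x \<in> X" "y \<in> X" "dist x y \<le> \<rho>" "\<bar>s\<bar> \<le> T" for x y s
      using \<rho>_close[of x y "- s"] that by simp
    show "dist (\<phi> (- s) x) (\<phi> (- s) y) \<le> \<rho>" if "x \<in> X" "y \<in> X" "dist x y \<le> \<delta>" "\<bar>s\<bar> \<le> 1" for x y s
      using \<delta>_close[of x y "- s"] that by simp
    show "\<phi> (- t) ` K \<subseteq> K" for t by (rule K_inv)
    fix x y and t u :: "int \<Rightarrow> real"
    assume xy: "x \<in> X" "y \<in> X" and 0: "t 0 = 0" "u 0 = 0"
      and t: "\<And>n. t (n + 1) - t n \<in> {1 - \<kappa>..1 + \<kappa>}" and u: "\<And>n. u (n + 1) - u n \<in> {1 - \<kappa>..1 + \<kappa>}"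
      and close: "\<And>n. dist (\<phi> (- t n) x) (\<phi> (- u n) y) \<le> \<delta>"
    \<comment> \<open>For the original flow the clock runs through the times -t n, which decrease.
      Reversing the index as well restores increasing clocks with the same increments.\<close>
    have rev: "- v (- (n + 1)) - - v (- n) \<in> {1 - \<kappa>..1 + \<kappa>}" if "\<And>n. v (n + 1) - v n \<in> {1 - \<kappa>..1 + \<kappa>}" for v :: "int \<Rightarrow> real" and n
      using that[of "- n - 1"] by simp
    have "\<exists>s. \<bar>s\<bar> \<le> \<kappa>\<^sub>0 \<and> y = \<phi> s x"
    proof (rule expand[OF xy])
      show "- t (- (n + 1)) - - t (- n) \<in> {1 - \<kappa>..1 + \<kappa>}" for n by (rule rev[of t, OF t])
      show "- u (- (n + 1)) - - u (- n) \<in> {1 - \<kappa>..1 + \<kappa>}" for n by (rule rev[of u, OF u])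
      show "dist (\<phi> (- t (- n)) x) (\<phi> (- u (- n)) y) \<le> \<delta>" for n by (rule close)
    qed (simp_all add: 0)
    then obtain s where "\<bar>s\<bar> \<le> \<kappa>\<^sub>0" "y = \<phi> s x" by blast
    then show "\<exists>s. \<bar>s\<bar> \<le> \<kappa>\<^sub>0 \<and> y = \<phi> (- s) x" by (intro exI[of _ "- s"]) simp
  qed (use T c \<kappa>\<^sub>0 \<kappa> \<rho> \<delta> compact_X K_sub K_compact K_ne K_dim in auto)
qed

lemma minimal_subset_reverse:
  "minimal_subset X (\<lambda>t. \<phi> (- t)) M \<longleftrightarrow> minimal_subset X \<phi> M"
proof -
  have "flow_invariant (\<lambda>t. \<phi> (- t)) N \<longleftrightarrow> flow_invariant \<phi> N" for N
    unfolding flow_invariant_def by (metis minus_minus)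
  then show ?thesis unfolding minimal_subset_def by simp
qed

text \<open>The flow and its reverse each give a half clock for q against the integer clock of p.
  Glued at 0 they form the two-sided close pair that \<open>expand\<close> requires, so small
  continua lie on short orbit arcs.\<close>

lemma (in avoiding_flow) minimal_subset_disjoint:
  assumes dim: "\<not> covering_dim_le X 1"
  shows "\<exists>M. minimal_subset X \<phi> M \<and> M \<inter> K = {}"
proof (rule ccontr)
  assume contr: "\<not> ?thesis"
  interpret rev: avoiding_flow X "\<lambda>t. \<phi> (- t)" T c \<kappa>\<^sub>0 \<kappa> \<rho> \<delta> K
    by (rule avoiding_flow_reverse) unfold_locales
  obtain r where r: "r > 0" "\<And>C p q. C \<subseteq> X \<and> compact C \<and> connected C \<and> p \<in> C \<and> q \<in> C \<and>
      (\<forall>y\<in>C. \<forall>z\<in>C. dist y z \<le> r) \<Longrightarrow> tracks_forward p q"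
    using forward_tracking[OF contr] by (elim exE conjE) (rule that, auto)
  have contr': "\<not> (\<exists>M. minimal_subset X (\<lambda>t. \<phi> (- t)) M \<and> M \<inter> K = {})"
    using contr by (simp add: minimal_subset_reverse)
  obtain r' where r': "r' > 0" "\<And>C p q. C \<subseteq> X \<and> compact C \<and> connected C \<and> p \<in> C \<and> q \<in> C \<and>
      (\<forall>y\<in>C. \<forall>z\<in>C. dist y z \<le> r') \<Longrightarrow> rev.tracks_forward p q"
    using rev.forward_tracking[OF contr'] by (elim exE conjE) (rule that, auto)
  have "covering_dim_le X 1"
  proof (rule flow_dim_le_1[of "min r r'"])
    show "min r r' > 0" using r(1) r'(1) by simp
    fix C p q
    assume C: "C \<subseteq> X" "compact C" "connected C" "\<And>y z. y \<in> C \<Longrightarrow> z \<in> C \<Longrightarrow> dist y z \<le> min r r'" "p \<in> C" "q \<in> C"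
    have small: "\<forall>y\<in>C. \<forall>z\<in>C. dist y z \<le> r" "\<forall>y\<in>C. \<forall>z\<in>C. dist y z \<le> r'" using C(4) by auto
    have "tracks_forward p q" using r(2)[of C p q] C(1-3,5,6) small(1) by blast
    then obtain u :: "nat \<Rightarrow> real" where u: "u 0 = 0" "\<forall>n. u (Suc n) - u n \<in> {1 - \<kappa>..1 + \<kappa>}"
        "\<forall>n. dist (\<phi> (real n) p) (\<phi> (u n) q) \<le> \<delta>"
      unfolding tracks_forward_def by (elim exE conjE) (rule that)
    have "rev.tracks_forward p q" using r'(2)[of C p q] C(1-3,5,6) small(2) by blast
    then obtain v :: "nat \<Rightarrow> real" where v: "v 0 = 0" "\<forall>n. v (Suc n) - v n \<in> {1 - \<kappa>..1 + \<kappa>}"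
        "\<forall>n. dist (\<phi> (- real n) p) (\<phi> (- v n) q) \<le> \<delta>"
      unfolding rev.tracks_forward_def by (elim exE conjE) (rule that)
    define t where "t = (\<lambda>n::int. if n \<ge> 0 then real (nat n) else - real (nat (- n)))"
    define w where "w = (\<lambda>n::int. if n \<ge> 0 then u (nat n) else - v (nat (- n)))"
    have t: "t 0 = 0" "t (n + 1) - t n \<in> {1 - \<kappa>..1 + \<kappa>}" for n
      unfolding t_def
      by (rule glue_sequences[where a = real and b = "\<lambda>k. - real k" and I = "{1 - \<kappa>..1 + \<kappa>}"]; use \<kappa> in simp)+
    have w: "w 0 = 0" "w (n + 1) - w n \<in> {1 - \<kappa>..1 + \<kappa>}" for n
      unfolding w_def
      by (rule glue_sequences[where a = u and b = "\<lambda>k. - v k" and I = "{1 - \<kappa>..1 + \<kappa>}"]; use u v in simp)+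
    have "dist (\<phi> (t n) p) (\<phi> (w n) q) \<le> \<delta>" for n
      using u(3)[rule_format, of "nat n"] v(3)[rule_format, of "nat (- n)"]
      by (cases "n \<ge> 0") (simp_all add: t_def w_def)
    then show "\<exists>s. \<bar>s\<bar> \<le> \<kappa>\<^sub>0 \<and> q = \<phi> s p"
      using C(1,5,6) t w by (intro expand[of p q t w]) auto
  qed
  then show False using dim by blast
qed

theorem theorem4p7:
  fixes X K :: "'a::metric_space set" and \<phi> :: "real \<Rightarrow> 'a \<Rightarrow> 'a"
  assumes "compact X"
    and "\<not> covering_dim_le X 1"
    and "continuous_flow X \<phi>" and "regular_flow X \<phi>" and "expansive_flow X \<phi>"
    and "K \<subseteq> X" and "compact K" and "flow_invariant \<phi> K"
    and "covering_dim_le K 1" and "\<not> covering_dim_le K 0"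
  shows "\<exists>M. minimal_subset X \<phi> M \<and> M \<inter> K = {}"
proof -
  interpret compact_flow X \<phi> using assms by unfold_locales
  \<comment> \<open>The empty set has dimension at most 0 here, so the lower bound on the dimension
    of K makes K nonempty, as distances to K require.\<close>
  have "covering_dim_le {} 0" unfolding covering_dim_le_def by auto
  then have K_ne: "K \<noteq> {}" using assms(10) by blast
  then have "X \<noteq> {}" using assms(6) by blast
  then obtain T c where T: "T > 0" and c: "c > 0" and far: "\<And>x. x \<in> X \<Longrightarrow> dist (\<phi> T x) x \<ge> 4 * c"
    using uniformly_moving_time[OF assms(4)] by blast
  have "c / 4 > 0" using c by simp
  then obtain d where d: "d > 0" "\<And>x y s t. x \<in> X \<Longrightarrow> y \<in> X \<Longrightarrow> \<bar>s\<bar> \<le> 1 \<Longrightarrow> \<bar>t\<bar> \<le> 1 \<Longrightarrow>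
    \<bar>s - t\<bar> \<le> d \<Longrightarrow> dist x y \<le> d \<Longrightarrow> dist (\<phi> s x) (\<phi> t y) \<le> c / 4"
    by (rule flow_uniform[of _ 1]) (rule that)
  \<comment> \<open>This is fixed before expansivity is applied, because it serves there as
    \<epsilon>: the conclusion must be an arc short enough for \<open>H_unique\<close>.\<close>
  define \<kappa>\<^sub>0 where "\<kappa>\<^sub>0 = min d 1"
  have \<kappa>\<^sub>0: "\<kappa>\<^sub>0 > 0" "\<kappa>\<^sub>0 \<le> d" "\<kappa>\<^sub>0 \<le> 1" using d(1) by (auto simp: \<kappa>\<^sub>0_def)
  have near: "dist (\<phi> s x) x \<le> c / 4" if "x \<in> X" "\<bar>s\<bar> \<le> \<kappa>\<^sub>0" for x s
    using d(2)[of x x s 0] that \<kappa>\<^sub>0 d(1) by simp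
  obtain \<delta>\<^sub>1 \<kappa>\<^sub>1 where dk: "\<delta>\<^sub>1 > 0" "\<kappa>\<^sub>1 > 0" "\<kappa>\<^sub>1 \<le> 1/2" and expand: "(\<forall>x\<in>X. \<forall>y\<in>X. \<forall>t u :: int \<Rightarrow> real. t 0 = 0 \<and> u 0 = 0 \<and>
      (\<forall>n. t (n + 1) - t n \<in> {1 - \<kappa>\<^sub>1..1 + \<kappa>\<^sub>1}) \<and> (\<forall>n. u (n + 1) - u n \<in> {1 - \<kappa>\<^sub>1..1 + \<kappa>\<^sub>1}) \<and>
      (\<forall>n. dist (\<phi> (t n) x) (\<phi> (u n) y) \<le> \<delta>\<^sub>1) \<longrightarrow> (\<exists>s. \<bar>s\<bar> \<le> \<kappa>\<^sub>0 \<and> y = \<phi> s x))"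
    using discrete_expansive[OF assms(5) \<kappa>\<^sub>0(1)] by (elim exE conjE) (rule that)
  \<comment> \<open>Expansivity for clocks with tolerance \<open>\<kappa>\<^sub>1\<close> covers
    those with tolerance \<kappa>; the bound \<open>\<kappa>\<^sub>0 / 2\<close> makes hitting times
    unique. After \<kappa> come \<rho>, for which hitting times are at most \<kappa>, and \<delta>,
    for which one unit of time leads into the \<rho>-ball.\<close>
  define \<kappa> where "\<kappa> = min \<kappa>\<^sub>1 (\<kappa>\<^sub>0 / 2)"
  have \<kappa>: "0 < \<kappa>" "\<kappa> \<le> \<kappa>\<^sub>1" "\<kappa> \<le> \<kappa>\<^sub>0 / 2" using dk \<kappa>\<^sub>0 by (auto simp: \<kappa>_def)
  have "2 * c * \<kappa> / T > 0" using c \<kappa> T by simp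
  then obtain d' where d': "d' > 0" "\<And>x y s t. x \<in> X \<Longrightarrow> y \<in> X \<Longrightarrow> \<bar>s\<bar> \<le> T \<Longrightarrow> \<bar>t\<bar> \<le> T \<Longrightarrow>
    \<bar>s - t\<bar> \<le> d' \<Longrightarrow> dist x y \<le> d' \<Longrightarrow> dist (\<phi> s x) (\<phi> t y) \<le> 2 * c * \<kappa> / T"
    by (rule flow_uniform[of _ T]) (rule that)
  define \<rho> where "\<rho> = min d' (c / 4)"
  have \<rho>: "0 < \<rho>" "\<rho> \<le> d'" "\<rho> \<le> c / 4" using d' c by (auto simp: \<rho>_def)
  obtain d'' where d'': "d'' > 0" "\<And>x y s t. x \<in> X \<Longrightarrow> y \<in> X \<Longrightarrow> \<bar>s\<bar> \<le> 1 \<Longrightarrow> \<bar>t\<bar> \<le> 1 \<Longrightarrow>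
    \<bar>s - t\<bar> \<le> d'' \<Longrightarrow> dist x y \<le> d'' \<Longrightarrow> dist (\<phi> s x) (\<phi> t y) \<le> \<rho>"
    by (rule flow_uniform[OF \<rho>(1), of 1]) (rule that)
  define \<delta> where "\<delta> = min d'' (min \<delta>\<^sub>1 \<rho>)"
  have \<delta>: "0 < \<delta>" "\<delta> \<le> d''" "\<delta> \<le> \<delta>\<^sub>1" "\<delta> \<le> \<rho>" using d'' dk \<rho> by (auto simp: \<delta>_def)
  interpret avoiding_flow X \<phi> T c \<kappa>\<^sub>0 \<kappa> \<rho> \<delta> K
  proof unfold_locales
    show "dist (\<phi> s x) (\<phi> s y) \<le> 2 * c * \<kappa> / T" if "x \<in> X" "y \<in> X" "dist x y \<le> \<rho>" "\<bar>s\<bar> \<le> T" for x y s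
      using that \<rho> d'(1) by (intro d'(2)) auto
    show "dist (\<phi> s x) (\<phi> s y) \<le> \<rho>" if "x \<in> X" "y \<in> X" "dist x y \<le> \<delta>" "\<bar>s\<bar> \<le> 1" for x y s
      using that \<delta> d''(1) by (intro d''(2)) auto
    show "\<phi> t ` K \<subseteq> K" for t using assms(8) unfolding flow_invariant_def by blast
    fix x y and t u :: "int \<Rightarrow> real"
    assume xy: "x \<in> X" "y \<in> X" and 0: "t 0 = 0" "u 0 = 0"
      and t: "\<And>n. t (n + 1) - t n \<in> {1 - \<kappa>..1 + \<kappa>}" and u: "\<And>n. u (n + 1) - u n \<in> {1 - \<kappa>..1 + \<kappa>}"
      and close: "\<And>n. dist (\<phi> (t n) x) (\<phi> (u n) y) \<le> \<delta>"
    have sub: "{1 - \<kappa>..1 + \<kappa>} \<subseteq> {1 - \<kappa>\<^sub>1..1 + \<kappa>\<^sub>1}" using \<kappa> by auto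
    show "\<exists>s. \<bar>s\<bar> \<le> \<kappa>\<^sub>0 \<and> y = \<phi> s x"
    proof (rule expand[rule_format, OF xy], intro conjI allI)
      show "t (n + 1) - t n \<in> {1 - \<kappa>\<^sub>1..1 + \<kappa>\<^sub>1}" for n by (rule subsetD[OF sub t])
      show "u (n + 1) - u n \<in> {1 - \<kappa>\<^sub>1..1 + \<kappa>\<^sub>1}" for n by (rule subsetD[OF sub u])
      show "dist (\<phi> (t n) x) (\<phi> (u n) y) \<le> \<delta>\<^sub>1" for n by (rule order_trans[OF close \<delta>(3)])
    qed (rule 0)+
  qed (use T c far \<kappa>\<^sub>0 near \<kappa> dk \<rho> \<delta> assms K_ne in auto)
  show ?thesis by (rule minimal_subset_disjoint[OF assms(2)])
qed

end
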